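(* Let $M$ be a connected, simply connected, oriented smooth surface. A generic elliptic Lagrangian immersion of $M$ into $\mathbb{R}^4$ is uniquely determined, up to affine symplectic transformation, by its Fubini cubic form. That is: if $f:M\to\mathbb{R}^4$ is a generic elliptic Lagrangian immersion with Fubini cubic form $\mathcal{F}$, and $\widetilde f:M\to\mathbb{R}^4$ is any elliptic Lagrangian immersion with Fubini cubic form $\widetilde{\mathcal{F}}=\mathcal{F}$, then there exists an affine symplectic transformation $D\in\mathcal{S}(4,\mathbb{R})$ such that $\widetilde f=D\cdot f$.
   Context: Symplectic group. $\mathbb{R}^4$ carries the symplectic form $\Omega(X,Y)={}^tXJY$, $J=\begin{pmatrix}0&I_2\\-I_2&0\end{pmatrix}$. $\mathrm{Sp}(4,\mathbb{R})=\{\mathbf{X}\in\mathrm{GL}(4,\mathbb{R}):{}^t\mathbf{X}J\mathbf{X}=J\}$. The affine symplectic group $\mathcal{S}(4,\mathbb{R})=\mathbb{R}^4\rtimes\mathrm{Sp}(4,\mathbb{R})$ consists of the matrices $\mathbf{S}(P,\mathbf{X})=\begin{pmatrix}1&0\\P&\mathbf{X}\end{pmatrix}$, $P\in\mathbb{R}^4$, $\mathbf{X}\in\mathrm{Sp}(4,\mathbb{R})$, acting on $\mathbb{R}^4$ by $v\mapsto P+\mathbf{X}v$. Lagrangian immersions. A smooth immersion $f:M\to\mathbb{R}^4$ is Lagrangian if $f^*\Omega=0$. Its Gauss map $\mathcal{T}_f$ sends $q$ to the plane $df(T_qM)$, translated to the origin, with the orientation OPPOSITE to the one induced by $df$ from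 $M$; it takes values in the manifold $\Lambda_2^+$ of oriented Lagrangian 2-planes. A symplectic frame field along $f$ on an open connected set $U\subset M$ is a smooth map $\mathbf{S}=\mathbf{S}(f,\mathbf{X}):U\to\mathcal{S}(4,\mathbb{R})$; write $X_1,\dots,X_4$ for the columns of $\mathbf{X}$. Define real 1-forms on $U$ by $df=\sum_j\tau^jX_j$, $dX_j=\sum_i\theta^i_jX_i$, with $\theta=\begin{pmatrix}\alpha&\beta\\\gamma&-{}^t\alpha\end{pmatrix}$, where $\alpha=(\alpha^i_j)$ is $2\times2$ ($i$ row, $j$ column) and $\beta=(\beta^i_j)$, $\gamma=(\gamma^i_j)$ are symmetric $2\times2$. The frame is of first order if $\mathcal{T}_f=[X_1\wedge X_2]$ as oriented planes (equivalently $\tau^3=\tau^4=0$ and $\tau^1\wedge\tau^2<0$). $f$ is elliptic if its Gauss map is a spacelike immersion for the natural signature $(2,1)$ conformal structure of $\Lambda_2^+$, i.e. if for first order frames the quadratic form $g=-\gamma^1_1\gamma^2_2+(\gamma^2_1)^2$ is positive definite. The conformal class of $g$ does not depend on the first order frame; with the orientation of $M$ it defines the complex structure on $M$ induced by $f$. Higher order frames. A first order frame is of second order if $\gamma^1_1+\gamma^2_2=0$. For such a frame put $\omega=\tfrac12(\gamma^1_1-\gamma^2_2)+i\gamma^2_1$, $\tau=\tau^1-i\tau^2$, $\eta=\tfrac12(\alpha^1_1-\alpha^2_2)-\tfrac i2(\alpha^2_1+\alpha^1_2)$. Then $\omega$ is a nowhere zero $(1,0)$-form, $\tau=t\omega$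 with $t$ nowhere zero complex-valued, and $\eta=h\omega+\ell\bar\omega$ with $h$ complex-valued and $\ell$ real-valued. The frame is of third order if $\ell=0$. Adapted frames. A complex parameter $(U,z)$ on $M$ is a holomorphic chart $z:U\to\mathbb{C}$ on a maximal contractible open set $U$ ($U=M$ if $M$ is biholomorphic to $\mathbb{C}$ or the unit disk; $U=M$ minus a point if $M$ is the Riemann sphere). A third order frame on $U$ is adapted to $(U,z)$ if $\omega=dz$ and $\alpha^1_1+\alpha^2_2=\alpha^2_1-\alpha^1_2=0$; such frames exist, and for them $\tau=t\,dz$, $\eta=h\,dz$ with $t,h:U\to\mathbb{C}$ smooth. Invariant forms. The Fubini cubic form of $f$ is the complex-valued cubic differential $\mathcal{F}=\tau^2\omega$ (any second order frame); the normalized Hopf differential is $\mathcal{H}=|t|^{2/3}\eta\,\omega$ (any third order frame). Both are globally defined on $M$. If $\mathcal{H}$ never vanishes, define, with respect to any complex parameter and adapted frame, $$\mathcal{P}=\Big(\big(\bar h_z\,\bar h^{-1}\big)_{\bar z}-\big(h_{\bar z}\,h^{-1}\big)_z\Big)\,dz\,d\bar z,$$ which is independent of these choices (here $\bar h_z=\partial_z(\bar h)$). An elliptic Lagrangian immersion is generic if $\mathcal{H}(q)\ne0$ and $\mathcal{P}(q)\neq0$ for each $q\in M$. *)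

theory Defs
  imports "HOL-Analysis.Analysis"
begin

section \<open>The affine symplectic group\<close>

definition J4 :: "real^4^4" where
  "J4 = (\<chi> i j. if (i = 1 \<and> j = 3) \<or> (i = 2 \<and> j = 4) then 1
               else if (i = 3 \<and> j = 1) \<or> (i = 4 \<and> j = 2) then - 1 else 0)"

definition Omega :: "real^4 \<Rightarrow> real^4 \<Rightarrow> real" where
  "Omega v w = v \<bullet> (J4 *v w)"

definition Sp4 :: "(real^4^4) set" where
  "Sp4 = {X. invertible X \<and> transpose X ** J4 ** X = J4}"

text \<open>The pair \<open>(P, X)\<close> stands for the matrix with block rows \<open>(1, 0)\<close> and \<open>(P, X)\<close>.\<close>

definition affine_Sp4 :: "((real^4) \<times> (real^4^4)) set" where
  "affine_Sp4 = UNIV \<times> Sp4"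

definition affine_act :: "(real^4) \<times> (real^4^4) \<Rightarrow> real^4 \<Rightarrow> real^4" where
  "affine_act D v = fst D + snd D *v v"


section \<open>Oriented smooth surfaces\<close>

primrec Ck_on :: "nat \<Rightarrow> 'a::real_normed_vector set \<Rightarrow> ('a \<Rightarrow> 'b::real_normed_vector) \<Rightarrow> bool" where
  "Ck_on 0 S F \<longleftrightarrow> continuous_on S F"
| "Ck_on (Suc k) S F \<longleftrightarrow> (\<forall>x\<in>S. F differentiable (at x)) \<and>
     (\<forall>v. Ck_on k S (\<lambda>x. frechet_derivative F (at x) v))"

text \<open>Only used for open \<open>S\<close>.\<close>

definition smooth_on :: "'a::real_normed_vector set \<Rightarrow> ('a \<Rightarrow> 'b::real_normed_vector) \<Rightarrow> bool" where
  "smooth_on S F \<longleftrightarrow> (\<forall>k. Ck_on k S F)"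

text \<open>A chart is a domain together with a coordinate map into the real plane, which is written as
  \<^typ>\<open>complex\<close>; no complex structure is implied. The standard oriented basis is \<open>1, \<i>\<close>.\<close>

type_synonym 'a chart = "'a set \<times> ('a \<Rightarrow> complex)"

definition is_chart :: "'a::topological_space chart \<Rightarrow> bool" where
  "is_chart c \<longleftrightarrow> open (fst c) \<and> open (snd c ` fst c) \<and>
     homeomorphism (fst c) (snd c ` fst c) (snd c) (inv_into (fst c) (snd c))"

definition in_chart :: "'a chart \<Rightarrow> ('a \<Rightarrow> 'b) \<Rightarrow> complex \<Rightarrow> 'b" where
  "in_chart c F = F \<circ> inv_into (fst c) (snd c)"

text \<open>\<open>Im (cnj a * b)\<close> is the determinant of the real matrix with columns \<open>a, b\<close>.\<close>

definition oriented_transition :: "'a chart \<Rightarrow> 'a chart \<Rightarrow> bool" where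
  "oriented_transition c c' \<longleftrightarrow>
     smooth_on (snd c ` (fst c \<inter> fst c')) (in_chart c (snd c')) \<and>
     (\<forall>p \<in> snd c ` (fst c \<inter> fst c').
        Im (cnj (frechet_derivative (in_chart c (snd c')) (at p) 1) *
            frechet_derivative (in_chart c (snd c')) (at p) \<i>) > 0)"

text \<open>The surface is the union of the chart domains. Being Hausdorff and second countable comes from
  the type class of the ambient type, in which the surface is open.\<close>

definition carrier_of :: "'a chart set \<Rightarrow> 'a set" where
  "carrier_of A = (\<Union>c\<in>A. fst c)"

definition oriented_surface_atlas ::
    "'a::{t2_space, second_countable_topology} chart set \<Rightarrow> bool" where
  "oriented_surface_atlas A \<longleftrightarrow>
     (\<forall>c\<in>A. is_chart c) \<and> (\<forall>c\<in>A. \<forall>c'\<in>A. oriented_transition c c')"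

definition smooth_map :: "'a chart set \<Rightarrow> 'a set \<Rightarrow> ('a \<Rightarrow> 'b::real_normed_vector) \<Rightarrow> bool" where
  "smooth_map A U F \<longleftrightarrow> (\<forall>c\<in>A. smooth_on (snd c ` (fst c \<inter> U)) (in_chart c F))"

text \<open>A tangent vector at \<open>q\<close> is given by a chart around \<open>q\<close> and its components in that chart. Pairs
  over different charts may represent the same tangent vector; a 1-form is a function of a point and
  a tangent vector, and all forms below are built from differentials, so that they take the same
  value on all representatives.\<close>

type_synonym 'a tangent = "'a chart \<times> complex"

definition tangents :: "'a chart set \<Rightarrow> 'a \<Rightarrow> 'a tangent set" where
  "tangents A q = {u. fst u \<in> A \<and> q \<in> fst (fst u)}"

definition differential :: "('a \<Rightarrow> 'b::real_normed_vector) \<Rightarrow> 'a \<Rightarrow> 'a tangent \<Rightarrow> 'b" where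
  "differential F q u = frechet_derivative (in_chart (fst u) F) (at (snd (fst u) q)) (snd u)"


section \<open>Lagrangian immersions and symplectic frames\<close>

definition lagrangian_immersion :: "'a chart set \<Rightarrow> ('a \<Rightarrow> real^4) \<Rightarrow> bool" where
  "lagrangian_immersion A f \<longleftrightarrow>
     smooth_map A (carrier_of A) f \<and>
     (\<forall>q\<in>carrier_of A. \<forall>u\<in>tangents A q. differential f q u = 0 \<longrightarrow> snd u = 0) \<and>
     (\<forall>q\<in>carrier_of A. \<forall>c v w. (c, v) \<in> tangents A q \<longrightarrow> (c, w) \<in> tangents A q \<longrightarrow>
        Omega (differential f q (c, v)) (differential f q (c, w)) = 0)"

text \<open>The oriented plane \<open>[v \<and> w]\<close>, as the set of its positively oriented bases.\<close>

definition oriented_plane :: "real^4 \<Rightarrow> real^4 \<Rightarrow> ((real^4) \<times> (real^4)) set" where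
  "oriented_plane v w =
     {(a *\<^sub>R v + b *\<^sub>R w, c *\<^sub>R v + d *\<^sub>R w) | a b c d. a * d - b * c > 0}"

text \<open>The Gauss map at \<open>q\<close>, computed in a chart. The basis is taken in the order \<open>\<i>, 1\<close> since the
  plane carries the orientation opposite to that of the surface.\<close>

definition gauss_map :: "('a \<Rightarrow> real^4) \<Rightarrow> 'a chart \<Rightarrow> 'a \<Rightarrow> ((real^4) \<times> (real^4)) set" where
  "gauss_map f c q = oriented_plane (differential f q (c, \<i>)) (differential f q (c, 1))"

text \<open>A frame field \<open>(f, X)\<close> along \<open>f\<close> is given by its linear part \<open>X\<close>; values of \<open>X\<close> outside \<open>U\<close>
  are irrelevant.\<close>

definition symplectic_frame :: "'a::topological_space chart set \<Rightarrow> 'a set \<Rightarrow> ('a \<Rightarrow> real^4^4) \<Rightarrow> bool" where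
  "symplectic_frame A U X \<longleftrightarrow> open U \<and> connected U \<and> U \<subseteq> carrier_of A \<and>
     smooth_map A U X \<and> (\<forall>q\<in>U. X q \<in> Sp4)"

definition tau_form :: "('a \<Rightarrow> real^4) \<Rightarrow> ('a \<Rightarrow> real^4^4) \<Rightarrow> 'a \<Rightarrow> 'a tangent \<Rightarrow> real^4" where
  "tau_form f X q u = matrix_inv (X q) *v differential f q u"

definition theta_form :: "('a \<Rightarrow> real^4^4) \<Rightarrow> 'a \<Rightarrow> 'a tangent \<Rightarrow> real^4^4" where
  "theta_form X q u = matrix_inv (X q) ** differential X q u"

lemma Sp4_inv_right: "X \<in> Sp4 \<Longrightarrow> X ** matrix_inv X = mat 1"
  unfolding Sp4_def invertible_def matrix_inv_def by (metis (mono_tags, lifting) mem_Collect_eq someI_ex)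

lemma differential_eq_tau:
  assumes "X q \<in> Sp4"
  shows "differential f q u = (\<Sum>j\<in>UNIV. tau_form f X q u $ j *s column j (X q))"
proof -
  have "X q ** matrix_inv (X q) = mat 1"
    using assms by (rule Sp4_inv_right)
  then have "X q *v tau_form f X q u = differential f q u"
    by (simp add: tau_form_def matrix_vector_mul_assoc)
  then show ?thesis by (simp add: matrix_mult_sum)
qed

lemma differential_eq_theta:
  assumes "X q \<in> Sp4"
  shows "column j (differential X q u) = (\<Sum>i\<in>UNIV. theta_form X q u $ i $ j *s column i (X q))"
proof -
  have "X q ** matrix_inv (X q) = mat 1"
    using assms by (rule Sp4_inv_right)
  then have "X q ** theta_form X q u = differential X q u"
    by (simp add: theta_form_def matrix_mul_assoc)
  then have "column j (differential X q u) = X q *v column j (theta_form X q u)"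
    by (metis matrix_vector_mult_basis matrix_vector_mul_assoc)
  then show ?thesis by (simp add: matrix_mult_sum column_def)
qed

definition first_order_frame ::
    "'a::topological_space chart set \<Rightarrow> ('a \<Rightarrow> real^4) \<Rightarrow> 'a set \<Rightarrow> ('a \<Rightarrow> real^4^4) \<Rightarrow> bool" where
  "first_order_frame A f U X \<longleftrightarrow> symplectic_frame A U X \<and>
     (\<forall>q\<in>U. \<forall>c\<in>A. q \<in> fst c \<longrightarrow>
        gauss_map f c q = oriented_plane (column 1 (X q)) (column 2 (X q)))"

text \<open>In block form, \<open>\<alpha>\<close> consists of the entries \<open>$ i $ j\<close> of \<open>\<theta>\<close> and \<open>\<gamma>\<close> of the entries
  \<open>$ (i + 2) $ j\<close>, for \<open>i, j\<close> in \<open>{1, 2}\<close>.\<close>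

definition alpha_form :: "('a \<Rightarrow> real^4^4) \<Rightarrow> 4 \<Rightarrow> 4 \<Rightarrow> 'a \<Rightarrow> 'a tangent \<Rightarrow> real" where
  "alpha_form X i j q u = theta_form X q u $ i $ j"

definition gamma_form :: "('a \<Rightarrow> real^4^4) \<Rightarrow> 4 \<Rightarrow> 4 \<Rightarrow> 'a \<Rightarrow> 'a tangent \<Rightarrow> real" where
  "gamma_form X i j q u = theta_form X q u $ (i + 2) $ j"

definition g_form :: "('a \<Rightarrow> real^4^4) \<Rightarrow> 'a \<Rightarrow> 'a tangent \<Rightarrow> real" where
  "g_form X q u = - gamma_form X 1 1 q u * gamma_form X 2 2 q u + (gamma_form X 2 1 q u)\<^sup>2"

definition elliptic_immersion :: "'a::topological_space chart set \<Rightarrow> ('a \<Rightarrow> real^4) \<Rightarrow> bool" where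
  "elliptic_immersion A f \<longleftrightarrow> lagrangian_immersion A f \<and>
     (\<forall>U X. first_order_frame A f U X \<longrightarrow>
        (\<forall>q\<in>U. \<forall>u\<in>tangents A q. snd u \<noteq> 0 \<longrightarrow> g_form X q u > 0))"


section \<open>Higher order frames\<close>

definition second_order_frame ::
    "'a::topological_space chart set \<Rightarrow> ('a \<Rightarrow> real^4) \<Rightarrow> 'a set \<Rightarrow> ('a \<Rightarrow> real^4^4) \<Rightarrow> bool" where
  "second_order_frame A f U X \<longleftrightarrow> first_order_frame A f U X \<and>
     (\<forall>q\<in>U. \<forall>u\<in>tangents A q. gamma_form X 1 1 q u + gamma_form X 2 2 q u = 0)"

definition omega_c :: "('a \<Rightarrow> real^4^4) \<Rightarrow> 'a \<Rightarrow> 'a tangent \<Rightarrow> complex" where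
  "omega_c X q u = Complex ((gamma_form X 1 1 q u - gamma_form X 2 2 q u) / 2) (gamma_form X 2 1 q u)"

definition tau_c :: "('a \<Rightarrow> real^4) \<Rightarrow> ('a \<Rightarrow> real^4^4) \<Rightarrow> 'a \<Rightarrow> 'a tangent \<Rightarrow> complex" where
  "tau_c f X q u = Complex (tau_form f X q u $ 1) (- tau_form f X q u $ 2)"

definition eta_c :: "('a \<Rightarrow> real^4^4) \<Rightarrow> 'a \<Rightarrow> 'a tangent \<Rightarrow> complex" where
  "eta_c X q u = Complex ((alpha_form X 1 1 q u - alpha_form X 2 2 q u) / 2)
                         (- (alpha_form X 2 1 q u + alpha_form X 1 2 q u) / 2)"

definition t_coeff ::
    "'a chart set \<Rightarrow> ('a \<Rightarrow> real^4) \<Rightarrow> ('a \<Rightarrow> real^4^4) \<Rightarrow> 'a \<Rightarrow> complex" where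
  "t_coeff A f X q = (THE t. \<forall>u\<in>tangents A q. tau_c f X q u = t * omega_c X q u)"

definition eta_coeffs :: "'a chart set \<Rightarrow> ('a \<Rightarrow> real^4^4) \<Rightarrow> 'a \<Rightarrow> complex \<Rightarrow> real \<Rightarrow> bool" where
  "eta_coeffs A X q h l \<longleftrightarrow>
     (\<forall>u\<in>tangents A q. eta_c X q u = h * omega_c X q u + of_real l * cnj (omega_c X q u))"

definition third_order_frame ::
    "'a::topological_space chart set \<Rightarrow> ('a \<Rightarrow> real^4) \<Rightarrow> 'a set \<Rightarrow> ('a \<Rightarrow> real^4^4) \<Rightarrow> bool" where
  "third_order_frame A f U X \<longleftrightarrow> second_order_frame A f U X \<and>
     (\<forall>q\<in>U. \<exists>h. eta_coeffs A X q h 0)"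

definition h_coeff :: "'a chart set \<Rightarrow> ('a \<Rightarrow> real^4^4) \<Rightarrow> 'a \<Rightarrow> complex" where
  "h_coeff A X q = (THE h. \<exists>l. eta_coeffs A X q h l)"


section \<open>Complex parameters and adapted frames\<close>

text \<open>Holomorphic charts for the complex structure given by the conformal class of \<open>g\<close> and the
  orientation: positively oriented charts in which \<open>g\<close> is conformal to the euclidean metric.\<close>

definition holomorphic_chart ::
    "'a::topological_space chart set \<Rightarrow> ('a \<Rightarrow> real^4) \<Rightarrow> 'a chart \<Rightarrow> bool" where
  "holomorphic_chart A f c \<longleftrightarrow> is_chart c \<and> fst c \<subseteq> carrier_of A \<and>
     (\<forall>c'\<in>A. oriented_transition c c' \<and> oriented_transition c' c) \<and>
     (\<forall>V X. first_order_frame A f V X \<longrightarrow>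
        (\<forall>q\<in>fst c \<inter> V. \<exists>r>0. \<forall>u\<in>tangents A q.
           g_form X q u = r * (cmod (differential (snd c) q u))\<^sup>2))"

definition maximal_contractible_open :: "'a::topological_space set \<Rightarrow> 'a set \<Rightarrow> bool" where
  "maximal_contractible_open M U \<longleftrightarrow> open U \<and> contractible U \<and> U \<subseteq> M \<and>
     (\<forall>V. open V \<and> contractible V \<and> V \<subseteq> M \<and> U \<subseteq> V \<longrightarrow> V = U)"

definition complex_parameter ::
    "'a::topological_space chart set \<Rightarrow> ('a \<Rightarrow> real^4) \<Rightarrow> 'a chart \<Rightarrow> bool" where
  "complex_parameter A f c \<longleftrightarrow>
     holomorphic_chart A f c \<and> maximal_contractible_open (carrier_of A) (fst c)"

definition adapted_frame ::
    "'a::topological_space chart set \<Rightarrow> ('a \<Rightarrow> real^4) \<Rightarrow> 'a chart \<Rightarrow> ('a \<Rightarrow> real^4^4) \<Rightarrow> bool" where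
  "adapted_frame A f c X \<longleftrightarrow> third_order_frame A f (fst c) X \<and>
     (\<forall>q\<in>fst c. \<forall>u\<in>tangents A q.
        omega_c X q u = differential (snd c) q u \<and>
        alpha_form X 1 1 q u + alpha_form X 2 2 q u = 0 \<and>
        alpha_form X 2 1 q u - alpha_form X 1 2 q u = 0)"

definition d_z :: "'a chart \<Rightarrow> ('a \<Rightarrow> complex) \<Rightarrow> 'a \<Rightarrow> complex" where
  "d_z c F q = (differential F q (c, 1) - \<i> * differential F q (c, \<i>)) / 2"

definition d_zbar :: "'a chart \<Rightarrow> ('a \<Rightarrow> complex) \<Rightarrow> 'a \<Rightarrow> complex" where
  "d_zbar c F q = (differential F q (c, 1) + \<i> * differential F q (c, \<i>)) / 2"


section \<open>Invariant forms and generic immersions\<close>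

text \<open>A cubic or quadratic differential is given by its values on the diagonal. The value at \<open>q\<close> does
  not depend on the frame.\<close>

definition fubini_form ::
    "'a::topological_space chart set \<Rightarrow> ('a \<Rightarrow> real^4) \<Rightarrow> 'a \<Rightarrow> 'a tangent \<Rightarrow> complex" where
  "fubini_form A f q u = (THE v. \<exists>U X. second_order_frame A f U X \<and> q \<in> U \<and>
     v = (tau_c f X q u)\<^sup>2 * omega_c X q u)"

definition hopf_differential ::
    "'a::topological_space chart set \<Rightarrow> ('a \<Rightarrow> real^4) \<Rightarrow> 'a \<Rightarrow> 'a tangent \<Rightarrow> complex" where
  "hopf_differential A f q u = (THE v. \<exists>U X. third_order_frame A f U X \<and> q \<in> U \<and>
     v = of_real (cmod (t_coeff A f X q) powr (2/3)) * eta_c X q u * omega_c X q u)"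

text \<open>The coefficient of \<open>\<P>\<close> relative to \<open>dz d(cnj z)\<close>, for a complex parameter and an adapted frame.\<close>

definition P_coeff :: "'a chart set \<Rightarrow> 'a chart \<Rightarrow> ('a \<Rightarrow> real^4^4) \<Rightarrow> 'a \<Rightarrow> complex" where
  "P_coeff A c X q =
     (let h = h_coeff A X; hbar = (\<lambda>p. cnj (h p)) in
        d_zbar c (\<lambda>p. d_z c hbar p * inverse (hbar p)) q - d_z c (\<lambda>p. d_zbar c h p * inverse (h p)) q)"

text \<open>Whether \<open>\<P>\<close> vanishes at \<open>q\<close> does not depend on the complex parameter and the adapted frame
  around \<open>q\<close>, so it is tested on one such choice.\<close>

definition generic_immersion :: "'a::topological_space chart set \<Rightarrow> ('a \<Rightarrow> real^4) \<Rightarrow> bool" where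
  "generic_immersion A f \<longleftrightarrow> elliptic_immersion A f \<and>
     (\<forall>q\<in>carrier_of A. \<exists>u\<in>tangents A q. hopf_differential A f q u \<noteq> 0) \<and>
     (\<forall>q\<in>carrier_of A. \<exists>c X. complex_parameter A f c \<and> adapted_frame A f c X \<and> q \<in> fst c \<and>
        P_coeff A c X q \<noteq> 0)"

end

theory Submission
  imports Defs
begin

text \<open>For a Lagrangian immersion \<open>f\<close> the expression \<open>\<Omega>(df, d\<^sup>2f)\<close> is a symmetric cubic form, and the Fubini
  form is the complex form \<open>t\<^sup>2 dz\<^sup>3\<close> whose real part it is; the real part determines it. In a
  holomorphic coordinate put \<open>E = 2 f\<^sub>z / t\<close>, the vector \<open>X\<^sub>1 + \<i> X\<^sub>2\<close> of an adapted frame. Differentiating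
  the pairings of \<open>E\<close> with its derivatives shows that \<open>N = cnj E\<^sub>z\<close> completes \<open>E\<close> to a symplectic basis and
  that all structure functions are determined by \<open>t\<close>, except for the coefficient \<open>k\<close> of \<open>cnj E\<close> in
  \<open>dN(d/d cnj z)\<close>. Two immersions with the same \<open>t\<close> have coefficients whose difference \<open>D\<close> is
  antiholomorphic with \<open>h D\<close> real, and wherever \<open>D\<close> does not vanish this forces \<open>P = 0\<close>. Hence \<open>D = 0\<close>, both
  frames solve the same linear system, and the immersions differ by an affine symplectic map, locally
  and then, as this map is unique on every open set, globally. For the second immersion nothing but
  the existence of second order frames is needed, without which its Fubini form would be
  unspecified.\<close>

section \<open>Calculus of smooth functions\<close>

text \<open>The second immersion brings no coordinate and no adapted frame of its own, and none is
  constructed for it: \<open>E\<close> and \<open>N\<close> arise from the immersion and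
  \<open>t\<close> by differentiation alone. A chart that is holomorphic for \<open>f\<close> serves
  \<open>f'\<close> too, because what the computation needs of the conformal structure is that the
  real cubic form has no mixed term, and this is shared by both. Why a nonzero \<open>D\<close>
  forces \<open>P = 0\<close>: from h D = cnj (h D) one gets log h = log (cnj h) + log (cnj D) - log
  D. The mixed derivative d/dz d/dzbar kills both terms in D, since D is antiholomorphic. So a =
  (h_zbar / h)_z, the mixed derivative of log h, equals its conjugate, and the coefficient of P is
  cnj a - a. The invariant forms are definite descriptions, so frames must be compared before the
  forms have a value. For the Fubini form this rests on the fact that the real part of the cube of
  an orientation preserving linear map determines the cube. For the Hopf differential it is enough
  that vanishing at a point does not depend on the frame.\<close>

abbreviation pd :: "'a::real_normed_vector \<Rightarrow> ('a \<Rightarrow> 'b::real_normed_vector) \<Rightarrow> 'a \<Rightarrow> 'b" where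
  "pd v F x \<equiv> frechet_derivative F (at x) v"

lemma pd_eqI: "(F has_derivative F') (at x) \<Longrightarrow> pd v F x = F' v"
  using frechet_derivative_at by metis

lemma pd_cong_open:
  assumes "open S" "x \<in> S" "F differentiable at x" "\<And>y. y \<in> S \<Longrightarrow> F y = G y"
  shows "pd v F x = pd v G x" "G differentiable at x"
proof -
  show "pd v F x = pd v G x"
    using frechet_derivative_transform_within_open[OF assms(3,1,2,4)] by simp
  show "G differentiable at x"
    using assms has_derivative_transform_within_open unfolding differentiable_def by metis
qed

lemma Ck_on_subset: "Ck_on k S F \<Longrightarrow> T \<subseteq> S \<Longrightarrow> Ck_on k T F"
  by (induction k arbitrary: F) (auto intro: continuous_on_subset)

lemma Ck_on_cong:
  assumes "open S" "\<And>x. x \<in> S \<Longrightarrow> F x = G x" "Ck_on k S F"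
  shows "Ck_on k S G"
  using assms(2,3)
proof (induction k arbitrary: F G)
  case 0
  then show ?case using continuous_on_cong by (metis Ck_on.simps(1))
next
  case (Suc k)
  have d: "F differentiable at x" if "x \<in> S" for x using Suc.prems(2) that by simp
  have "Ck_on k S (pd v G)" for v
    using Suc.IH[of "pd v F" "pd v G"] pd_cong_open[OF assms(1) _ d Suc.prems(1)] Suc.prems(2) by simp
  then show ?case using pd_cong_open(2)[OF assms(1) _ d Suc.prems(1)] by simp
qed

lemma Ck_on_SucD: "Ck_on (Suc k) S F \<Longrightarrow> Ck_on k S F"
proof (induction k arbitrary: F)
  case 0
  then show ?case
    by (simp add: continuous_at_imp_continuous_on differentiable_imp_continuous_within)
next
  case (Suc k)
  then show ?case by (metis Ck_on.simps(2))
qed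

lemma Ck_on_local:
  assumes "\<And>x. x \<in> S \<Longrightarrow> \<exists>T. open T \<and> x \<in> T \<and> Ck_on k T F"
  shows "Ck_on k S F"
  using assms
proof (induction k arbitrary: F)
  case 0
  then show ?case
    by (metis Ck_on.simps(1) continuous_at_imp_continuous_on continuous_on_eq_continuous_at)
next
  case (Suc k)
  then show ?case by (metis Ck_on.simps(2))
qed

lemma Ck_on_const: "Ck_on k S (\<lambda>x. c)"
  by (induction k arbitrary: c) auto

lemma Ck_on_add:
  assumes "open S" "Ck_on k S F" "Ck_on k S G"
  shows "Ck_on k S (\<lambda>x. F x + G x)"
  using assms(2,3)
proof (induction k arbitrary: F G)
  case (Suc k)
  then have d: "F differentiable at x" "G differentiable at x" if "x \<in> S" for x using that by auto
  have "Ck_on k S (pd v (\<lambda>x. F x + G x))" for v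
  proof (rule Ck_on_cong[OF assms(1)])
    show "Ck_on k S (\<lambda>x. pd v F x + pd v G x)" using Suc by simp
    show "pd v F x + pd v G x = pd v (\<lambda>x. F x + G x) x" if "x \<in> S" for x
      using d[OF that, THEN frechet_derivative_works[THEN iffD1]]
      by (intro pd_eqI[symmetric] derivative_eq_intros) auto
  qed
  with d show ?case by auto
qed (auto intro: continuous_intros)

lemma Ck_on_linear:
  assumes "open S" "bounded_linear L" "Ck_on k S F"
  shows "Ck_on k S (\<lambda>x. L (F x))"
  using assms(3)
proof (induction k arbitrary: F)
  case 0
  then show ?case using assms(2) by (auto intro: bounded_linear.continuous_on)
next
  case (Suc k)
  then have d: "(F has_derivative (\<lambda>v. pd v F x)) (at x)" if "x \<in> S" for x
    using that by (simp flip: frechet_derivative_works)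
  have e: "((\<lambda>x. L (F x)) has_derivative (\<lambda>v. L (pd v F x))) (at x)" if "x \<in> S" for x
    using bounded_linear.has_derivative[OF assms(2) d[OF that]] .
  have "Ck_on k S (pd v (\<lambda>x. L (F x)))" for v
  proof (rule Ck_on_cong[OF assms(1)])
    show "Ck_on k S (\<lambda>x. L (pd v F x))" using Suc by simp
    show "L (pd v F x) = pd v (\<lambda>x. L (F x)) x" if "x \<in> S" for x
      using pd_eqI[OF e[OF that]] by simp
  qed
  with e show ?case by (auto simp: differentiable_def)
qed

lemma Ck_on_bilinear:
  assumes "open S" "bounded_bilinear P" "Ck_on k S F" "Ck_on k S G"
  shows "Ck_on k S (\<lambda>x. P (F x) (G x))"
  using assms(3,4)
proof (induction k arbitrary: F G)
  case 0
  then show ?case using assms(2) by (auto intro: bounded_bilinear.continuous_on)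
next
  case (Suc k)
  then have d: "(F has_derivative (\<lambda>v. pd v F x)) (at x)" "(G has_derivative (\<lambda>v. pd v G x)) (at x)"
    if "x \<in> S" for x
    using that by (simp_all flip: frechet_derivative_works)
  have e: "((\<lambda>x. P (F x) (G x)) has_derivative (\<lambda>v. P (F x) (pd v G x) + P (pd v F x) (G x))) (at x)"
    if "x \<in> S" for x
    using bounded_bilinear.FDERIV[OF assms(2) d[OF that]] .
  have "Ck_on k S (pd v (\<lambda>x. P (F x) (G x)))" for v
  proof (rule Ck_on_cong[OF assms(1)])
    show "Ck_on k S (\<lambda>x. P (F x) (pd v G x) + P (pd v F x) (G x))"
      using Suc.prems Suc.prems[THEN Ck_on_SucD] by (intro Ck_on_add assms(1) Suc.IH) simp_all
    show "P (F x) (pd v G x) + P (pd v F x) (G x) = pd v (\<lambda>x. P (F x) (G x)) x" if "x \<in> S" for x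
      using pd_eqI[OF e[OF that]] by simp
  qed
  with e show ?case by (auto simp: differentiable_def)
qed

lemma Ck_on_sum:
  assumes "open S" "\<And>i. i \<in> I \<Longrightarrow> Ck_on k S (F i)"
  shows "Ck_on k S (\<lambda>x. \<Sum>i\<in>I. F i x)"
  using assms(2)
  by (induction I rule: infinite_finite_induct) (auto intro: Ck_on_const Ck_on_add[OF assms(1)])

lemma Ck_on_compose:
  fixes G :: "'a::real_normed_vector \<Rightarrow> 'b::euclidean_space"
  assumes "open S" "open T" "Ck_on k S G" "Ck_on k T F" "G ` S \<subseteq> T"
  shows "Ck_on k S (\<lambda>x. F (G x))"
  using assms(3,4)
proof (induction k arbitrary: F)
  case 0
  then show ?case using assms(5) by (auto intro: continuous_on_compose2)
next
  case (Suc k)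
  have d: "(G has_derivative (\<lambda>v. pd v G x)) (at x)" "(F has_derivative (\<lambda>v. pd v F (G x))) (at (G x))"
    if "x \<in> S" for x
    using that Suc.prems assms(5) by (auto simp flip: frechet_derivative_works)
  have e: "((\<lambda>x. F (G x)) has_derivative (\<lambda>v. pd (pd v G x) F (G x))) (at x)" if "x \<in> S" for x
    using has_derivative_compose[OF d[OF that]] by simp
  \<comment> \<open>The direction \<open>pd v G x\<close> varies with x, while the induction
    hypothesis covers \<open>pd b F\<close> only for fixed b. Expanding the direction in a basis of
    the middle space turns the derivative into a sum of products.\<close>
  have lin: "pd w F (G x) = (\<Sum>b\<in>Basis. (w \<bullet> b) *\<^sub>R pd b F (G x))" if "x \<in> S" for x w
  proof -
    have "linear (\<lambda>v. pd v F (G x))" using d(2)[OF that] has_derivative_linear by auto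
    then show ?thesis
      by (subst (1) euclidean_representation[symmetric, of w]) (simp add: linear_sum linear_cmul)
  qed
  have "Ck_on k S (pd v (\<lambda>x. F (G x)))" for v
  proof (rule Ck_on_cong[OF assms(1)])
    have "Ck_on k S (\<lambda>x. pd v G x \<bullet> b)" for b
      using Suc.prems by (intro Ck_on_linear[OF assms(1) bounded_linear_inner_left]) auto
    moreover have "Ck_on k S (\<lambda>x. pd b F (G x))" for b
      using Suc.IH[OF Ck_on_SucD[OF Suc.prems(1)], of "pd b F"] Suc.prems(2) by simp
    ultimately show "Ck_on k S (\<lambda>x. \<Sum>b\<in>Basis. (pd v G x \<bullet> b) *\<^sub>R pd b F (G x))"
      by (intro Ck_on_sum assms Ck_on_bilinear[OF assms(1) bounded_bilinear_scaleR])
    show "(\<Sum>b\<in>Basis. (pd v G x \<bullet> b) *\<^sub>R pd b F (G x)) = pd v (\<lambda>x. F (G x)) x" if "x \<in> S" for x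
      using pd_eqI[OF e[OF that], of v] lin[OF that] by metis
  qed
  with e show ?case by (auto simp: differentiable_def)
qed

text \<open>The derivative of 1/F is a product of 1/F, F' and 1/F, so differentiability of one order
  more only needs 1/F at the previous order. The square root is treated in the same way.\<close>

lemma Ck_on_inverse:
  fixes F :: "'a::real_normed_vector \<Rightarrow> 'b::real_normed_field"
  assumes "open S" "\<And>x. x \<in> S \<Longrightarrow> F x \<noteq> 0" "Ck_on k S F"
  shows "Ck_on k S (\<lambda>x. inverse (F x))"
  using assms(3)
proof (induction k)
  case 0
  then show ?case using assms(2) by (auto intro: continuous_on_inverse)
next
  case (Suc k)
  have d: "(F has_derivative (\<lambda>v. pd v F x)) (at x)" if "x \<in> S" for x
    using that Suc.prems by (simp flip: frechet_derivative_works)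
  have e: "((\<lambda>x. inverse (F x)) has_derivative (\<lambda>v. - (inverse (F x) * pd v F x * inverse (F x)))) (at x)"
    if "x \<in> S" for x
    using Deriv.has_derivative_inverse[OF assms(2)[OF that] d[OF that]] .
  have i: "Ck_on k S (\<lambda>x. inverse (F x))" by (rule Suc.IH[OF Ck_on_SucD[OF Suc.prems]])
  have "Ck_on k S (pd v (\<lambda>x. inverse (F x)))" for v
  proof (rule Ck_on_cong[OF assms(1)])
    show "Ck_on k S (\<lambda>x. - (inverse (F x) * pd v F x * inverse (F x)))"
      using Suc.prems
      by (intro Ck_on_linear[OF assms(1) bounded_linear_minus[OF bounded_linear_ident]]
          Ck_on_bilinear[OF assms(1) bounded_bilinear_mult] i) auto
    show "- (inverse (F x) * pd v F x * inverse (F x)) = pd v (\<lambda>x. inverse (F x)) x" if "x \<in> S" for x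
      using pd_eqI[OF e[OF that], of v] by simp
  qed
  with e show ?case by (auto simp: differentiable_def)
qed

lemma Ck_on_sqrt:
  fixes F :: "'a::real_normed_vector \<Rightarrow> real"
  assumes "open S" "\<And>x. x \<in> S \<Longrightarrow> F x > 0" "Ck_on k S F"
  shows "Ck_on k S (\<lambda>x. sqrt (F x))"
  using assms(3)
proof (induction k)
  case 0
  then show ?case by (auto intro: continuous_intros)
next
  case (Suc k)
  have d: "(F has_derivative (\<lambda>v. pd v F x)) (at x)" if "x \<in> S" for x
    using that Suc.prems by (simp flip: frechet_derivative_works)
  have e: "((\<lambda>x. sqrt (F x)) has_derivative (\<lambda>v. pd v F x * (inverse (sqrt (F x)) / 2))) (at x)"
    if "x \<in> S" for x
    using d[OF that] assms(2)[OF that] by (auto intro!: derivative_eq_intros simp: field_simps)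
  have i: "Ck_on k S (\<lambda>x. sqrt (F x))" by (rule Suc.IH[OF Ck_on_SucD[OF Suc.prems]])
  have "Ck_on k S (pd v (\<lambda>x. sqrt (F x)))" for v
  proof (rule Ck_on_cong[OF assms(1)])
    have "F x \<noteq> 0" if "x \<in> S" for x using assms(2)[OF that] by simp
    then show "Ck_on k S (\<lambda>x. pd v F x * (inverse (sqrt (F x)) / 2))"
      using Suc.prems
      by (intro Ck_on_bilinear[OF assms(1) bounded_bilinear_mult] i
           Ck_on_linear[OF assms(1) bounded_linear_divide] Ck_on_inverse assms(1)) auto
    show "pd v F x * (inverse (sqrt (F x)) / 2) = pd v (\<lambda>x. sqrt (F x)) x" if "x \<in> S" for x
      using pd_eqI[OF e[OF that], of v] by simp
  qed
  with e show ?case by (auto simp: differentiable_def)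
qed

section \<open>Closure properties of smooth functions\<close>

lemma smooth_on_subset: "smooth_on S F \<Longrightarrow> T \<subseteq> S \<Longrightarrow> smooth_on T F"
  unfolding smooth_on_def using Ck_on_subset by blast

lemma smooth_on_cong: "open S \<Longrightarrow> (\<And>x. x \<in> S \<Longrightarrow> F x = G x) \<Longrightarrow> smooth_on S F \<Longrightarrow> smooth_on S G"
  unfolding smooth_on_def using Ck_on_cong by blast

lemma smooth_on_local: "(\<And>x. x \<in> S \<Longrightarrow> \<exists>T. open T \<and> x \<in> T \<and> smooth_on T F) \<Longrightarrow> smooth_on S F"
  unfolding smooth_on_def by (metis Ck_on_local)

lemma smooth_on_differentiable: "smooth_on S F \<Longrightarrow> x \<in> S \<Longrightarrow> F differentiable at x"
  unfolding smooth_on_def by (meson Ck_on.simps(2))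

lemma smooth_on_pd: "smooth_on S F \<Longrightarrow> smooth_on S (pd v F)"
  unfolding smooth_on_def
proof
  fix k assume "\<forall>k. Ck_on k S F"
  then have "Ck_on (Suc k) S F" by blast
  then show "Ck_on k S (pd v F)" by simp
qed

lemma smooth_on_has_derivative:
  "smooth_on S F \<Longrightarrow> x \<in> S \<Longrightarrow> (F has_derivative (\<lambda>v. pd v F x)) (at x)"
  using smooth_on_differentiable frechet_derivative_works by blast

lemma smooth_on_continuous: "smooth_on S F \<Longrightarrow> continuous_on S F"
  unfolding smooth_on_def by (meson Ck_on.simps(1))

lemma smooth_on_const: "smooth_on S (\<lambda>x. c)"
  unfolding smooth_on_def by (simp add: Ck_on_const)

lemma smooth_on_add: "open S \<Longrightarrow> smooth_on S F \<Longrightarrow> smooth_on S G \<Longrightarrow> smooth_on S (\<lambda>x. F x + G x)"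
  unfolding smooth_on_def by (simp add: Ck_on_add)

lemma smooth_on_linear: "open S \<Longrightarrow> bounded_linear L \<Longrightarrow> smooth_on S F \<Longrightarrow> smooth_on S (\<lambda>x. L (F x))"
  unfolding smooth_on_def by (simp add: Ck_on_linear)

lemma smooth_on_bilinear:
  "open S \<Longrightarrow> bounded_bilinear P \<Longrightarrow> smooth_on S F \<Longrightarrow> smooth_on S G \<Longrightarrow> smooth_on S (\<lambda>x. P (F x) (G x))"
  unfolding smooth_on_def by (simp add: Ck_on_bilinear)

lemma smooth_on_minus: "open S \<Longrightarrow> smooth_on S F \<Longrightarrow> smooth_on S (\<lambda>x. - F x)"
  by (rule smooth_on_linear[OF _ bounded_linear_minus[OF bounded_linear_ident]])

lemma smooth_on_diff: "open S \<Longrightarrow> smooth_on S F \<Longrightarrow> smooth_on S G \<Longrightarrow> smooth_on S (\<lambda>x. F x - G x)"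
  using smooth_on_add[of S F "\<lambda>x. - G x"] smooth_on_minus[of S G] by simp

lemma smooth_on_mult:
  fixes F G :: "_ \<Rightarrow> 'b::real_normed_algebra"
  shows "open S \<Longrightarrow> smooth_on S F \<Longrightarrow> smooth_on S G \<Longrightarrow> smooth_on S (\<lambda>x. F x * G x)"
  by (rule smooth_on_bilinear[OF _ bounded_bilinear_mult])

lemma smooth_on_scaleR: "open S \<Longrightarrow> smooth_on S F \<Longrightarrow> smooth_on S G \<Longrightarrow> smooth_on S (\<lambda>x. F x *\<^sub>R G x)"
  by (rule smooth_on_bilinear[OF _ bounded_bilinear_scaleR])

lemma smooth_on_inverse:
  fixes F :: "_ \<Rightarrow> 'b::real_normed_field"
  shows "open S \<Longrightarrow> (\<And>x. x \<in> S \<Longrightarrow> F x \<noteq> 0) \<Longrightarrow> smooth_on S F \<Longrightarrow> smooth_on S (\<lambda>x. inverse (F x))"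
  unfolding smooth_on_def by (simp add: Ck_on_inverse)

lemma smooth_on_divide:
  fixes F G :: "_ \<Rightarrow> 'b::real_normed_field"
  shows "open S \<Longrightarrow> (\<And>x. x \<in> S \<Longrightarrow> G x \<noteq> 0) \<Longrightarrow> smooth_on S F \<Longrightarrow> smooth_on S G \<Longrightarrow>
    smooth_on S (\<lambda>x. F x / G x)"
  unfolding divide_inverse by (intro smooth_on_mult smooth_on_inverse) auto

lemma smooth_on_sqrt:
  "open S \<Longrightarrow> (\<And>x. x \<in> S \<Longrightarrow> F x > 0) \<Longrightarrow> smooth_on S F \<Longrightarrow> smooth_on S (\<lambda>x. sqrt (F x))"
  unfolding smooth_on_def by (simp add: Ck_on_sqrt)

lemma smooth_on_compose:
  fixes G :: "'a::real_normed_vector \<Rightarrow> 'b::euclidean_space"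
  shows "open S \<Longrightarrow> open T \<Longrightarrow> smooth_on S G \<Longrightarrow> smooth_on T F \<Longrightarrow> G ` S \<subseteq> T \<Longrightarrow>
    smooth_on S (\<lambda>x. F (G x))"
  unfolding smooth_on_def by (metis Ck_on_compose)

lemma smooth_on_sum:
  "open S \<Longrightarrow> (\<And>i. i \<in> I \<Longrightarrow> smooth_on S (F i)) \<Longrightarrow> smooth_on S (\<lambda>x. \<Sum>i\<in>I. F i x)"
  unfolding smooth_on_def by (simp add: Ck_on_sum)

lemma smooth_on_vec_nth: "open S \<Longrightarrow> smooth_on S F \<Longrightarrow> smooth_on S (\<lambda>x. F x $ i)"
  by (rule smooth_on_linear[OF _ bounded_linear_vec_nth])

lemma bounded_linear_axis: "bounded_linear (axis i :: 'b::euclidean_space \<Rightarrow> 'b^'n)"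
proof (rule linear_conv_bounded_linear[THEN iffD1], rule linearI)
  show "axis i (x + y) = axis i x + (axis i y :: 'b^'n)" for x y
    by (simp add: vec_eq_iff axis_def)
  show "axis i (r *\<^sub>R x) = r *\<^sub>R (axis i x :: 'b^'n)" for r x
    by (simp add: vec_eq_iff axis_def)
qed

lemma smooth_on_vec:
  fixes F :: "'a::real_normed_vector \<Rightarrow> 'n::finite \<Rightarrow> 'b::euclidean_space"
  assumes "open S" "\<And>i. smooth_on S (\<lambda>x. F x i)"
  shows "smooth_on S (\<lambda>x. \<chi> i. F x i)"
proof (rule smooth_on_cong[OF assms(1)])
  show "smooth_on S (\<lambda>x. \<Sum>i\<in>UNIV. axis i (F x i))"
    using assms by (intro smooth_on_sum smooth_on_linear[OF _ bounded_linear_axis])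
  show "(\<Sum>i\<in>UNIV. axis i (F x i)) = (\<chi> i. F x i)" for x
    by (simp add: vec_eq_iff axis_def if_distrib sum.delta cong: if_cong)
qed

section \<open>Rules for directional derivatives and their symmetry\<close>

lemma pd_add:
  "F differentiable at x \<Longrightarrow> G differentiable at x \<Longrightarrow> pd v (\<lambda>x. F x + G x) x = pd v F x + pd v G x"
  unfolding frechet_derivative_works by (intro pd_eqI has_derivative_add)

lemma pd_diff:
  "F differentiable at x \<Longrightarrow> G differentiable at x \<Longrightarrow> pd v (\<lambda>x. F x - G x) x = pd v F x - pd v G x"
  unfolding frechet_derivative_works by (intro pd_eqI has_derivative_diff)

lemma pd_linear:
  "bounded_linear L \<Longrightarrow> F differentiable at x \<Longrightarrow> pd v (\<lambda>x. L (F x)) x = L (pd v F x)"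
  unfolding frechet_derivative_works by (rule pd_eqI[OF bounded_linear.has_derivative])

lemma pd_bilinear:
  "bounded_bilinear P \<Longrightarrow> F differentiable at x \<Longrightarrow> G differentiable at x \<Longrightarrow>
    pd v (\<lambda>x. P (F x) (G x)) x = P (F x) (pd v G x) + P (pd v F x) (G x)"
  unfolding frechet_derivative_works by (rule pd_eqI[OF bounded_bilinear.FDERIV])

lemma pd_vec_nth: "F differentiable at x \<Longrightarrow> pd v (\<lambda>x. F x $ i) x = pd v F x $ i"
  by (rule pd_linear[OF bounded_linear_vec_nth])

lemma pd_add_dir: "F differentiable at x \<Longrightarrow> pd (v + w) F x = pd v F x + pd w F x"
  using linear_add[OF linear_frechet_derivative] .

lemma pd_scaleR_dir: "F differentiable at x \<Longrightarrow> pd (r *\<^sub>R v) F x = r *\<^sub>R pd v F x"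
  using linear_scale[OF linear_frechet_derivative] .

lemma pd_complex_dir:
  fixes F :: "complex \<Rightarrow> 'b::real_normed_vector"
  assumes "F differentiable at x"
  shows "pd v F x = Re v *\<^sub>R pd 1 F x + Im v *\<^sub>R pd \<i> F x"
proof -
  have "v = Re v *\<^sub>R 1 + Im v *\<^sub>R \<i>" by (simp add: complex_eq_iff)
  then show ?thesis using assms by (metis pd_add_dir pd_scaleR_dir)
qed

lemma pd_pd_commute_real:
  fixes F :: "'a::real_normed_vector \<Rightarrow> real"
  assumes S: "open S" "z \<in> S" and F: "smooth_on S F"
  shows "pd w (pd u F) z = pd u (pd w F) z"
proof -
  \<comment> \<open>Both sides are limits of the same second difference quotient, by two mean value theorems.\<close>
  define \<Delta> where "\<Delta> u w s = F (z + s *\<^sub>R u + s *\<^sub>R w) - F (z + s *\<^sub>R u) - F (z + s *\<^sub>R w) + F z"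
    for u w :: 'a and s :: real
  have lim: "((\<lambda>s. \<Delta> u w s / s\<^sup>2) \<longlongrightarrow> pd w (pd u F) z) (at_right 0)" for u w
  proof (rule tendstoI)
    fix e :: real assume "e > 0"
    have "continuous_on S (pd w (pd u F))" using F by (intro smooth_on_continuous smooth_on_pd)
    then have "isCont (pd w (pd u F)) z" using S continuous_on_eq_continuous_at by blast
    then obtain d0 where d0: "d0 > 0" "\<And>y. dist y z < d0 \<Longrightarrow> dist (pd w (pd u F) y) (pd w (pd u F) z) < e"
      using \<open>e > 0\<close> unfolding continuous_at_eps_delta by blast
    obtain d1 where d1: "d1 > 0" "ball z d1 \<subseteq> S" using S open_contains_ball by blast
    define d where "d = min d0 d1"
    have d: "d > 0" "\<And>y. dist y z < d \<Longrightarrow> y \<in> S"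
      using d0 d1 by (auto simp: d_def dist_commute subset_eq)
    \<comment> \<open>For 0 < s < d / K the whole parallelogram with sides s u and s w stays within
      distance d of z. The summand 1 keeps K positive when both directions vanish.\<close>
    define K where "K = norm u + norm w + 1"
    have K: "K > 0" by (simp add: K_def add_nonneg_pos)
    have near: "dist (z + a *\<^sub>R u + b *\<^sub>R w) z < d" if "0 \<le> a" "a \<le> s" "0 \<le> b" "b \<le> s" "0 < s" "s < d / K" for a b s
    proof -
      have "norm (a *\<^sub>R u + b *\<^sub>R w) \<le> a * norm u + b * norm w"
        using norm_triangle_ineq[of "a *\<^sub>R u" "b *\<^sub>R w"] that by simp
      also have "\<dots> \<le> s * norm u + s * norm w" using that by (intro add_mono mult_right_mono) auto
      also have "\<dots> \<le> s * K" using that by (simp add: K_def algebra_simps)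
      also have "\<dots> < d" using that K by (simp add: field_simps)
      finally show ?thesis by (simp add: dist_norm add.assoc)
    qed
    have "dist (\<Delta> u w s / s\<^sup>2) (pd w (pd u F) z) < e" if s: "0 < s" "s < d / K" for s
    proof -
      have dF: "(F has_derivative (\<lambda>v. pd v F y)) (at y)" if "y \<in> S" for y
        using smooth_on_has_derivative[OF F that] .
      have dpF: "(pd u F has_derivative (\<lambda>v. pd v (pd u F) y)) (at y)" if "y \<in> S" for y
        using smooth_on_has_derivative[OF smooth_on_pd[OF F] that] .
      have D1: "((\<lambda>a. F (z + a *\<^sub>R u + b *\<^sub>R w)) has_real_derivative pd u F (z + a *\<^sub>R u + b *\<^sub>R w)) (at a)"
        if "0 \<le> a" "a \<le> s" "0 \<le> b" "b \<le> s" for a b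
      proof -
        have y: "z + a *\<^sub>R u + b *\<^sub>R w \<in> S" using near[OF that s] d by blast
        have "((\<lambda>a. z + a *\<^sub>R u + b *\<^sub>R w) has_derivative (\<lambda>h. h *\<^sub>R u)) (at a)"
          by (auto intro!: derivative_eq_intros)
        from has_derivative_compose[OF this dF[OF y]]
        show ?thesis
          using pd_scaleR_dir[OF smooth_on_differentiable[OF F y]]
          by (simp add: has_field_derivative_def mult_commute_abs)
      qed
      have D2: "((\<lambda>b. pd u F (z + a *\<^sub>R u + b *\<^sub>R w)) has_real_derivative pd w (pd u F) (z + a *\<^sub>R u + b *\<^sub>R w)) (at b)"
        if "0 \<le> a" "a \<le> s" "0 \<le> b" "b \<le> s" for a b
      proof -
        have y: "z + a *\<^sub>R u + b *\<^sub>R w \<in> S" using near[OF that s] d by blast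
        have "((\<lambda>b. z + a *\<^sub>R u + b *\<^sub>R w) has_derivative (\<lambda>h. h *\<^sub>R w)) (at b)"
          by (auto intro!: derivative_eq_intros)
        from has_derivative_compose[OF this dpF[OF y]]
        show ?thesis
          using pd_scaleR_dir[OF smooth_on_differentiable[OF smooth_on_pd[OF F] y]]
          by (simp add: has_field_derivative_def mult_commute_abs)
      qed
      let ?g = "\<lambda>a. F (z + a *\<^sub>R u + s *\<^sub>R w) - F (z + a *\<^sub>R u)"
      have "(?g has_real_derivative (pd u F (z + a *\<^sub>R u + s *\<^sub>R w) - pd u F (z + a *\<^sub>R u))) (at a)"
        if "0 \<le> a" "a \<le> s" for a
        using DERIV_diff[OF D1[OF that, of s] D1[OF that, of 0]] s by simp
      from MVT2[OF s(1) this] obtain a where a: "0 < a" "a < s"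
        "?g s - ?g 0 = (s - 0) * (pd u F (z + a *\<^sub>R u + s *\<^sub>R w) - pd u F (z + a *\<^sub>R u))"
        by blast
      have "((\<lambda>b. pd u F (z + a *\<^sub>R u + b *\<^sub>R w)) has_real_derivative
          pd w (pd u F) (z + a *\<^sub>R u + b *\<^sub>R w)) (at b)" if "0 \<le> b" "b \<le> s" for b
        using D2 a that by simp
      from MVT2[OF s(1) this] obtain b where b: "0 < b" "b < s"
        "pd u F (z + a *\<^sub>R u + s *\<^sub>R w) - pd u F (z + a *\<^sub>R u + 0 *\<^sub>R w) =
          (s - 0) * pd w (pd u F) (z + a *\<^sub>R u + b *\<^sub>R w)" by blast
      have "\<Delta> u w s = s\<^sup>2 * pd w (pd u F) (z + a *\<^sub>R u + b *\<^sub>R w)"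
        using a(3) b(3) by (simp add: \<Delta>_def power2_eq_square)
      then have "\<Delta> u w s / s\<^sup>2 = pd w (pd u F) (z + a *\<^sub>R u + b *\<^sub>R w)" using s by simp
      moreover have "dist (z + a *\<^sub>R u + b *\<^sub>R w) z < d0" using near[of a s b] a b s by (simp add: d_def)
      ultimately show ?thesis using d0 by simp
    qed
    moreover have "d / K > 0" using d K by simp
    ultimately show "\<forall>\<^sub>F s in at_right 0. dist (\<Delta> u w s / s\<^sup>2) (pd w (pd u F) z) < e"
      unfolding eventually_at_right_field by blast
  qed
  have "\<Delta> u w = \<Delta> w u" by (simp add: \<Delta>_def fun_eq_iff algebra_simps)
  then show ?thesis using lim[of u w] lim[of w u] tendsto_unique[of "at_right (0::real)"] by simp
qed

lemma pd_pd_commute: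
  fixes F :: "'a::real_normed_vector \<Rightarrow> 'b::euclidean_space"
  assumes S: "open S" "z \<in> S" and F: "smooth_on S F"
  shows "pd w (pd u F) z = pd u (pd w F) z"
proof (rule euclidean_eqI)
  fix b :: 'b
  have i: "bounded_linear (\<lambda>x::'b. x \<bullet> b)" by (rule bounded_linear_inner_left)
  have p: "pd v (\<lambda>x. F x \<bullet> b) x = pd v F x \<bullet> b" if "x \<in> S" for x v
    by (rule pd_linear[OF i smooth_on_differentiable[OF F that]])
  have s: "smooth_on S (\<lambda>x. F x \<bullet> b)" by (rule smooth_on_linear[OF S(1) i F])
  have "pd w (pd u F) z \<bullet> b = pd w (pd u (\<lambda>x. F x \<bullet> b)) z" for u w
  proof -
    have "pd w (pd u F) z \<bullet> b = pd w (\<lambda>x. pd u F x \<bullet> b) z"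
      by (rule pd_linear[OF i smooth_on_differentiable[OF smooth_on_pd[OF F] S(2)], symmetric])
    also have "\<dots> = pd w (pd u (\<lambda>x. F x \<bullet> b)) z"
      using p by (intro pd_cong_open(1)[OF S] smooth_on_differentiable[OF _ S(2)]
          smooth_on_linear[OF S(1) i] smooth_on_pd F) auto
    finally show ?thesis .
  qed
  then show "pd w (pd u F) z \<bullet> b = pd u (pd w F) z \<bullet> b"
    using pd_pd_commute_real[OF S s] by simp
qed

section \<open>Wirtinger calculus\<close>

definition dz :: "(complex \<Rightarrow> complex) \<Rightarrow> complex \<Rightarrow> complex" where
  "dz F z = (pd 1 F z - \<i> * pd \<i> F z) / 2"

definition dzb :: "(complex \<Rightarrow> complex) \<Rightarrow> complex \<Rightarrow> complex" where
  "dzb F z = (pd 1 F z + \<i> * pd \<i> F z) / 2"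

definition vdz :: "(complex \<Rightarrow> complex^4) \<Rightarrow> complex \<Rightarrow> complex^4" where
  "vdz F z = (\<chi> a. dz (\<lambda>z. F z $ a) z)"

definition vdzb :: "(complex \<Rightarrow> complex^4) \<Rightarrow> complex \<Rightarrow> complex^4" where
  "vdzb F z = (\<chi> a. dzb (\<lambda>z. F z $ a) z)"

definition vcnj :: "complex^4 \<Rightarrow> complex^4" where
  "vcnj v = (\<chi> a. cnj (v $ a))"

text \<open>The complex bilinear extension of \<open>Omega\<close>. It is not sesquilinear:
  conjugations are always written out by \<open>vcnj\<close>, so that \<open>Oc v v = 0\<close>
  persists and \<open>Oc v (vcnj v)\<close> carries information.\<close>

definition Oc :: "complex^4 \<Rightarrow> complex^4 \<Rightarrow> complex" where
  "Oc v w = v$1 * w$3 + v$2 * w$4 - v$3 * w$1 - v$4 * w$2"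

lemma Oc_simps:
  "Oc (u + v) w = Oc u w + Oc v w" "Oc w (u + v) = Oc w u + Oc w v"
  "Oc (u - v) w = Oc u w - Oc v w" "Oc w (u - v) = Oc w u - Oc w v"
  "Oc (c *s v) w = c * Oc v w" "Oc w (c *s v) = c * Oc w v"
  "Oc v v = 0"
  by (simp_all add: Oc_def algebra_simps)

lemma Oc_swap: "Oc w v = - Oc v w"
  by (simp add: Oc_def algebra_simps)

lemma vcnj_simps [simp]:
  "vcnj (vcnj v) = v" "vcnj (u + v) = vcnj u + vcnj v" "vcnj (u - v) = vcnj u - vcnj v"
  "vcnj (c *s v) = cnj c *s vcnj v"
  by (simp_all add: vcnj_def vec_eq_iff)

lemma Oc_vcnj: "Oc (vcnj v) (vcnj w) = cnj (Oc v w)"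
  by (simp add: Oc_def vcnj_def)

locale plane_domain =
  fixes S :: "complex set"
  assumes open_S: "open S"
begin

lemmas smooth_plane = smooth_on_add[OF open_S] smooth_on_diff[OF open_S] smooth_on_minus[OF open_S]
  smooth_on_mult[OF open_S] smooth_on_const smooth_on_vec_nth[OF open_S] smooth_on_pd

lemma smooth_cnj: "smooth_on S F \<Longrightarrow> smooth_on S (\<lambda>z. cnj (F z))"
  by (rule smooth_on_linear[OF open_S bounded_linear_cnj])

lemma smooth_dz: "smooth_on S F \<Longrightarrow> smooth_on S (dz F)"
  unfolding dz_def [abs_def] divide_inverse by (intro smooth_plane)

lemma smooth_dzb: "smooth_on S F \<Longrightarrow> smooth_on S (dzb F)"
  unfolding dzb_def [abs_def] divide_inverse by (intro smooth_plane)

lemma smooth_vdz: "smooth_on S F \<Longrightarrow> smooth_on S (vdz F)"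
  unfolding vdz_def [abs_def] by (intro smooth_on_vec open_S smooth_dz smooth_plane)

lemma smooth_vdzb: "smooth_on S F \<Longrightarrow> smooth_on S (vdzb F)"
  unfolding vdzb_def [abs_def] by (intro smooth_on_vec open_S smooth_dzb smooth_plane)

lemma smooth_vcnj: "smooth_on S F \<Longrightarrow> smooth_on S (\<lambda>z. vcnj (F z))"
  unfolding vcnj_def by (intro smooth_on_vec open_S smooth_cnj smooth_plane)

lemma smooth_vscale: "smooth_on S c \<Longrightarrow> smooth_on S F \<Longrightarrow> smooth_on S (\<lambda>z. c z *s (F z :: complex^4))"
  unfolding vector_scalar_mult_def by (intro smooth_on_vec open_S smooth_plane)

lemma smooth_Oc: "smooth_on S F \<Longrightarrow> smooth_on S G \<Longrightarrow> smooth_on S (\<lambda>z. Oc (F z) (G z))"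
  unfolding Oc_def by (intro smooth_plane)

lemma pd_rules:
  fixes F G :: "complex \<Rightarrow> complex"
  assumes "smooth_on S F" "smooth_on S G" "z \<in> S"
  shows "pd v (\<lambda>z. F z + G z) z = pd v F z + pd v G z"
    and "pd v (\<lambda>z. F z * G z) z = F z * pd v G z + pd v F z * G z"
    and "pd v (\<lambda>z. cnj (F z)) z = cnj (pd v F z)"
    and "pd v (\<lambda>z. F z - G z) z = pd v F z - pd v G z"
  using assms(1,2)[THEN smooth_on_differentiable, OF assms(3)]
  by (simp_all add: pd_add pd_bilinear[OF bounded_bilinear_mult] pd_linear[OF bounded_linear_cnj] pd_diff)

lemma dz_rules:
  assumes "smooth_on S F" "smooth_on S G" "z \<in> S"
  shows "dz (\<lambda>z. F z + G z) z = dz F z + dz G z"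
    and "dz (\<lambda>z. F z - G z) z = dz F z - dz G z"
    and "dz (\<lambda>z. F z * G z) z = dz F z * G z + F z * dz G z"
    and "dzb (\<lambda>z. F z + G z) z = dzb F z + dzb G z"
    and "dzb (\<lambda>z. F z - G z) z = dzb F z - dzb G z"
    and "dzb (\<lambda>z. F z * G z) z = dzb F z * G z + F z * dzb G z"
  unfolding dz_def dzb_def pd_rules[OF assms] divide_inverse by (simp_all add: algebra_simps)

lemma dz_cnj:
  assumes "smooth_on S F" "z \<in> S"
  shows "dz (\<lambda>z. cnj (F z)) z = cnj (dzb F z)" "dzb (\<lambda>z. cnj (F z)) z = cnj (dz F z)"
  using pd_rules(3)[OF assms(1,1,2)] by (simp_all add: dz_def dzb_def)

lemma dz_const [simp]: "dz (\<lambda>z. c) z = 0" "dzb (\<lambda>z. c) z = 0"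
  by (simp_all add: dz_def dzb_def)

lemma dz_cong:
  assumes "smooth_on S F" "z \<in> S" "\<And>y. y \<in> S \<Longrightarrow> F y = G y"
  shows "dz F z = dz G z" "dzb F z = dzb G z"
  unfolding dz_def dzb_def
  using pd_cong_open(1)[OF open_S assms(2) smooth_on_differentiable[OF assms(1,2)] assms(3)] by simp_all

lemma vdz_cong:
  assumes "smooth_on S F" "z \<in> S" "\<And>y. y \<in> S \<Longrightarrow> F y = G y"
  shows "vdz F z = vdz G z" "vdzb F z = vdzb G z"
proof -
  have "dz (\<lambda>z. F z $ a) z = dz (\<lambda>z. G z $ a) z" "dzb (\<lambda>z. F z $ a) z = dzb (\<lambda>z. G z $ a) z" for a
    using assms smooth_on_vec_nth[OF open_S assms(1)] by (intro dz_cong; simp)+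
  then show "vdz F z = vdz G z" "vdzb F z = vdzb G z" by (simp_all add: vdz_def vdzb_def)
qed

text \<open>Both sides are a quarter of the Laplacian; the terms with a factor \<i> cancel by
  symmetry of the second derivatives.\<close>

lemma dz_dzb:
  assumes "smooth_on S F" "z \<in> S"
  shows "dz (dzb F) z = dzb (dz F) z"
proof -
  have c: "pd 1 (pd \<i> F) z = pd \<i> (pd 1 F) z" by (rule pd_pd_commute[OF open_S assms(2,1)])
  have p: "pd v (\<lambda>z. (pd 1 F z + c * pd \<i> F z) / 2) z = (pd v (pd 1 F) z + c * pd v (pd \<i> F) z) / 2" for v c
  proof -
    have s: "smooth_on S (pd 1 F)" "smooth_on S (\<lambda>z. c * pd \<i> F z)" "smooth_on S (pd \<i> F)"
      by (intro smooth_plane assms(1))+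
    have "pd v (\<lambda>z. (pd 1 F z + c * pd \<i> F z) * inverse 2) z = (pd v (pd 1 F) z + c * pd v (pd \<i> F) z) * inverse 2"
      unfolding pd_rules(2)[OF smooth_on_add[OF open_S s(1,2)] smooth_on_const assms(2)]
        pd_rules(1)[OF s(1,2) assms(2)] pd_rules(2)[OF smooth_on_const s(3) assms(2)]
      by simp
    then show ?thesis unfolding divide_inverse .
  qed
  have p1: "pd v (dzb F) z = (pd v (pd 1 F) z + \<i> * pd v (pd \<i> F) z) / 2" for v
    using p[of \<i> v] by (simp add: dzb_def [abs_def])
  have p2: "pd v (dz F) z = (pd v (pd 1 F) z - \<i> * pd v (pd \<i> F) z) / 2" for v
    using p[of "-\<i>" v] by (simp add: dz_def [abs_def])
  show ?thesis
    unfolding dz_def[of "dzb F"] dzb_def[of "dz F"] p1 p2 c divide_inverse by (simp add: algebra_simps)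
qed

lemma vdz_vdzb:
  assumes "smooth_on S F" "z \<in> S"
  shows "vdz (vdzb F) z = vdzb (vdz F) z"
  using dz_dzb[OF smooth_on_vec_nth[OF open_S assms(1)] assms(2)] by (simp add: vdz_def vdzb_def)

lemma vdz_vcnj:
  assumes "smooth_on S F" "z \<in> S"
  shows "vdz (\<lambda>z. vcnj (F z)) z = vcnj (vdzb F z)" "vdzb (\<lambda>z. vcnj (F z)) z = vcnj (vdz F z)"
  using dz_cnj[OF smooth_on_vec_nth[OF open_S assms(1)] assms(2)]
  by (simp_all add: vdz_def vdzb_def vcnj_def)

lemma vdz_rules:
  assumes "smooth_on S F" "smooth_on S G" "smooth_on S c" "z \<in> S"
  shows "vdz (\<lambda>z. F z + G z) z = vdz F z + vdz G z"
    and "vdz (\<lambda>z. c z *s F z) z = dz c z *s F z + c z *s vdz F z"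
    and "vdzb (\<lambda>z. F z + G z) z = vdzb F z + vdzb G z"
    and "vdzb (\<lambda>z. c z *s F z) z = dzb c z *s F z + c z *s vdzb F z"
    and "vdz (\<lambda>z. F z - G z) z = vdz F z - vdz G z"
    and "vdzb (\<lambda>z. F z - G z) z = vdzb F z - vdzb G z"
  using dz_rules[OF smooth_on_vec_nth[OF open_S assms(1)] smooth_on_vec_nth[OF open_S assms(2)] assms(4)]
    dz_rules[OF assms(3) smooth_on_vec_nth[OF open_S assms(1)] assms(4)]
  by (simp_all add: vdz_def vdzb_def vec_eq_iff)

lemma dz_Oc:
  assumes F: "smooth_on S F" and G: "smooth_on S G" and z: "z \<in> S"
  shows "dz (\<lambda>z. Oc (F z) (G z)) z = Oc (vdz F z) (G z) + Oc (F z) (vdz G z)"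
    and "dzb (\<lambda>z. Oc (F z) (G z)) z = Oc (vdzb F z) (G z) + Oc (F z) (vdzb G z)"
  unfolding Oc_def using F G z
  by (simp_all add: dz_rules smooth_plane vdz_def vdzb_def algebra_simps)

lemma dz_inverse:
  assumes F: "smooth_on S F" and nz: "\<And>z. z \<in> S \<Longrightarrow> F z \<noteq> 0" and z: "z \<in> S"
  shows "dz (\<lambda>z. inverse (F z)) z = - dz F z / (F z)\<^sup>2" "dzb (\<lambda>z. inverse (F z)) z = - dzb F z / (F z)\<^sup>2"
proof -
  have i: "smooth_on S (\<lambda>z. inverse (F z))" by (intro smooth_on_inverse open_S nz F)
  have "dz (\<lambda>z. F z * inverse (F z)) z = dz (\<lambda>z. 1) z" "dzb (\<lambda>z. F z * inverse (F z)) z = dzb (\<lambda>z. 1) z"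
    using dz_cong[OF smooth_on_mult[OF open_S F i] z, of "\<lambda>z. 1"] nz by simp_all
  then have e: "dz F z * inverse (F z) + F z * dz (\<lambda>z. inverse (F z)) z = 0"
      "dzb F z * inverse (F z) + F z * dzb (\<lambda>z. inverse (F z)) z = 0"
    by (simp_all add: dz_rules[OF F i z])
  have r: "d = - e / x\<^sup>2" if "e * inverse x + x * d = 0" "x \<noteq> 0" for x d e :: complex
  proof -
    have "x * d = - (e * inverse x)" using that(1) by (simp add: eq_neg_iff_add_eq_0 add.commute)
    then have "inverse x * (x * d) = - e / x\<^sup>2" by (simp add: power2_eq_square divide_inverse)
    then show ?thesis using that(2) by (simp flip: mult.assoc)
  qed
  show "dz (\<lambda>z. inverse (F z)) z = - dz F z / (F z)\<^sup>2" "dzb (\<lambda>z. inverse (F z)) z = - dzb F z / (F z)\<^sup>2"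
    using r[OF e(1) nz[OF z]] r[OF e(2) nz[OF z]] .
qed

end

section \<open>Complex symplectic bases\<close>

lemma J4_J4: "J4 ** J4 = - mat 1"
  by (simp add: vec_eq_iff forall_4 matrix_matrix_mult_def sum_4 J4_def mat_def)

lemma matrix_mul_neg: "(- A) ** B = - (A ** B)" "A ** (- B) = - (A ** B)" for A B :: "real^4^4"
  by (simp_all add: vec_eq_iff matrix_matrix_mult_def sum_negf)

text \<open>Since \<open>J4\<close> squares to \<open>- mat 1\<close>, multiplying the symplectic
  relation by \<open>- J4\<close> exhibits the inverse. It is polynomial in the entries of X, so
  components relative to a frame become symplectic pairings with its columns.\<close>

lemma symplectic_left_inverse:
  assumes "transpose X ** J4 ** X = J4"
  shows "- (J4 ** transpose X ** J4) ** X = mat 1" "X ** - (J4 ** transpose X ** J4) = mat 1"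
proof -
  show "- (J4 ** transpose X ** J4) ** X = mat 1"
    using assms J4_J4 by (simp add: matrix_mul_neg flip: matrix_mul_assoc)
  then show "X ** - (J4 ** transpose X ** J4) = mat 1" using matrix_left_right_inverse by blast
qed

definition frame_matrix :: "complex^4 \<Rightarrow> complex^4 \<Rightarrow> real^4^4" where
  "frame_matrix E N = (\<chi> i j. if j = 1 then Re (E$i) else if j = 2 then Im (E$i)
    else if j = 3 then Re (N$i) else Im (N$i))"

text \<open>Writing w_ij for the pairing of columns i and j, the four complex pairings are -2 \<i>
  w_12, (w_13 - w_24) + \<i> (w_14 + w_23), (w_13 + w_24) + \<i> (w_23 - w_14) and -2 \<i> w_34.
  Together they contain all six real relations; the value 2 is w_13 + w_24.\<close>

lemma frame_matrix_symplectic: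
  assumes "Oc E (vcnj E) = 0" "Oc E N = 0" "Oc E (vcnj N) = 2" "Oc N (vcnj N) = 0"
  shows "transpose (frame_matrix E N) ** J4 ** frame_matrix E N = J4"
  using assms
  by (simp add: vec_eq_iff forall_4 matrix_matrix_mult_def sum_4 J4_def transpose_def frame_matrix_def
      Oc_def vcnj_def complex_eq_iff algebra_simps)

lemma symplectic_matrix_rows:
  fixes X :: "real^4^4"
  assumes "transpose X ** J4 ** X = J4"
  shows "X ** J4 ** transpose X = J4"
proof -
  have "- (X ** J4 ** transpose X ** J4) = mat 1"
    using symplectic_left_inverse(2)[OF assms] by (simp add: matrix_mul_neg matrix_mul_assoc)
  then have "X ** J4 ** transpose X ** J4 = - mat 1" by (metis minus_minus)
  then have "X ** J4 ** transpose X ** J4 ** J4 = - mat 1 ** J4" by simp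
  then show ?thesis using J4_J4 by (simp add: matrix_mul_neg flip: matrix_mul_assoc)
qed

lemma symplectic_rows:
  assumes "Oc E (vcnj E) = 0" "Oc E N = 0" "Oc E (vcnj N) = 2" "Oc N (vcnj N) = 0"
  shows "E$a * cnj (N$b) + cnj (E$a) * N$b - N$a * cnj (E$b) - cnj (N$a) * E$b = of_real (2 * J4$a$b)"
proof -
  let ?X = "frame_matrix E N"
  have "(?X ** J4 ** transpose ?X)$a$b = J4$a$b"
    using symplectic_matrix_rows[OF frame_matrix_symplectic[OF assms]] by simp
  then have "?X$a$1 * ?X$b$3 + ?X$a$2 * ?X$b$4 - ?X$a$3 * ?X$b$1 - ?X$a$4 * ?X$b$2 = J4$a$b"
    by (simp add: matrix_matrix_mult_def sum_4 J4_def transpose_def)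
  then show ?thesis by (simp add: frame_matrix_def complex_eq_iff algebra_simps)
qed

text \<open>Each coefficient is the pairing with the symplectic partner of the basis vector:
  \<open>E\<close> with \<open>vcnj N\<close>, \<open>vcnj E\<close> with \<open>N\<close>. The
  factor 2 is the normalisation \<open>Oc E (vcnj N) = 2\<close>. The relations between the rows of
  the frame supply the completeness of the basis.\<close>

lemma symplectic_expand:
  assumes "Oc E (vcnj E) = 0" "Oc E N = 0" "Oc E (vcnj N) = 2" "Oc N (vcnj N) = 0"
  shows "2 *s v = Oc v (vcnj N) *s E + Oc v N *s vcnj E - Oc v (vcnj E) *s N - Oc v E *s vcnj N"
proof -
  let ?G = "\<lambda>a b. E$a * cnj (N$b) + cnj (E$a) * N$b - N$a * cnj (E$b) - cnj (N$a) * E$b"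
  have "(Oc v (vcnj N) *s E + Oc v N *s vcnj E - Oc v (vcnj E) *s N - Oc v E *s vcnj N)$a
      = v$1 * ?G a 3 + v$2 * ?G a 4 - v$3 * ?G a 1 - v$4 * ?G a 2" for a
    by (simp add: Oc_def vcnj_def algebra_simps)
  also have "\<dots> a = (2 *s v)$a" for a
    unfolding symplectic_rows[OF assms] using exhaust_4[of a] by (auto simp: J4_def)
  finally show ?thesis by (simp add: vec_eq_iff)
qed

text \<open>Adding a multiple of \<open>E\<close> to \<open>N\<close> makes \<open>N\<close> isotropic against its conjugate.\<close>

lemma lagrangian_span:
  assumes "Oc E (vcnj E) = 0" "Oc E N = 0" "Oc E (vcnj N) = 2" "Oc v E = 0" "Oc v (vcnj E) = 0"
  obtains x y where "v = x *s E + y *s vcnj E"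
proof -
  define n where "n = Oc N (vcnj N)"
  define N0 where "N0 = N - (n / 4) *s E"
  have n: "cnj n = - n"
    using Oc_vcnj[of N "vcnj N"] Oc_swap[of N "vcnj N"] by (simp add: n_def)
  have "Oc (vcnj E) N = 2" using Oc_vcnj[of E "vcnj N"] assms(3) by simp
  then have NE: "Oc N (vcnj E) = - 2" using Oc_swap by metis
  have "Oc E N0 = 0" "Oc E (vcnj N0) = 2" "Oc N0 (vcnj N0) = 0"
    using assms NE n by (simp_all add: N0_def Oc_simps algebra_simps flip: n_def)
  from symplectic_expand[OF assms(1) this, of v] assms(4,5)
  have "2 *s v = Oc v (vcnj N0) *s E + Oc v N0 *s vcnj E" by simp
  then have "v = (Oc v (vcnj N0) / 2) *s E + (Oc v N0 / 2) *s vcnj E"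
    by (simp add: vec_eq_iff field_simps)
  then show ?thesis by (rule that)
qed

section \<open>Lagrangian immersions of plane domains\<close>

definition complexify :: "real^4 \<Rightarrow> complex^4" where
  "complexify v = (\<chi> a. of_real (v $ a))"

lemma vcnj_complexify [simp]: "vcnj (complexify v) = complexify v"
  by (simp add: vcnj_def complexify_def vec_eq_iff)

lemma bounded_linear_complexify: "bounded_linear complexify"
  by (rule linear_conv_bounded_linear[THEN iffD1], rule linearI)
    (simp_all add: complexify_def vec_eq_iff complex_eq_iff)

text \<open>The four pairings are the coefficients of the symmetric cubic form \<open>\<Omega>(df, d\<^sup>2f)\<close>, which is
  required to be the real part of \<open>t\<^sup>2 dz\<^sup>3\<close>.\<close>

locale cubic_immersion = plane_domain +
  fixes f :: "complex \<Rightarrow> real^4" and t :: "complex \<Rightarrow> complex"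
  assumes smooth_f: "smooth_on S f" and smooth_t: "smooth_on S t"
    and t_nz: "z \<in> S \<Longrightarrow> t z \<noteq> 0"
    and lag: "z \<in> S \<Longrightarrow> Oc (vdz (complexify \<circ> f) z) (vcnj (vdz (complexify \<circ> f) z)) = 0"
    and cub_zzz: "z \<in> S \<Longrightarrow>
      Oc (vdz (complexify \<circ> f) z) (vdz (vdz (complexify \<circ> f)) z) = (t z)\<^sup>2 / 2"
    and cub_zzb: "z \<in> S \<Longrightarrow> Oc (vdz (complexify \<circ> f) z) (vdzb (vdz (complexify \<circ> f)) z) = 0"
    and cub_bbb: "z \<in> S \<Longrightarrow> Oc (vdz (complexify \<circ> f) z) (vcnj (vdz (vdz (complexify \<circ> f)) z)) = 0"
begin

abbreviation "cf \<equiv> complexify \<circ> f"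
abbreviation "phi \<equiv> vdz cf"

section \<open>The moving frame of a cubic immersion and its structure equations\<close>

definition "E z = (2 / t z) *s phi z"
text \<open>The conjugate is taken because \<open>E\<close> pairs to 2 with its own z-derivative,
  whereas in a symplectic basis the partner of \<open>E\<close> is \<open>vcnj N\<close>.\<close>

definition "N z = vcnj (vdz E z)"
text \<open>The coefficient of \<eta> in an adapted frame, expressed through \<open>t\<close>. The
  formula is forced by the reality of the mixed second derivative of f.\<close>

definition "h z = dzb t z / cnj (t z)"
definition "k z = Oc (vdzb N z) (N z) / 2"

lemma smooth_cf: "smooth_on S cf"
  unfolding comp_def by (rule smooth_on_linear[OF open_S bounded_linear_complexify smooth_f])

lemma smooth_E: "smooth_on S E"
  unfolding E_def [abs_def]
  by (intro smooth_vscale smooth_vdz smooth_cf smooth_on_divide open_S t_nz smooth_t smooth_on_const)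

lemma smooth_N: "smooth_on S N"
  unfolding N_def [abs_def] by (intro smooth_vcnj smooth_vdz smooth_E)

lemma smooth_h: "smooth_on S h"
  unfolding h_def [abs_def]
  by (intro smooth_on_divide open_S smooth_dzb smooth_cnj smooth_t) (simp add: t_nz)

lemma smooth_k: "smooth_on S k"
  unfolding k_def [abs_def]
  by (intro smooth_on_divide open_S smooth_Oc smooth_vdzb smooth_N smooth_on_const) simp

lemma phi_eq: "z \<in> S \<Longrightarrow> phi z = (t z / 2) *s E z"
  using t_nz by (simp add: E_def vec_eq_iff)

lemma vdzb_cf: "z \<in> S \<Longrightarrow> vdzb cf z = vcnj (phi z)"
  using vdz_vcnj(2)[OF smooth_cf, of z] by (simp add: comp_def)

text \<open>The mixed derivative of a real map is real: conjugation exchanges the two derivatives,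
  and these commute.\<close>

lemma vdzb_phi_real: assumes "z \<in> S" shows "vcnj (vdzb phi z) = vdzb phi z"
proof -
  have "vcnj (vdzb phi z) = vdz (\<lambda>z. vcnj (phi z)) z"
    using vdz_vcnj(1)[OF smooth_vdz[OF smooth_cf] assms] by simp
  also have "\<dots> = vdz (vdzb cf) z"
    by (rule vdz_cong(1)[OF smooth_vcnj[OF smooth_vdz[OF smooth_cf]] assms]) (simp add: vdzb_cf)
  also have "\<dots> = vdzb phi z" by (rule vdz_vdzb[OF smooth_cf assms])
  finally show ?thesis .
qed

lemma d_phi:
  assumes "z \<in> S"
  shows "vdz phi z = (dz t z / 2) *s E z + (t z / 2) *s vdz E z"
    "vdzb phi z = (dzb t z / 2) *s E z + (t z / 2) *s vdzb E z"
proof -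
  have s: "smooth_on S (\<lambda>z. t z * (1/2))" by (intro smooth_plane smooth_t)
  have p: "phi y = (t y * (1/2)) *s E y" if "y \<in> S" for y using phi_eq[OF that] by simp
  have "dz (\<lambda>z. t z * (1/2)) z = dz t z / 2" "dzb (\<lambda>z. t z * (1/2)) z = dzb t z / 2"
    using dz_rules(3,6)[OF smooth_t smooth_on_const assms, of "1/2"] by simp_all
  then show "vdz phi z = (dz t z / 2) *s E z + (t z / 2) *s vdz E z"
    "vdzb phi z = (dzb t z / 2) *s E z + (t z / 2) *s vdzb E z"
    using vdz_cong[OF smooth_vdz[OF smooth_cf] assms p] vdz_rules(2,4)[OF smooth_E smooth_E s assms]
    by simp_all
qed

lemma E_cE: "z \<in> S \<Longrightarrow> Oc (E z) (vcnj (E z)) = 0"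
  using lag t_nz by (simp add: E_def Oc_simps)

text \<open>In the pairing of phi = (t/2) E with its derivative only the term with the derivative of
  E survives, which gives (t/2)^2 \<open>Oc E (vdz E)\<close> = t^2 / 2. The factor 2 / t in
  \<open>E\<close> is chosen to produce the value 2 needed for a symplectic basis.\<close>

lemma E_Ez: "z \<in> S \<Longrightarrow> Oc (E z) (vdz E z) = 2"
  using cub_zzz[of z] t_nz[of z] unfolding d_phi(1) phi_eq
  by (simp add: phi_eq d_phi Oc_simps power2_eq_square field_simps)

lemma E_cN: "z \<in> S \<Longrightarrow> Oc (E z) (vcnj (N z)) = 2"
  using E_Ez by (simp add: N_def)

lemma E_N: "z \<in> S \<Longrightarrow> Oc (E z) (N z) = 0"
  using cub_bbb[of z] t_nz[of z] E_cE[of z] by (simp add: phi_eq d_phi Oc_simps N_def)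

lemma E_Ezb: "z \<in> S \<Longrightarrow> Oc (E z) (vdzb E z) = 0"
  using cub_zzb[of z] t_nz[of z] by (simp add: phi_eq d_phi Oc_simps)

text \<open>Conjugating \<open>cub_zzb\<close> and using that the zbar derivative of phi is real
  gives the pairing with the conjugate vector.\<close>

lemma cE_Ezb: "z \<in> S \<Longrightarrow> Oc (vcnj (E z)) (vdzb E z) = 0"
proof -
  assume z: "z \<in> S"
  have "Oc (vcnj (phi z)) (vcnj (vdzb phi z)) = 0" using cub_zzb[OF z] by (simp add: Oc_vcnj)
  then have "Oc (vcnj (phi z)) (vdzb phi z) = 0" using vdzb_phi_real[OF z] by simp
  moreover have "Oc (vcnj (E z)) (E z) = 0" using E_cE[OF z] Oc_swap by (metis neg_equal_0_iff_equal)
  ultimately show ?thesis using t_nz[OF z] by (simp add: phi_eq z d_phi Oc_simps)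
qed

lemma cE_N: "z \<in> S \<Longrightarrow> Oc (vcnj (E z)) (N z) = 2"
  using E_cN[of z] Oc_vcnj[of "E z" "vcnj (N z)"] by simp

lemma cE_cN: "z \<in> S \<Longrightarrow> Oc (vcnj (E z)) (vcnj (N z)) = 0"
  using E_N[of z] by (simp add: Oc_vcnj)

text \<open>The coefficient of \<open>E\<close> in \<open>E\<^sub>z\<^sub>b\<close> vanishes since mixed derivatives of \<open>E\<close> commute; the other one is
  determined by \<open>t\<close> because \<open>f\<^sub>z\<^sub>z\<^sub>b\<close> is real.\<close>

lemma E_zb: assumes z: "z \<in> S" shows "vdzb E z = cnj (h z) *s vcnj (E z)"
proof -
  have "Oc (vdzb E z) (E z) = 0" "Oc (vdzb E z) (vcnj (E z)) = 0"
    using E_Ezb[OF z] cE_Ezb[OF z] Oc_swap by (metis neg_equal_0_iff_equal)+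
  then obtain x y where xy: "vdzb E z = x *s E z + y *s vcnj (E z)"
    using lagrangian_span[OF E_cE E_N E_cN] z by metis
  \<comment> \<open>Both differentiated identities contain the pairing of E with its mixed
    derivative. Their difference leaves twice the pairing of the two first derivatives of E, which
    therefore vanishes.\<close>
  have "dzb (\<lambda>z. Oc (E z) (vdz E z)) z = dzb (\<lambda>z. 2) z" "dz (\<lambda>z. Oc (E z) (vdzb E z)) z = dz (\<lambda>z. 0) z"
    using dz_cong(2)[OF smooth_Oc[OF smooth_E smooth_vdz[OF smooth_E]] z E_Ez]
      dz_cong(1)[OF smooth_Oc[OF smooth_E smooth_vdzb[OF smooth_E]] z E_Ezb] by simp_all
  then have "Oc (vdzb E z) (vdz E z) + Oc (E z) (vdzb (vdz E) z) = 0"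
    "Oc (vdz E z) (vdzb E z) + Oc (E z) (vdz (vdzb E) z) = 0"
    by (simp_all add: dz_Oc smooth_E smooth_vdz smooth_vdzb z)
  then have "Oc (vdzb E z) (vdz E z) = 0"
    using Oc_swap[of "vdz E z" "vdzb E z"] vdz_vdzb[OF smooth_E z] by (simp add: eq_neg_iff_add_eq_0)
  then have "x = 0" using E_cN[OF z] cE_cN[OF z] by (simp add: xy Oc_simps N_def)
  then have p: "vdzb phi z = (dzb t z / 2) *s E z + (t z * y / 2) *s vcnj (E z)"
    using d_phi(2)[OF z] xy by simp
  \<comment> \<open>A real vector in the span of E and \<open>vcnj E\<close> has conjugate
    coefficients; pairing with \<open>vcnj N\<close> reads off the coefficient of E.\<close>
  have "vdzb phi z = vcnj ((dzb t z / 2) *s E z + (t z * y / 2) *s vcnj (E z))"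
    using vdzb_phi_real[OF z] p by metis
  then have "Oc (vdzb phi z) (vcnj (N z)) = cnj (t z * y)"
    using E_cN[OF z] cE_cN[OF z] by (simp add: Oc_simps)
  moreover have "Oc (vdzb phi z) (vcnj (N z)) = dzb t z"
    unfolding p using E_cN[OF z] cE_cN[OF z] by (simp add: Oc_simps)
  ultimately have "dzb t z = cnj (t z * y)" by simp
  then have "h z = cnj y" using t_nz[OF z] by (simp add: h_def)
  then show ?thesis using xy \<open>x = 0\<close> by simp
qed

lemma E_z: "vdz E z = vcnj (N z)"
  by (simp add: N_def)

lemma cE_z: "z \<in> S \<Longrightarrow> vdz (\<lambda>z. vcnj (E z)) z = h z *s E z"
  using vdz_vcnj(1)[OF smooth_E, of z] E_zb[of z] by simp

lemma cE_zb: "z \<in> S \<Longrightarrow> vdzb (\<lambda>z. vcnj (E z)) z = N z"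
  using vdz_vcnj(2)[OF smooth_E, of z] by (simp add: N_def)

text \<open>\<open>N\<close> is the zbar derivative of \<open>vcnj E\<close>, so its z-derivative is
  the zbar derivative of h E, which is already known.\<close>

lemma N_z: assumes z: "z \<in> S" shows "vdz N z = dzb h z *s E z + (h z * cnj (h z)) *s vcnj (E z)"
proof -
  have "vdz N z = vdz (vdzb (\<lambda>z. vcnj (E z))) z"
    by (rule vdz_cong(1)[OF smooth_N z]) (simp add: cE_zb)
  also have "\<dots> = vdzb (vdz (\<lambda>z. vcnj (E z))) z"
    by (rule vdz_vdzb[OF smooth_vcnj[OF smooth_E] z])
  also have "\<dots> = vdzb (\<lambda>z. h z *s E z) z"
    by (rule vdz_cong(2)[OF smooth_vdz[OF smooth_vcnj[OF smooth_E]] z]) (simp add: cE_z)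
  also have "\<dots> = dzb h z *s E z + (h z * cnj (h z)) *s vcnj (E z)"
    using vdz_rules(4)[OF smooth_E smooth_E smooth_h z] E_zb[OF z] by simp
  finally show ?thesis .
qed

lemma cN_zb: "z \<in> S \<Longrightarrow>
    vdzb (\<lambda>z. vcnj (N z)) z = cnj (dzb h z) *s vcnj (E z) + (h z * cnj (h z)) *s E z"
  using vdz_vcnj(2)[OF smooth_N, of z] N_z[of z] by (simp add: mult.commute)

text \<open>The zbar derivative of \<open>vcnj N\<close> lies in the isotropic span of E and
  \<open>vcnj E\<close>. Differentiating \<open>cE_cN\<close> thus leaves only the pairing of N with
  its conjugate. This completes the symplectic basis.\<close>

lemma N_cN: assumes z: "z \<in> S" shows "Oc (N z) (vcnj (N z)) = 0"
proof -
  have s: "smooth_on S (\<lambda>z. vcnj (E z))" "smooth_on S (\<lambda>z. vcnj (N z))"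
    by (intro smooth_vcnj smooth_E smooth_N)+
  have "dzb (\<lambda>z. Oc (vcnj (E z)) (vcnj (N z))) z = dzb (\<lambda>z. 0) z"
    by (rule dz_cong(2)[OF smooth_Oc[OF s] z]) (simp add: cE_cN)
  then have "Oc (vdzb (\<lambda>z. vcnj (E z)) z) (vcnj (N z)) + Oc (vcnj (E z)) (vdzb (\<lambda>z. vcnj (N z)) z) = 0"
    by (simp add: dz_Oc(2)[OF s z])
  then show ?thesis
    using E_cE[OF z] Oc_swap[of "E z" "vcnj (E z)"] by (simp add: cE_zb cN_zb z Oc_simps)
qed

text \<open>Three of the four coefficients come from differentiating the pairings of N with E,
  \<open>vcnj E\<close> and \<open>vcnj N\<close>. The fourth is the pairing of the derivative with
  N itself, on which the trivial identity \<open>Oc N N = 0\<close> says nothing; it stays as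
  \<open>k\<close>.\<close>

lemma N_zb: assumes z: "z \<in> S"
  shows "vdzb N z = cnj (dzb h z) *s E z + k z *s vcnj (E z) - cnj (h z) *s vcnj (N z)"
proof -
  note s = smooth_E smooth_vcnj[OF smooth_E] smooth_N smooth_vcnj[OF smooth_N]
  note p = E_cE[OF z] E_N[OF z] E_cN[OF z] cE_N[OF z] cE_cN[OF z] N_cN[OF z]
  have NE: "Oc (N z) (E z) = 0" "Oc (N z) (vcnj (E z)) = - 2"
    using p(2,4) Oc_swap[of "N z" "E z"] Oc_swap[of "N z" "vcnj (E z)"] by simp_all
  have "dzb (\<lambda>z. Oc (E z) (N z)) z = dzb (\<lambda>z. 0) z"
    by (rule dz_cong(2)[OF smooth_Oc[OF s(1,3)] z]) (simp add: E_N)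
  then have "Oc (vdzb E z) (N z) + Oc (E z) (vdzb N z) = 0" by (simp add: dz_Oc(2)[OF s(1,3) z])
  then have 1: "Oc (vdzb N z) (E z) = 2 * cnj (h z)"
    unfolding Oc_swap[of "vdzb N z" "E z"] neg_eq_iff_add_eq_0
    using p by (simp add: E_zb[OF z] Oc_simps add.commute mult.commute)
  have "dzb (\<lambda>z. Oc (vcnj (E z)) (N z)) z = dzb (\<lambda>z. 2) z"
    by (rule dz_cong(2)[OF smooth_Oc[OF s(2,3)] z]) (simp add: cE_N)
  then have "Oc (vdzb (\<lambda>z. vcnj (E z)) z) (N z) + Oc (vcnj (E z)) (vdzb N z) = 0"
    by (simp add: dz_Oc(2)[OF s(2,3) z])
  then have 2: "Oc (vdzb N z) (vcnj (E z)) = 0"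
    using Oc_swap[of "vdzb N z" "vcnj (E z)"] by (simp add: cE_zb[OF z] Oc_simps)
  have "dzb (\<lambda>z. Oc (N z) (vcnj (N z))) z = dzb (\<lambda>z. 0) z"
    by (rule dz_cong(2)[OF smooth_Oc[OF s(3,4)] z]) (simp add: N_cN)
  then have "Oc (vdzb N z) (vcnj (N z)) + Oc (N z) (vdzb (\<lambda>z. vcnj (N z)) z) = 0"
    by (simp add: dz_Oc(2)[OF s(3,4) z])
  then have 3: "Oc (vdzb N z) (vcnj (N z)) = 2 * cnj (dzb h z)"
    using NE by (simp add: cN_zb[OF z] Oc_simps)
  have "2 *s vdzb N z = (2 * cnj (dzb h z)) *s E z + (2 * k z) *s vcnj (E z) - (2 * cnj (h z)) *s vcnj (N z)"
    using symplectic_expand[OF p(1,2,3,6), of "vdzb N z"] 1 2 3 by (simp add: k_def)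
  also have "\<dots> = 2 *s (cnj (dzb h z) *s E z + k z *s vcnj (E z) - cnj (h z) *s vcnj (N z))"
    by (simp add: vec_eq_iff algebra_simps)
  finally show ?thesis unfolding vector_mul_lcancel by simp
qed

text \<open>Both relations come from equality of the mixed derivatives of N. They are affine in k
  with coefficients built from h, so for two immersions with the same h the difference of the k has
  zero z-derivative and becomes real after multiplication by h.\<close>

lemma k_z: assumes z: "z \<in> S"
  shows "dz k z = 3 * cnj (h z) * dzb h z + h z * dzb (\<lambda>z. cnj (h z)) z"
    and "dzb (dzb h) z - h z * k z = cnj (dzb (dzb h) z - h z * k z)"
proof -
  note s = smooth_E smooth_vcnj[OF smooth_E] smooth_N smooth_vcnj[OF smooth_N] smooth_h smooth_k
    smooth_cnj[OF smooth_h]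
  note p = E_cE[OF z] E_N[OF z] E_cN[OF z] cE_N[OF z] cE_cN[OF z] N_cN[OF z]
  have q: "Oc (N z) (E z) = 0" "Oc (N z) (vcnj (E z)) = - 2" "Oc (vcnj (N z)) (E z) = - 2"
      "Oc (vcnj (E z)) (E z) = 0" "Oc (vcnj (N z)) (vcnj (E z)) = 0" "Oc (vcnj (N z)) (N z) = 0"
    using p Oc_swap by (metis minus_zero)+
  have hh: "dzb (\<lambda>z. h z * cnj (h z)) z = dzb h z * cnj (h z) + h z * dzb (\<lambda>z. cnj (h z)) z"
    by (rule dz_rules(6)[OF s(5,7) z])
  have s1: "smooth_on S (\<lambda>z. h z * cnj (h z))" "smooth_on S (dzb h)"
    by (intro smooth_plane s smooth_dzb)+
  have "vdzb (vdz N) z = vdzb (\<lambda>z. dzb h z *s E z + (h z * cnj (h z)) *s vcnj (E z)) z"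
    by (rule vdz_cong(2)[OF smooth_vdz[OF smooth_N] z]) (simp add: N_z)
  also have "\<dots> = vdzb (\<lambda>z. dzb h z *s E z) z + vdzb (\<lambda>z. (h z * cnj (h z)) *s vcnj (E z)) z"
    by (rule vdz_rules(3)[OF smooth_vscale[OF s1(2) s(1)] smooth_vscale[OF s1(1) s(2)] smooth_h z])
  also have "\<dots> = (dzb (dzb h) z) *s E z + (dzb h z * cnj (h z)) *s vcnj (E z)
      + dzb (\<lambda>z. h z * cnj (h z)) z *s vcnj (E z) + (h z * cnj (h z)) *s N z"
    by (simp add: vdz_rules(4)[OF s(1,1) s1(2) z] vdz_rules(4)[OF s(2,2) s1(1) z] E_zb[OF z] cE_zb[OF z])
  finally have A: "vdz (vdzb N) z = (dzb (dzb h) z) *s E z + (dzb h z * cnj (h z)) *s vcnj (E z)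
      + (dzb h z * cnj (h z) + h z * dzb (\<lambda>z. cnj (h z)) z) *s vcnj (E z) + (h z * cnj (h z)) *s N z"
    unfolding hh vdz_vdzb[OF smooth_N z] .
  have "dz k z = dz (\<lambda>z. Oc (vdzb N z) (N z) * (1/2)) z" by (simp add: k_def [abs_def])
  also have "\<dots> = (Oc (vdz (vdzb N) z) (N z) + Oc (vdzb N z) (vdz N z)) / 2"
    using dz_rules(3)[OF smooth_Oc[OF smooth_vdzb[OF smooth_N] smooth_N] smooth_on_const z, of "1/2"]
      dz_Oc(1)[OF smooth_vdzb[OF smooth_N] smooth_N z] by simp
  also have "\<dots> = 3 * cnj (h z) * dzb h z + h z * dzb (\<lambda>z. cnj (h z)) z"
    unfolding A N_zb[OF z] N_z[OF z] by (simp only: Oc_simps p q) (simp add: algebra_simps)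
  finally show "dz k z = 3 * cnj (h z) * dzb h z + h z * dzb (\<lambda>z. cnj (h z)) z" .
  have b: "smooth_on S (\<lambda>z. cnj (dzb h z))" by (intro smooth_cnj s1)
  have "vdz (vdzb N) z = vdz (\<lambda>z. (cnj (dzb h z) *s E z + k z *s vcnj (E z)) - cnj (h z) *s vcnj (N z)) z"
    by (rule vdz_cong(1)[OF smooth_vdzb[OF smooth_N] z]) (simp add: N_zb)
  also have "\<dots> = vdz (\<lambda>z. cnj (dzb h z) *s E z + k z *s vcnj (E z)) z - vdz (\<lambda>z. cnj (h z) *s vcnj (N z)) z"
    by (rule vdz_rules(5)[OF smooth_on_add[OF open_S smooth_vscale[OF b s(1)] smooth_vscale[OF s(6,2)]]
          smooth_vscale[OF s(7,4)] smooth_h z])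
  also have "\<dots> = vdz (\<lambda>z. cnj (dzb h z) *s E z) z + vdz (\<lambda>z. k z *s vcnj (E z)) z
      - vdz (\<lambda>z. cnj (h z) *s vcnj (N z)) z"
    by (simp add: vdz_rules(1)[OF smooth_vscale[OF b s(1)] smooth_vscale[OF s(6,2)] smooth_h z])
  also have "\<dots> = cnj (dzb (dzb h) z) *s E z + cnj (dzb h z) *s vcnj (N z) + dz k z *s vcnj (E z)
      + (k z * h z) *s E z - dz (\<lambda>z. cnj (h z)) z *s vcnj (N z) - cnj (h z) *s vcnj (vdzb N z)"
    by (simp add: vdz_rules(2)[OF s(1,1) b z] vdz_rules(2)[OF s(2,2,6) z] vdz_rules(2)[OF s(4,4,7) z]
        E_z cE_z[OF z] dz_cnj(1)[OF s1(2) z] vdz_vcnj(1)[OF smooth_N z])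
  finally have B: "vdz (vdzb N) z = cnj (dzb (dzb h) z) *s E z + cnj (dzb h z) *s vcnj (N z)
      + dz k z *s vcnj (E z) + (k z * h z) *s E z - dz (\<lambda>z. cnj (h z)) z *s vcnj (N z)
      - cnj (h z) *s vcnj (vdzb N z)" .
  \<comment> \<open>Pairing with \<open>vcnj N\<close> extracts the coefficient of E from the two
    expressions \<open>A\<close> and \<open>B\<close> for the same mixed derivative.\<close>
  have "2 * dzb (dzb h) z = Oc (vdz (vdzb N) z) (vcnj (N z))"
    unfolding A by (simp only: Oc_simps p q) simp
  also have "\<dots> = 2 * cnj (dzb (dzb h) z) + 2 * k z * h z - 2 * cnj (h z) * cnj (k z)"
    unfolding B N_zb[OF z] by (simp add: Oc_simps p q algebra_simps)
  finally have "2 * (dzb (dzb h) z - h z * k z) = 2 * cnj (dzb (dzb h) z - h z * k z)"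
    by (simp add: algebra_simps)
  then show "dzb (dzb h) z - h z * k z = cnj (dzb (dzb h) z - h z * k z)"
    unfolding mult_cancel_left by simp
qed

end

section \<open>Rigidity on plane domains\<close>

definition cmv :: "real^4^4 \<Rightarrow> complex^4 \<Rightarrow> complex^4" where
  "cmv M v = (\<chi> a. \<Sum>c\<in>UNIV. of_real (M$a$c) * v$c)"

lemma cmv_simps:
  "cmv M (c *s v) = c *s cmv M v" "cmv M (vcnj v) = vcnj (cmv M v)"
  "cmv M (complexify w) = complexify (M *v w)"
  by (simp_all add: cmv_def vcnj_def complexify_def matrix_vector_mult_def vec_eq_iff sum_distrib_left
      algebra_simps)

lemma complexify_diff: "complexify (v - w) = complexify v - complexify w"
  by (simp add: complexify_def vec_eq_iff)

lemma cmv_frame_matrix: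
  "L ** frame_matrix E N = frame_matrix E' N' \<longleftrightarrow> cmv L E = E' \<and> cmv L N = N'"
  by (auto simp: vec_eq_iff forall_4 matrix_matrix_mult_def sum_4 frame_matrix_def cmv_def complex_eq_iff)

lemma Sp4_iff: "X \<in> Sp4 \<longleftrightarrow> transpose X ** J4 ** X = J4"
  using symplectic_left_inverse[of X] by (auto simp: Sp4_def invertible_def)

text \<open>With Y the inverse of X, both Y and L X preserve the form, and L is the product of L X
  and Y.\<close>

lemma Sp4_divide:
  assumes X: "transpose X ** J4 ** X = J4" and Y: "transpose (L ** X) ** J4 ** (L ** X) = J4"
  shows "L \<in> Sp4"
proof -
  let ?Y = "- (J4 ** transpose X ** J4)"
  have i: "X ** ?Y = mat 1" by (rule symplectic_left_inverse(2)[OF X])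
  have "transpose ?Y ** (transpose X ** (transpose L ** J4 ** L) ** X) ** ?Y
      = transpose (X ** ?Y) ** (transpose L ** J4 ** L) ** (X ** ?Y)"
    by (simp only: matrix_transpose_mul matrix_mul_assoc)
  also have "\<dots> = transpose L ** J4 ** L" unfolding i by (simp add: transpose_mat)
  finally have 1: "transpose L ** J4 ** L = transpose ?Y ** (transpose (L ** X) ** J4 ** (L ** X)) ** ?Y"
    by (simp add: matrix_transpose_mul matrix_mul_assoc)
  have "transpose ?Y ** (transpose X ** J4 ** X) ** ?Y = transpose (X ** ?Y) ** J4 ** (X ** ?Y)"
    by (simp only: matrix_transpose_mul matrix_mul_assoc)
  also have "\<dots> = J4" unfolding i by (simp add: transpose_mat)
  finally have 2: "transpose ?Y ** J4 ** ?Y = J4" unfolding X .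
  show ?thesis unfolding Sp4_iff 1 unfolding Y by (rule 2)
qed

context plane_domain
begin

lemma constant_if_dz_0:
  assumes "convex S" "smooth_on S F" "\<And>z. z \<in> S \<Longrightarrow> dz F z = 0" "\<And>z. z \<in> S \<Longrightarrow> dzb F z = 0"
  shows "\<exists>c. \<forall>z\<in>S. F z = c"
proof (rule has_derivative_zero_constant[OF assms(1)])
  fix z assume z: "z \<in> S"
  have "pd 1 F z = dz F z + dzb F z" "pd \<i> F z = \<i> * (dz F z - dzb F z)"
    by (simp_all add: complex_eq_iff dz_def dzb_def diff_divide_distrib add_divide_distrib)
  then have "pd v F z = 0" for v
    unfolding pd_complex_dir[OF smooth_on_differentiable[OF assms(2) z], of v] using assms(3,4)[OF z]
    by simp
  then show "(F has_derivative (\<lambda>v. 0)) (at z within S)"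
    using smooth_on_has_derivative[OF assms(2) z] has_derivative_at_withinI by simp
qed

text \<open>For a real map the zbar derivative is the conjugate of the z-derivative, so one of them
  suffices.\<close>

lemma constant_if_vdz_0:
  assumes "convex S" "smooth_on S u" "\<And>z. z \<in> S \<Longrightarrow> vdz (\<lambda>z. complexify (u z)) z = 0"
  shows "\<exists>c. \<forall>z\<in>S. u z = c"
proof -
  have s: "smooth_on S (\<lambda>z. complexify (u z))"
    by (rule smooth_on_linear[OF open_S bounded_linear_complexify assms(2)])
  have "\<exists>c. \<forall>z\<in>S. complexify (u z) $ a = c" for a
  proof (rule constant_if_dz_0[OF assms(1) smooth_on_vec_nth[OF open_S s]])
    fix z assume z: "z \<in> S"
    show 1: "dz (\<lambda>z. complexify (u z) $ a) z = 0"
      using assms(3)[OF z] by (simp add: vdz_def vec_eq_iff)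
    have "dzb (\<lambda>z. cnj (complexify (u z) $ a)) z = cnj (dz (\<lambda>z. complexify (u z) $ a) z)"
      by (rule dz_cnj(2)[OF smooth_on_vec_nth[OF open_S s] z])
    then show "dzb (\<lambda>z. complexify (u z) $ a) z = 0" using 1 by (simp add: complexify_def)
  qed
  then obtain c where "complexify (u z) $ a = c a" if "z \<in> S" for z a by metis
  then have "u z = (\<chi> a. Re (c a))" if "z \<in> S" for z
    using that by (simp add: vec_eq_iff complexify_def) (metis Re_complex_of_real)
  then show ?thesis by blast
qed

lemma vdz_cmv:
  assumes "smooth_on S F" "z \<in> S"
  shows "vdz (\<lambda>z. cmv M (F z)) z = cmv M (vdz F z)"
proof -
  note s = smooth_on_vec_nth[OF open_S assms(1)]
  have c: "dz (\<lambda>z. of_real r * F z $ a) z = of_real r * dz (\<lambda>z. F z $ a) z" for r a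
    using dz_rules(3)[OF smooth_on_const s assms(2)] by simp
  have sc: "smooth_on S (\<lambda>z. of_real r * F z $ a)" for r a
    by (intro smooth_on_mult open_S smooth_on_const s)
  show ?thesis
    by (simp add: vdz_def cmv_def vec_eq_iff sum_4 dz_rules(1)[OF _ _ assms(2)] sc c smooth_on_add open_S)
qed

text \<open>Logarithmic differentiation of \<open>h D = cnj (h D)\<close> shows that \<open>(h\<^sub>z\<^sub>b / h)\<^sub>z\<close> is real.\<close>

lemma P_vanishes:
  assumes h: "smooth_on S h" "\<And>z. z \<in> S \<Longrightarrow> h z \<noteq> 0"
    and D: "smooth_on S D" "\<And>z. z \<in> S \<Longrightarrow> D z \<noteq> 0" "\<And>z. z \<in> S \<Longrightarrow> dz D z = 0"
    and r: "\<And>z. z \<in> S \<Longrightarrow> h z * D z = cnj (h z * D z)" and z: "z \<in> S"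
  shows "dzb (\<lambda>p. dz (\<lambda>p. cnj (h p)) p * inverse (cnj (h p))) z - dz (\<lambda>p. dzb h p * inverse (h p)) z = 0"
proof -
  let ?hb = "\<lambda>p. cnj (h p)" and ?Db = "\<lambda>p. cnj (D p)"
  have hb: "smooth_on S ?hb" "\<And>z. z \<in> S \<Longrightarrow> ?hb z \<noteq> 0" and Db: "smooth_on S ?Db" "\<And>z. z \<in> S \<Longrightarrow> ?Db z \<noteq> 0"
    using h D by (auto intro: smooth_cnj)
  have Db': "dzb ?Db z = 0" if "z \<in> S" for z using dz_cnj(2)[OF D(1) that] D(3)[OF that] by simp
  have ih: "smooth_on S (\<lambda>p. inverse (h p))" and iDb: "smooth_on S (\<lambda>p. inverse (?Db p))"
    by (intro smooth_on_inverse open_S h Db; simp)+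
  \<comment> \<open>The logarithmic z-derivative of h D = cnj h cnj D; the factor D contributes
    nothing because its z-derivative vanishes.\<close>
  have 1: "dz ?hb p * inverse (?hb p) = dz h p * inverse (h p) - dz ?Db p * inverse (?Db p)" if p: "p \<in> S" for p
  proof -
    have "dz (\<lambda>p. h p * D p) p = dz (\<lambda>p. ?hb p * ?Db p) p"
      by (rule dz_cong(1)[OF smooth_on_mult[OF open_S h(1) D(1)] p]) (use r in simp)
    then have e: "dz h p * D p = dz ?hb p * ?Db p + ?hb p * dz ?Db p"
      using dz_rules(3)[OF h(1) D(1) p] dz_rules(3)[OF hb(1) Db(1) p] D(3)[OF p] by simp
    have "dz h p * inverse (h p) = (dz h p * D p) * inverse (h p * D p)"
      using D(2)[OF p] by simp
    also have "\<dots> = (dz ?hb p * ?Db p + ?hb p * dz ?Db p) * inverse (?hb p * ?Db p)"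
      using e r[OF p] by simp
    also have "\<dots> = dz ?hb p * inverse (?hb p) + dz ?Db p * inverse (?Db p)"
      using hb(2)[OF p] Db(2)[OF p] by (simp add: field_simps)
    finally show ?thesis by simp
  qed
  note s1 = smooth_on_mult[OF open_S smooth_dz[OF h(1)] ih]
    and s2 = smooth_on_mult[OF open_S smooth_dz[OF Db(1)] iDb]
  have "dzb (\<lambda>p. dz ?hb p * inverse (?hb p)) z
      = dzb (\<lambda>p. dz h p * inverse (h p) - dz ?Db p * inverse (?Db p)) z"
    by (rule dz_cong(2)[OF smooth_on_mult[OF open_S smooth_dz[OF hb(1)] smooth_on_inverse[OF open_S hb(2) hb(1)]] z 1])
  also have "\<dots> = dzb (\<lambda>p. dz h p * inverse (h p)) z - dzb (\<lambda>p. dz ?Db p * inverse (?Db p)) z"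
    by (rule dz_rules(5)[OF s1 s2 z])
  \<comment> \<open>The conjugate of D is holomorphic, hence so is its logarithmic
    derivative.\<close>
  also have "dzb (\<lambda>p. dz ?Db p * inverse (?Db p)) z = 0"
  proof -
    have "dzb (dz ?Db) z = dz (dzb ?Db) z" by (rule dz_dzb[OF Db(1) z, symmetric])
    also have "\<dots> = dz (\<lambda>z. 0) z" by (rule dz_cong(1)[OF smooth_dzb[OF Db(1)] z Db'])
    finally show ?thesis
      using dz_rules(6)[OF smooth_dz[OF Db(1)] iDb z] dz_inverse(2)[OF Db z] Db'[OF z] by simp
  qed
  \<comment> \<open>Both are the mixed derivative of log h, written without a logarithm.\<close>
  also have "dzb (\<lambda>p. dz h p * inverse (h p)) z = dz (\<lambda>p. dzb h p * inverse (h p)) z"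
    using dz_rules(6)[OF smooth_dz[OF h(1)] ih z] dz_rules(3)[OF smooth_dzb[OF h(1)] ih z]
      dz_inverse[OF h z] dz_dzb[OF h(1) z] by simp
  finally show ?thesis by simp
qed

end

context cubic_immersion
begin

lemma symplectic_relations:
  assumes "z \<in> S"
  shows "Oc (E z) (vcnj (E z)) = 0" "Oc (E z) (N z) = 0" "Oc (E z) (vcnj (N z)) = 2" "Oc (N z) (vcnj (N z)) = 0"
  using assms by (rule E_cE E_N E_cN N_cN)+

text \<open>The image of an open set lies in no proper affine subspace: a linear map that is
  constant on the values of f annihilates the derivative of f, hence E and, after one more
  derivative, N. Real and imaginary parts of these form a basis.\<close>

lemma affine_eq:
  assumes "S \<noteq> {}" "\<And>z. z \<in> S \<Longrightarrow> affine_act D (f z) = affine_act D' (f z)"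
  shows "D = D'"
proof -
  let ?M = "snd D - snd D'"
  have M: "?M *v f z = fst D' - fst D" if "z \<in> S" for z
    using assms(2)[OF that] by (simp add: affine_act_def matrix_vector_mult_diff_rdistrib algebra_simps)
  obtain z where z: "z \<in> S" using assms(1) by blast
  have 1: "cmv ?M (phi z) = 0" if z: "z \<in> S" for z
  proof -
    have s: "smooth_on S (\<lambda>z. complexify (f z))" using smooth_cf by (simp add: comp_def)
    have "cmv ?M (phi z) = vdz (\<lambda>z. cmv ?M (complexify (f z))) z"
      using vdz_cmv[OF s z, of ?M] by (simp add: comp_def)
    also have "\<dots> = vdz (\<lambda>z. complexify (fst D' - fst D)) z"
    proof (rule vdz_cong(1)[OF _ z, symmetric])
      show "smooth_on S (\<lambda>z. complexify (fst D' - fst D))" by (rule smooth_on_const)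
    qed (simp add: cmv_simps M)
    also have "\<dots> = 0" by (simp add: vdz_def vec_eq_iff)
    finally show ?thesis .
  qed
  have 2: "cmv ?M (E z) = 0" if z: "z \<in> S" for z
    using 1[OF z] by (simp add: E_def cmv_simps)
  have "cmv ?M (vdz E z) = vdz (\<lambda>z. cmv ?M (E z)) z" by (rule vdz_cmv[OF smooth_E z, symmetric])
  also have "\<dots> = vdz (\<lambda>z. 0) z"
    by (rule vdz_cong(1)[OF _ z, symmetric]) (simp_all add: 2 smooth_on_const)
  also have "\<dots> = 0" by (simp add: vdz_def vec_eq_iff)
  finally have "cmv ?M (N z) = 0" unfolding N_def cmv_simps by (simp add: vcnj_def vec_eq_iff)
  then have "?M ** frame_matrix (E z) (N z) = frame_matrix 0 0"
    using 2[OF z] by (simp add: cmv_frame_matrix)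
  also have "frame_matrix 0 0 = 0" by (simp add: frame_matrix_def vec_eq_iff)
  finally have "?M ** (frame_matrix (E z) (N z) **
      - (J4 ** transpose (frame_matrix (E z) (N z)) ** J4)) = 0"
    by (simp add: matrix_mul_assoc)
  then have "?M = 0"
    using symplectic_left_inverse(2)[OF frame_matrix_symplectic[OF symplectic_relations[OF z]]] by simp
  then show ?thesis using M[OF z] by (simp add: prod_eq_iff)
qed

end

text \<open>As \<open>h\<close> is built from \<open>t\<close> alone, it is literally the same
  function for both immersions; only \<open>k\<close> may differ. Convexity is there to conclude
  constancy from vanishing derivatives.\<close>

locale cubic_pair = A: cubic_immersion S f t + B: cubic_immersion S f' t for S f f' t +
  assumes convex_S: "convex S" and h_nz: "z \<in> S \<Longrightarrow> A.h z \<noteq> 0"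
    and P_nz: "z \<in> S \<Longrightarrow> dzb (\<lambda>p. dz (\<lambda>p. cnj (A.h p)) p * inverse (cnj (A.h p))) z
      - dz (\<lambda>p. dzb A.h p * inverse (A.h p)) z \<noteq> 0"
begin

lemma k_eq: assumes "z \<in> S" shows "B.k z = A.k z"
proof (rule ccontr)
  assume nz: "B.k z \<noteq> A.k z"
  define D where "D z = B.k z - A.k z" for z
  have sD: "smooth_on S D"
    unfolding D_def [abs_def] by (intro smooth_on_diff A.open_S A.smooth_k B.smooth_k)
  \<comment> \<open>\<open>P_vanishes\<close> divides by D, so it is applied on the open set where D
    has no zero.\<close>
  define T where "T = {z \<in> S. D z \<in> - {0}}"
  have T: "T = S \<inter> D -` (- {0})" by (auto simp: T_def)
  have oT: "open T"
    unfolding T by (intro continuous_open_preimage smooth_on_continuous sD A.open_S open_Compl closed_singleton)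
  interpret T: plane_domain T by unfold_locales (rule oT)
  have TS: "T \<subseteq> S" "z \<in> T" using assms nz by (auto simp: T_def D_def)
  have "dz D y = 0" if "y \<in> S" for y
    unfolding D_def [abs_def] A.dz_rules(2)[OF B.smooth_k A.smooth_k that] A.k_z(1)[OF that] B.k_z(1)[OF that]
    by simp
  moreover have "A.h y * D y = cnj (A.h y * D y)" if "y \<in> S" for y
  proof -
    have "A.h y * D y = (dzb (dzb A.h) y - A.h y * A.k y) - (dzb (dzb A.h) y - A.h y * B.k y)"
      by (simp add: D_def algebra_simps)
    also have "\<dots> = cnj (dzb (dzb A.h) y - A.h y * A.k y) - cnj (dzb (dzb A.h) y - A.h y * B.k y)"
      using A.k_z(2)[OF that] B.k_z(2)[OF that] by metis
    also have "\<dots> = cnj (A.h y * D y)" by (simp add: D_def algebra_simps)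
    finally show ?thesis .
  qed
  ultimately have "dzb (\<lambda>p. dz (\<lambda>p. cnj (A.h p)) p * inverse (cnj (A.h p))) z
      - dz (\<lambda>p. dzb A.h p * inverse (A.h p)) z = 0"
    using TS h_nz
    by (intro T.P_vanishes[of A.h D] smooth_on_subset[OF A.smooth_h] smooth_on_subset[OF sD])
      (auto simp: T_def)
  then show False using P_nz[OF assms] by simp
qed

text \<open>Twice the entry (a, b) of Y J X^T, where X and Y are the real frame matrices of the two
  immersions. Up to the constant right factor -J this is the transition matrix Y X^(-1), in a form
  that is bilinear in the frames and can be differentiated without inverting a matrix.\<close>

definition "G a b z = B.E z $ a * cnj (A.N z $ b) + cnj (B.E z $ a) * A.N z $ b
  - B.N z $ a * cnj (A.E z $ b) - cnj (B.N z $ a) * A.E z $ b"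

text \<open>By \<open>k_eq\<close> both frames satisfy dX = X \<theta>, dY = Y \<theta> with one
  \<theta> in the symplectic Lie algebra, so d(Y J X^T) = Y (\<theta> J + J \<theta>^T) X^T = 0. The
  computation verifies this entrywise.\<close>

lemma G_constant: "\<exists>c. \<forall>z\<in>S. G a b z = c"
proof (rule A.constant_if_dz_0[OF convex_S])
  note nth = smooth_on_vec_nth[OF A.open_S]
  note s = nth[OF A.smooth_E] nth[OF B.smooth_E] nth[OF A.smooth_N] nth[OF B.smooth_N]
  note sc = s[THEN A.smooth_cnj]
  show sG: "smooth_on S (G a b)"
    unfolding G_def [abs_def] by (intro A.smooth_plane sc s)
  show dG: "dz (G a b) z = 0" if z: "z \<in> S" for z
  proof -
    have d: "dz (\<lambda>z. A.E z $ b) z = cnj (A.N z $ b)" "dz (\<lambda>z. B.E z $ a) z = cnj (B.N z $ a)"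
      using A.E_z[of z] B.E_z[of z] by (simp_all add: vdz_def vcnj_def vec_eq_iff)
    have dc: "dz (\<lambda>z. cnj (A.E z $ b)) z = A.h z * A.E z $ b" "dz (\<lambda>z. cnj (B.E z $ a)) z = A.h z * B.E z $ a"
      using A.cE_z[OF z] B.cE_z[OF z] by (simp_all add: vdz_def vcnj_def vec_eq_iff)
    have n: "dz (\<lambda>z. A.N z $ b) z = dzb A.h z * A.E z $ b + (A.h z * cnj (A.h z)) * cnj (A.E z $ b)"
      "dz (\<lambda>z. B.N z $ a) z = dzb A.h z * B.E z $ a + (A.h z * cnj (A.h z)) * cnj (B.E z $ a)"
      using A.N_z[OF z] B.N_z[OF z] by (simp_all add: vdz_def vcnj_def vec_eq_iff)
    have nc: "dz (\<lambda>z. cnj (A.N z $ b)) z = dzb A.h z * cnj (A.E z $ b) + cnj (A.k z) * A.E z $ b - A.h z * A.N z $ b"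
      "dz (\<lambda>z. cnj (B.N z $ a)) z = dzb A.h z * cnj (B.E z $ a) + cnj (A.k z) * B.E z $ a - A.h z * B.N z $ a"
      using A.vdz_vcnj(1)[OF A.smooth_N z] A.vdz_vcnj(1)[OF B.smooth_N z]
      unfolding A.N_zb[OF z] B.N_zb[OF z] k_eq[OF z]
      by (simp_all add: vdz_def vcnj_def vec_eq_iff)
    show ?thesis
      unfolding G_def [abs_def]
      by (simp add: A.dz_rules A.smooth_plane s sc z d dc n nc) (simp add: algebra_simps)
  qed
  show "dzb (G a b) z = 0" if z: "z \<in> S" for z
  proof -
    \<comment> \<open>G is real, so the zbar derivative is the conjugate of the
      z-derivative.\<close>
    have "G a b = (\<lambda>z. cnj (G a b z))" by (simp add: G_def fun_eq_iff algebra_simps)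
    then show ?thesis using A.dz_cnj(2)[OF sG z] dG[OF z] by simp
  qed
qed

theorem affine_rigidity:
  assumes "S \<noteq> {}"
  shows "\<exists>D\<in>affine_Sp4. \<forall>z\<in>S. f' z = affine_act D (f z)"
proof -
  obtain z0 where z0: "z0 \<in> S" using assms by blast
  let ?X = "\<lambda>z. frame_matrix (A.E z) (A.N z)" and ?Y = "\<lambda>z. frame_matrix (B.E z) (B.N z)"
  define L where "L z = ?Y z ** - (J4 ** transpose (?X z) ** J4)" for z
  have "2 * (?Y z ** J4 ** transpose (?X z)) $ a $ b = Re (G a b z)" for a b z
    by (simp add: G_def frame_matrix_def matrix_matrix_mult_def sum_4 J4_def transpose_def algebra_simps)
  moreover have "G a b z = G a b z0" if "z \<in> S" for a b z
    using G_constant[of a b] that z0 by metis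
  ultimately have "2 * (?Y z ** J4 ** transpose (?X z)) $ a $ b = 2 * (?Y z0 ** J4 ** transpose (?X z0)) $ a $ b"
    if "z \<in> S" for a b z
    using that by simp
  then have "?Y z ** J4 ** transpose (?X z) = ?Y z0 ** J4 ** transpose (?X z0)" if "z \<in> S" for z
    using that by (simp add: vec_eq_iff)
  then have L: "L z = L z0" if "z \<in> S" for z
    using that by (simp add: L_def matrix_mul_neg matrix_mul_assoc)
  have LX: "L z0 ** ?X z = ?Y z" if z: "z \<in> S" for z
  proof -
    have "L z ** ?X z = ?Y z ** (- (J4 ** transpose (?X z) ** J4) ** ?X z)"
      by (simp only: L_def matrix_mul_assoc)
    then show ?thesis
      using symplectic_left_inverse(1)[OF frame_matrix_symplectic[OF A.symplectic_relations[OF z]]] L[OF z]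
      by simp
  qed
  have "L z0 \<in> Sp4"
    using frame_matrix_symplectic[OF B.symplectic_relations[OF z0]]
    by (intro Sp4_divide[OF frame_matrix_symplectic[OF A.symplectic_relations[OF z0]]])
      (simp only: LX[OF z0])
  \<comment> \<open>Each immersion has z-derivative t/2 times its own E, and \<open>L z0\<close>
    maps one E to the other; the remaining difference is the translation part.\<close>
  moreover have "\<exists>c. \<forall>z\<in>S. f' z - L z0 *v f z = c"
  proof (rule A.constant_if_vdz_0[OF convex_S])
    have sL: "smooth_on S (\<lambda>z. L z0 *v f z)"
      by (rule smooth_on_linear[OF A.open_S matrix_vector_mul_bounded_linear A.smooth_f])
    then show "smooth_on S (\<lambda>z. f' z - L z0 *v f z)"
      by (rule smooth_on_diff[OF A.open_S B.smooth_f])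
    fix z assume z: "z \<in> S"
    have s: "smooth_on S (\<lambda>z. complexify (f z))" "smooth_on S (\<lambda>z. complexify (f' z))"
      using A.smooth_cf B.smooth_cf by (simp_all add: comp_def)
    have sM: "smooth_on S (\<lambda>z. cmv (L z0) (complexify (f z)))"
      unfolding cmv_simps by (rule smooth_on_linear[OF A.open_S bounded_linear_complexify sL])
    have "vdz (\<lambda>z. complexify (f' z - L z0 *v f z)) z
        = vdz (\<lambda>z. complexify (f' z) - cmv (L z0) (complexify (f z))) z"
      by (simp add: cmv_simps complexify_diff)
    also have "\<dots> = vdz (\<lambda>z. complexify (f' z)) z - cmv (L z0) (vdz (\<lambda>z. complexify (f z)) z)"
      using A.vdz_rules(5)[OF s(2) sM smooth_on_const z] A.vdz_cmv[OF s(1) z] by simp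
    also have "\<dots> = (t z / 2) *s B.E z - cmv (L z0) ((t z / 2) *s A.E z)"
      using A.phi_eq[OF z] B.phi_eq[OF z] by (simp add: comp_def)
    also have "\<dots> = 0"
      using LX[OF z] by (simp add: cmv_simps cmv_frame_matrix)
    finally show "vdz (\<lambda>z. complexify (f' z - L z0 *v f z)) z = 0" .
  qed
  then obtain c where "f' z = c + L z0 *v f z" if "z \<in> S" for z by (metis diff_add_cancel)
  ultimately show ?thesis
    by (intro bexI[of _ "(c, L z0)"]) (auto simp: affine_act_def affine_Sp4_def)
qed

end

section \<open>Charts\<close>

lemma in_chart_apply: "is_chart c \<Longrightarrow> q \<in> fst c \<Longrightarrow> in_chart c F (snd c q) = F q"
  unfolding is_chart_def homeomorphism_def in_chart_def by simp

lemma open_chart_image: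
  assumes "is_chart c" "open U"
  shows "open (snd c ` (fst c \<inter> U))"
proof -
  have "snd c ` (fst c \<inter> U) = snd c ` fst c \<inter> inv_into (fst c) (snd c) -` U"
    using assms(1) unfolding is_chart_def homeomorphism_def by force
  moreover have "continuous_on (snd c ` fst c) (inv_into (fst c) (snd c))" "open (snd c ` fst c)"
    using assms(1) unfolding is_chart_def homeomorphism_def by auto
  ultimately show ?thesis using assms(2) continuous_open_preimage by metis
qed

lemma linear_pd: "F differentiable at x \<Longrightarrow> linear (\<lambda>v. pd v F x)"
  using linear_frechet_derivative by auto

lemma differential_pd: "differential F q (c, v) = pd v (in_chart c F) (snd c q)"
  by (simp add: differential_def)

lemma in_chart_change:
  assumes "is_chart c" "is_chart c'" "q \<in> fst c" "q \<in> fst c'"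
  shows "in_chart c' F (in_chart c (snd c') (snd c q)) = in_chart c F (snd c q)"
  using assms by (simp add: in_chart_apply)

lemma differential_change:
  assumes c: "is_chart c" "is_chart c'" "q \<in> fst c" "q \<in> fst c'"
    and d: "in_chart c (snd c') differentiable at (snd c q)" "in_chart c' F differentiable at (snd c' q)"
  shows "differential F q (c, v) = differential F q (c', differential (snd c') q (c, v))"
proof -
  let ?T = "snd c ` (fst c \<inter> fst c')"
  have "open ?T" using open_chart_image[OF c(1)] c(2) unfolding is_chart_def by blast
  moreover have "snd c q \<in> ?T" using c by blast
  moreover have comp: "((\<lambda>z. in_chart c' F (in_chart c (snd c') z)) has_derivative
      (\<lambda>v. pd (pd v (in_chart c (snd c')) (snd c q)) (in_chart c' F) (snd c' q))) (at (snd c q))"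
    using has_derivative_compose[of "in_chart c (snd c')" "\<lambda>v. pd v (in_chart c (snd c')) (snd c q)"
        "snd c q" UNIV "in_chart c' F" "\<lambda>v. pd v (in_chart c' F) (snd c' q)"] d
    unfolding frechet_derivative_works by (simp add: in_chart_apply c)
  ultimately have "pd v (\<lambda>z. in_chart c' F (in_chart c (snd c') z)) (snd c q) = pd v (in_chart c F) (snd c q)"
    using c by (intro pd_cong_open(1)) (auto simp: differentiable_def in_chart_change)
  then show ?thesis using pd_eqI[OF comp] by (simp add: differential_pd)
qed

lemma differential_self:
  assumes "is_chart c" "q \<in> fst c"
  shows "differential (snd c) q (c, v) = v"
proof -
  have "pd v (\<lambda>z. z) (snd c q) = pd v (in_chart c (snd c)) (snd c q)"
    using assms unfolding is_chart_def
    by (intro pd_cong_open(1)[of "snd c ` fst c"]) (auto simp: in_chart_apply[unfolded is_chart_def])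
  then show ?thesis by (simp add: differential_pd)
qed

locale surface =
  fixes A :: "'a::{t2_space, second_countable_topology} chart set"
  assumes atlas: "oriented_surface_atlas A"
begin

lemma is_chart: "c \<in> A \<Longrightarrow> is_chart c"
  using atlas by (simp add: oriented_surface_atlas_def)

lemma open_carrier: "open (carrier_of A)"
  using is_chart by (auto simp: carrier_of_def is_chart_def)

end

text \<open>The chart need not belong to the atlas: complex parameters are only compatible with it.
  Since tangent vectors live over atlas charts, values of forms must be carried between the two
  kinds of charts.\<close>

locale surface_chart = surface A for A :: "'a::{t2_space, second_countable_topology} chart set" +
  fixes c :: "'a chart"
  assumes chart: "is_chart c" and chart_carrier: "fst c \<subseteq> carrier_of A"
    and transitions: "c' \<in> A \<Longrightarrow> oriented_transition c c' \<and> oriented_transition c' c"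
begin

lemma open_dom: "open (fst c)"
  using chart by (simp add: is_chart_def)

lemma atlas_chart: assumes "q \<in> fst c" obtains c' where "c' \<in> A" "q \<in> fst c'"
  using assms chart_carrier unfolding carrier_of_def by blast

text \<open>\<open>smooth_map\<close> speaks of atlas charts only; near each point the expression in
  c is the one in an atlas chart composed with a smooth transition.\<close>

lemma smooth_hat:
  assumes F: "smooth_map A U F" and U: "open U"
  shows "smooth_on (snd c ` (fst c \<inter> U)) (in_chart c F)"
proof (rule smooth_on_local)
  fix p assume "p \<in> snd c ` (fst c \<inter> U)"
  then obtain q where q: "q \<in> fst c" "q \<in> U" "p = snd c q" by blast
  obtain c' where c': "c' \<in> A" "q \<in> fst c'" using atlas_chart[OF q(1)] .
  note ic = is_chart[OF c'(1)]
  have o': "open (fst c')" using ic by (simp add: is_chart_def)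
  let ?T = "snd c ` (fst c \<inter> (fst c' \<inter> U))"
  have oT: "open ?T" by (rule open_chart_image[OF chart open_Int[OF o' U]])
  have s: "smooth_on ?T (\<lambda>z. in_chart c' F (in_chart c (snd c') z))"
  proof (rule smooth_on_compose[OF oT open_chart_image[OF ic U]])
    show "smooth_on ?T (in_chart c (snd c'))"
      using transitions[OF c'(1)] unfolding oriented_transition_def
      by (auto elim!: smooth_on_subset)
    show "smooth_on (snd c' ` (fst c' \<inter> U)) (in_chart c' F)"
      using F c'(1) unfolding smooth_map_def by blast
    show "in_chart c (snd c') ` ?T \<subseteq> snd c' ` (fst c' \<inter> U)"
      using chart by (auto simp: in_chart_apply)
  qed
  have "smooth_on ?T (in_chart c F)"
    using chart ic by (intro smooth_on_cong[OF oT _ s]) (auto simp: in_chart_change)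
  then show "\<exists>T. open T \<and> p \<in> T \<and> smooth_on T (in_chart c F)" using oT q c' by blast
qed

lemma hat_differentiable:
  assumes "smooth_map A U F" "open U" "q \<in> U" "q \<in> fst c"
  shows "in_chart c F differentiable at (snd c q)"
  using smooth_on_differentiable[OF smooth_hat[OF assms(1,2)]] assms(3,4) by blast

lemma differential_into:
  assumes F: "smooth_map A U F" "open U" "q \<in> U" and q: "q \<in> fst c" "c' \<in> A" "q \<in> fst c'"
  shows "differential F q (c', w) = differential F q (c, differential (snd c) q (c', w))"
proof (rule differential_change[OF is_chart[OF q(2)] chart q(3,1) _ hat_differentiable[OF F q(1)]])
  show "in_chart c' (snd c) differentiable at (snd c' q)"
    using transitions[OF q(2)] q unfolding oriented_transition_def
    by (auto elim!: smooth_on_differentiable)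
qed

lemma differential_from:
  assumes F: "smooth_map A U F" "open U" "q \<in> U" and q: "q \<in> fst c" "c' \<in> A" "q \<in> fst c'"
  shows "differential F q (c, w) = differential F q (c', differential (snd c') q (c, w))"
proof (rule differential_change[OF chart is_chart[OF q(2)] q(1,3)])
  show "in_chart c (snd c') differentiable at (snd c q)"
    using transitions[OF q(2)] q unfolding oriented_transition_def
    by (auto elim!: smooth_on_differentiable)
  show "in_chart c' F differentiable at (snd c' q)"
    using F q unfolding smooth_map_def by (auto elim!: smooth_on_differentiable)
qed

lemma smooth_coordinate: "smooth_map A (fst c) (snd c)"
  unfolding smooth_map_def
proof
  fix c' assume "c' \<in> A"
  then show "smooth_on (snd c' ` (fst c' \<inter> fst c)) (in_chart c' (snd c))"
    using transitions unfolding oriented_transition_def by blast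
qed

lemma coordinate_from:
  assumes "q \<in> fst c" "c' \<in> A" "q \<in> fst c'"
  shows "differential (snd c) q (c', differential (snd c') q (c, v)) = v"
  using differential_from[OF smooth_coordinate open_dom assms(1,1-3), of v]
    differential_self[OF chart assms(1), of v] by metis

end

lemma (in surface) chart_in_atlas: "c \<in> A \<Longrightarrow> surface_chart A c"
  using atlas
  by unfold_locales (auto simp: oriented_surface_atlas_def carrier_of_def)

section \<open>Symplectic frames\<close>

definition frame_E :: "real^4^4 \<Rightarrow> complex^4" where
  "frame_E X = (\<chi> i. Complex (X$i$1) (X$i$2))"

definition frame_N :: "real^4^4 \<Rightarrow> complex^4" where
  "frame_N X = (\<chi> i. Complex (X$i$3) (X$i$4))"

lemma symplectic_entries:
  assumes "X \<in> Sp4"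
  shows "X$1$i * X$3$j + X$2$i * X$4$j - X$3$i * X$1$j - X$4$i * X$2$j = J4$i$j"
proof -
  have "(transpose X ** J4 ** X)$i$j = X$1$i * X$3$j + X$2$i * X$4$j - X$3$i * X$1$j - X$4$i * X$2$j"
    by (simp add: matrix_matrix_mult_def sum_4 J4_def transpose_def)
  then show ?thesis using assms by (simp add: Sp4_iff)
qed

lemma frame_relations:
  assumes "X \<in> Sp4"
  shows "Oc (frame_E X) (vcnj (frame_E X)) = 0" "Oc (frame_E X) (frame_N X) = 0"
    "Oc (frame_E X) (vcnj (frame_N X)) = 2" "Oc (frame_N X) (vcnj (frame_N X)) = 0"
proof -
  note e = symplectic_entries[OF assms]
  have "Oc (frame_E X) (vcnj (frame_E X)) = Complex 0 (- 2 * J4$1$2)"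
    "Oc (frame_E X) (frame_N X) = Complex (J4$1$3 - J4$2$4) (J4$1$4 + J4$2$3)"
    "Oc (frame_E X) (vcnj (frame_N X)) = Complex (J4$1$3 + J4$2$4) (J4$2$3 - J4$1$4)"
    "Oc (frame_N X) (vcnj (frame_N X)) = Complex 0 (- 2 * J4$3$4)"
    unfolding e[symmetric]
    by (simp_all add: frame_E_def frame_N_def Oc_def vcnj_def complex_eq_iff algebra_simps)
  then show "Oc (frame_E X) (vcnj (frame_E X)) = 0" "Oc (frame_E X) (frame_N X) = 0"
    "Oc (frame_E X) (vcnj (frame_N X)) = 2" "Oc (frame_N X) (vcnj (frame_N X)) = 0"
    by (simp_all add: J4_def complex_eq_iff)
qed

lemma frame_relations':
  assumes "X \<in> Sp4"
  shows "Oc (vcnj (frame_E X)) (frame_E X) = 0" "Oc (frame_N X) (frame_E X) = 0"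
    "Oc (vcnj (frame_N X)) (frame_E X) = - 2" "Oc (vcnj (frame_N X)) (frame_N X) = 0"
    "Oc (vcnj (frame_E X)) (vcnj (frame_N X)) = 0" "Oc (vcnj (frame_N X)) (vcnj (frame_E X)) = 0"
    "Oc (vcnj (frame_E X)) (frame_N X) = 2" "Oc (frame_N X) (vcnj (frame_E X)) = - 2"
proof -
  let ?E = "frame_E X" and ?N = "frame_N X"
  note r = frame_relations[OF assms]
  show "Oc (vcnj ?E) ?E = 0" using r(1) Oc_swap[of "vcnj ?E" ?E] by simp
  show NE: "Oc ?N ?E = 0" using r(2) Oc_swap[of ?N ?E] by simp
  show "Oc (vcnj ?N) ?E = - 2" using r(3) Oc_swap[of "vcnj ?N" ?E] by simp
  show "Oc (vcnj ?N) ?N = 0" using r(4) Oc_swap[of "vcnj ?N" ?N] by simp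
  show "Oc (vcnj ?E) (vcnj ?N) = 0" using r(2) by (simp add: Oc_vcnj)
  show "Oc (vcnj ?N) (vcnj ?E) = 0" using NE by (simp add: Oc_vcnj)
  show EN: "Oc (vcnj ?E) ?N = 2" using r(3) Oc_vcnj[of ?E "vcnj ?N"] by simp
  show "Oc ?N (vcnj ?E) = - 2" using EN Oc_swap[of ?N "vcnj ?E"] by simp
qed

lemma bounded_linear_frame_E: "bounded_linear frame_E"
  by (rule linear_conv_bounded_linear[THEN iffD1], rule linearI)
    (simp_all add: frame_E_def vec_eq_iff complex_eq_iff)

lemma bounded_bilinear_Oc: "bounded_bilinear Oc"
  unfolding bilinear_conv_bounded_bilinear[symmetric] bilinear_def
  by (auto intro!: linearI simp: Oc_def algebra_simps)

lemma Sp4_matrix_inv: "X \<in> Sp4 \<Longrightarrow> matrix_inv X = - (J4 ** transpose X ** J4)"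
proof -
  assume X: "X \<in> Sp4"
  have "matrix_inv X = (- (J4 ** transpose X ** J4) ** X) ** matrix_inv X"
    using symplectic_left_inverse(1) X unfolding Sp4_iff by (metis matrix_mul_lid)
  then show ?thesis using Sp4_inv_right[OF X] by (metis matrix_mul_assoc matrix_mul_rid)
qed

lemma symplectic_inverse_entries:
  "(- (J4 ** transpose X ** J4) ** Y) $ 1 $ j = - (X$1$3 * Y$3$j + X$2$3 * Y$4$j - X$3$3 * Y$1$j - X$4$3 * Y$2$j)"
  "(- (J4 ** transpose X ** J4) ** Y) $ 2 $ j = - (X$1$4 * Y$3$j + X$2$4 * Y$4$j - X$3$4 * Y$1$j - X$4$4 * Y$2$j)"
  "(- (J4 ** transpose X ** J4) ** Y) $ 3 $ j = X$1$1 * Y$3$j + X$2$1 * Y$4$j - X$3$1 * Y$1$j - X$4$1 * Y$2$j"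
  "(- (J4 ** transpose X ** J4) ** Y) $ 4 $ j = X$1$2 * Y$3$j + X$2$2 * Y$4$j - X$3$2 * Y$1$j - X$4$2 * Y$2$j"
  by (simp_all add: matrix_matrix_mult_def sum_4 J4_def transpose_def)

lemma symplectic_inverse_entries_vec:
  "(- (J4 ** transpose X ** J4) *v w) $ 1 = - (X$1$3 * w$3 + X$2$3 * w$4 - X$3$3 * w$1 - X$4$3 * w$2)"
  "(- (J4 ** transpose X ** J4) *v w) $ 2 = - (X$1$4 * w$3 + X$2$4 * w$4 - X$3$4 * w$1 - X$4$4 * w$2)"
  "(- (J4 ** transpose X ** J4) *v w) $ 3 = X$1$1 * w$3 + X$2$1 * w$4 - X$3$1 * w$1 - X$4$1 * w$2"
  "(- (J4 ** transpose X ** J4) *v w) $ 4 = X$1$2 * w$3 + X$2$2 * w$4 - X$3$2 * w$1 - X$4$2 * w$2"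
  by (simp_all add: matrix_matrix_mult_def matrix_vector_mult_def sum_4 J4_def transpose_def)

text \<open>By the explicit symplectic inverse every entry of the forms is a pairing with a column
  of X. The complex combinations group them so that the second order condition and \<eta> each
  become a single pairing with X_1 + \<i> X_2 or X_3 + \<i> X_4.\<close>

lemma form_pairings:
  assumes "X q \<in> Sp4"
  shows "tau_c f X q u = Oc (complexify (differential f q u)) (vcnj (frame_N (X q)))"
    and "Complex (tau_form f X q u $ 3) (tau_form f X q u $ 4) = Oc (frame_E (X q)) (complexify (differential f q u))"
    and "Oc (frame_E (X q)) (frame_E (differential X q u)) =
      Complex (gamma_form X 1 1 q u - gamma_form X 2 2 q u) (gamma_form X 1 2 q u + gamma_form X 2 1 q u)"
    and "Oc (vcnj (frame_E (X q))) (frame_E (differential X q u)) =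
      Complex (gamma_form X 1 1 q u + gamma_form X 2 2 q u) (gamma_form X 1 2 q u - gamma_form X 2 1 q u)"
    and "Oc (frame_E (differential X q u)) (frame_N (X q)) = 2 * cnj (eta_c X q u)"
proof -
  show "tau_c f X q u = Oc (complexify (differential f q u)) (vcnj (frame_N (X q)))"
    "Complex (tau_form f X q u $ 3) (tau_form f X q u $ 4) = Oc (frame_E (X q)) (complexify (differential f q u))"
    "Oc (frame_E (X q)) (frame_E (differential X q u)) =
      Complex (gamma_form X 1 1 q u - gamma_form X 2 2 q u) (gamma_form X 1 2 q u + gamma_form X 2 1 q u)"
    "Oc (vcnj (frame_E (X q))) (frame_E (differential X q u)) =
      Complex (gamma_form X 1 1 q u + gamma_form X 2 2 q u) (gamma_form X 1 2 q u - gamma_form X 2 1 q u)"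
    unfolding tau_c_def tau_form_def gamma_form_def theta_form_def Sp4_matrix_inv[OF assms]
    by (simp_all add: symplectic_inverse_entries symplectic_inverse_entries_vec frame_E_def frame_N_def Oc_def
        vcnj_def complexify_def complex_eq_iff algebra_simps)
  have "Oc (frame_E (differential X q u)) (frame_N (X q)) =
      Complex (alpha_form X 1 1 q u - alpha_form X 2 2 q u) (alpha_form X 2 1 q u + alpha_form X 1 2 q u)"
    unfolding alpha_form_def theta_form_def Sp4_matrix_inv[OF assms]
    by (simp add: symplectic_inverse_entries frame_E_def frame_N_def Oc_def complex_eq_iff algebra_simps)
  then show "Oc (frame_E (differential X q u)) (frame_N (X q)) = 2 * cnj (eta_c X q u)"
    by (simp add: eta_c_def complex_eq_iff) (simp add: field_simps)
qed

section \<open>Real linear maps of the plane and binary cubic forms\<close>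

lemma complex_linear_expand:
  assumes "linear (T :: complex \<Rightarrow> complex)"
  shows "T v = of_real (Re v) * T 1 + of_real (Im v) * T \<i>"
proof -
  have "v = Re v *\<^sub>R 1 + Im v *\<^sub>R \<i>" by (simp add: complex_eq_iff)
  then have "T v = Re v *\<^sub>R T 1 + Im v *\<^sub>R T \<i>"
    using linear_add[OF assms] linear_scale[OF assms] by metis
  then show ?thesis by (simp add: scaleR_conv_of_real)
qed

lemma linear_det:
  assumes "linear (T :: complex \<Rightarrow> complex)"
  shows "Im (cnj (T u) * T v) = Im (cnj (T 1) * T \<i>) * Im (cnj u * v)"
  unfolding complex_linear_expand[OF assms, of u] complex_linear_expand[OF assms, of v]
  by (simp add: algebra_simps)

lemma linear_det_inverse:
  assumes T: "linear (T :: complex \<Rightarrow> complex)" "Im (cnj (T 1) * T \<i>) > 0"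
  obtains S where "linear S" "\<And>x. S (T x) = x" "\<And>x. T (S x) = x" "Im (cnj (S 1) * S \<i>) > 0"
proof -
  have "inj T"
  proof (rule injI)
    fix x y assume "T x = T y"
    then have 0: "T (x - y) = 0" using linear_diff[OF T(1)] by simp
    have "Im (cnj (T (x - y)) * T v) = 0" for v unfolding 0 by simp
    then have z: "Im (cnj (x - y) * v) = 0" for v using linear_det[OF T(1), of "x - y" v] T(2) by simp
    from z[of 1] z[of \<i>] show "x = y" by (simp add: complex_eq_iff)
  qed
  from linear_injective_isomorphism[OF T(1) this]
  obtain S where S: "linear S" "\<And>x. S (T x) = x" "\<And>x. T (S x) = x" by blast
  have "Im (cnj (T (S 1)) * T (S \<i>)) = 1" unfolding S by simp
  then have "Im (cnj (T 1) * T \<i>) * Im (cnj (S 1) * S \<i>) = 1" using linear_det[OF T(1)] by metis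
  then have "Im (cnj (S 1) * S \<i>) > 0" using T(2) by (metis zero_less_mult_pos zero_less_one)
  with S show ?thesis by (rule that)
qed

text \<open>A real binary cubic form has four coefficients, and the directions 1, \<i>, 1 + \<i>, 1
  - \<i> give four independent equations for them.\<close>

lemma cubic_form_eq_0:
  assumes "\<And>x. Re (a * x^3 + b * (x\<^sup>2 * cnj x)) = 0"
  shows "a = 0" "b = 0"
proof -
  have p: "(1 + \<i>)^3 = Complex (-2) 2" "(1 - \<i>)^3 = Complex (-2) (-2)" "\<i>^3 = Complex 0 (-1)"
    "(1 + \<i>)\<^sup>2 * cnj (1 + \<i>) = Complex 2 2" "(1 - \<i>)\<^sup>2 * cnj (1 - \<i>) = Complex 2 (-2)"
    "\<i>\<^sup>2 * cnj \<i> = Complex 0 1"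
    by (simp_all add: power3_eq_cube power2_eq_square complex_eq_iff)
  have "Re a + Re b = 0" using assms[of 1] by simp
  moreover have "Im a - Im b = 0" using assms[of \<i>] unfolding p by simp
  moreover have "- 2 * Re a - 2 * Im a + 2 * Re b - 2 * Im b = 0" using assms[of "1 + \<i>"] unfolding p by simp
  moreover have "- 2 * Re a + 2 * Im a + 2 * Re b + 2 * Im b = 0" using assms[of "1 - \<i>"] unfolding p by simp
  ultimately have "Re a = 0" "Re b = 0" "Im a = 0" "Im b = 0" by argo+
  then show "a = 0" "b = 0" by (simp_all add: complex_eq_iff)
qed

text \<open>The real part of the cube of an orientation preserving linear isomorphism determines its
  complex structure: in \<open>s (p x + q cnj x)\<^sup>3\<close> the coefficient of \<open>x\<^sup>2 cnj x\<close> has modulus at least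
  \<open>3 |s p q| (|p| - |q|)\<close>.\<close>

lemma cubic_unique:
  assumes T1: "linear T1" "Im (cnj (T1 1) * T1 \<i>) > 0"
    and T2: "linear T2" "Im (cnj (T2 1) * T2 \<i>) > 0"
    and eq: "\<And>u. Re (s1 * (T1 u)^3) = Re (s2 * (T2 u)^3)"
  shows "s1 * (T1 u)^3 = s2 * (T2 u)^3" "s2 \<noteq> 0 \<Longrightarrow> \<exists>p. p \<noteq> 0 \<and> (\<forall>u. T2 u = p * T1 u)"
proof -
  obtain S where S: "linear S" "\<And>x. S (T1 x) = x" "\<And>x. T1 (S x) = x" "Im (cnj (S 1) * S \<i>) > 0"
    using linear_det_inverse[OF T1] by blast
  let ?R = "\<lambda>x. T2 (S x)"
  have R: "linear ?R" using linear_compose[OF S(1) T2(1)] by (simp add: comp_def)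
  have detR: "Im (cnj (?R 1) * ?R \<i>) > 0" using linear_det[OF T2(1), of "S 1" "S \<i>"] T2(2) S(4) by simp
  define p where "p = (?R 1 - \<i> * ?R \<i>) / 2"
  define q where "q = (?R 1 + \<i> * ?R \<i>) / 2"
  have R1: "?R 1 = p + q" "?R \<i> = \<i> * (p - q)"
    by (simp_all add: p_def q_def complex_eq_iff field_simps)
  have Rx: "?R x = p * x + q * cnj x" for x
    unfolding complex_linear_expand[OF R, of x] R1 by (simp add: complex_eq_iff algebra_simps)
  have "Im (cnj (?R 1) * ?R \<i>) = (cmod p)\<^sup>2 - (cmod q)\<^sup>2"
    unfolding R1 cmod_power2 by (simp add: power2_eq_square algebra_simps)
  then have "(cmod q)\<^sup>2 < (cmod p)\<^sup>2" using detR by simp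
  then have pq: "cmod q < cmod p" using power2_less_imp_less norm_ge_zero by blast
  \<comment> \<open>In the coordinate x = T1 u the first cubic is s1 x^3. Inside the real part,
    terms in (cnj x)^3 and x (cnj x)^2 may be conjugated, which leaves only x^3 and x^2 cnj x with
    these coefficients.\<close>
  let ?a = "s2 * p^3 + cnj (s2 * q^3) - s1" and ?b = "3 * (s2 * p\<^sup>2 * q + cnj (s2 * p * q\<^sup>2))"
  have "Re (?a * x^3 + ?b * (x\<^sup>2 * cnj x)) = 0" for x
  proof -
    have e: "Re (s1 * x^3) = Re (s2 * (p * x + q * cnj x)^3)" using eq[of "S x"] S(3) Rx by simp
    have "s2 * (p * x + q * cnj x)^3 = s2 * p^3 * x^3 + 3 * (s2 * p\<^sup>2 * q) * (x\<^sup>2 * cnj x)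
        + cnj (3 * cnj (s2 * p * q\<^sup>2) * (x\<^sup>2 * cnj x) + cnj (s2 * q^3) * x^3)"
      by (simp add: power3_eq_cube power2_eq_square algebra_simps)
    then have "Re (s2 * (p * x + q * cnj x)^3) = Re (s2 * p^3 * x^3) + Re (3 * (s2 * p\<^sup>2 * q) * (x\<^sup>2 * cnj x))
        + Re (3 * cnj (s2 * p * q\<^sup>2) * (x\<^sup>2 * cnj x) + cnj (s2 * q^3) * x^3)"
      by (metis plus_complex.sel(1) cnj.sel(1))
    also have "\<dots> = Re (s2 * p^3 * x^3 + 3 * (s2 * p\<^sup>2 * q) * (x\<^sup>2 * cnj x)
        + (3 * cnj (s2 * p * q\<^sup>2) * (x\<^sup>2 * cnj x) + cnj (s2 * q^3) * x^3))" by simp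
    also have "s2 * p^3 * x^3 + 3 * (s2 * p\<^sup>2 * q) * (x\<^sup>2 * cnj x)
        + (3 * cnj (s2 * p * q\<^sup>2) * (x\<^sup>2 * cnj x) + cnj (s2 * q^3) * x^3)
      = ?a * x^3 + ?b * (x\<^sup>2 * cnj x) + s1 * x^3" by (simp add: algebra_simps)
    finally have "Re (s2 * (p * x + q * cnj x)^3) = Re (?a * x^3 + ?b * (x\<^sup>2 * cnj x)) + Re (s1 * x^3)"
      by simp
    then show ?thesis using e by linarith
  qed
  from cubic_form_eq_0[of ?a ?b, OF this] have a: "?a = 0" and b: "?b = 0" by blast+
  have q0: "s2 \<noteq> 0 \<Longrightarrow> q = 0"
  proof (rule ccontr)
    assume s: "s2 \<noteq> 0" and q: "q \<noteq> 0"
    have "s2 * p\<^sup>2 * q + cnj (s2 * p * q\<^sup>2) = 0" using b unfolding mult_eq_0_iff by simp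
    then have "s2 * p\<^sup>2 * q = - cnj (s2 * p * q\<^sup>2)" by (simp only: eq_neg_iff_add_eq_0)
    then have "cmod (s2 * p\<^sup>2 * q) = cmod (cnj (s2 * p * q\<^sup>2))" by (metis norm_minus_cancel)
    then have "cmod s2 * (cmod p)\<^sup>2 * cmod q = cmod s2 * cmod p * (cmod q)\<^sup>2"
      by (simp only: norm_mult norm_power complex_mod_cnj)
    then have "cmod p = cmod q"
      using s q pq by (auto simp: power2_eq_square)
    then show False using pq by simp
  qed
  have T2T1: "T2 u = p * T1 u + q * cnj (T1 u)" for u using Rx[of "T1 u"] S(2) by simp
  show "s1 * (T1 u)^3 = s2 * (T2 u)^3"
  proof (cases "s2 = 0")
    case True
    then show ?thesis using a by simp
  next
    case False
    have "s1 = s2 * p^3" using a q0[OF False] by simp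
    then show ?thesis using T2T1[of u] q0[OF False] by (simp add: power_mult_distrib)
  qed
  show "\<exists>p. p \<noteq> 0 \<and> (\<forall>u. T2 u = p * T1 u)" if "s2 \<noteq> 0"
    using q0[OF that] T2T1 pq by (intro exI[of _ p]) auto
qed

lemma Re_mult_eq_0:
  assumes "\<And>x. Re (x * a) = 0" shows "a = 0"
  using assms[of 1] assms[of \<i>] by (simp add: complex_eq_iff)

text \<open>A form of Cartan's lemma. As T w runs through all complex numbers, the real symmetry
  becomes the complex identity T v W u = T u W v; then v is chosen with T v = 1.\<close>

lemma symmetric_proportional:
  assumes T: "linear T" "Im (cnj (T 1) * T \<i>) > 0"
    and sym: "\<And>u v w. Re (T w * T v * W u) = Re (T w * T u * W v)"
  shows "\<exists>s. \<forall>u. W u = s * T u"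
proof -
  obtain S where S: "\<And>x. T (S x) = x" by (rule linear_det_inverse[OF T], rule that, assumption)
  have e: "T v * W u = T u * W v" for u v
  proof -
    have "Re (x * (T v * W u - T u * W v)) = 0" for x
      using sym[of "S x" v u] unfolding S by (simp add: right_diff_distrib mult.assoc)
    then have "T v * W u - T u * W v = 0" by (rule Re_mult_eq_0)
    then show ?thesis by simp
  qed
  have "W u = W (S 1) * T u" for u
    using e[of "S 1" u] unfolding S by (simp only: mult_1 mult.commute)
  then show ?thesis by blast
qed

section \<open>First and second order frames in a chart\<close>

lemma Omega_Oc: "complex_of_real (Omega v w) = Oc (complexify v) (complexify w)"
  by (simp add: Omega_def inner_vec_def matrix_vector_mult_def sum_4 J4_def Oc_def complexify_def
      algebra_simps)

lemma Re_Oc: "Omega v w = Re (Oc (complexify v) (complexify w))"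
  using Omega_Oc[of v w] by (metis Re_complex_of_real)

lemma complexify_plane:
  "complexify (a *\<^sub>R column 1 X + b *\<^sub>R column 2 X)
    = (Complex a (- b) / 2) *s frame_E X + (Complex a b / 2) *s vcnj (frame_E X)"
  by (simp add: complexify_def column_def frame_E_def vcnj_def vec_eq_iff complex_eq_iff field_simps)

lemma bounded_linear_frame_N: "bounded_linear frame_N"
  by (rule linear_conv_bounded_linear[THEN iffD1], rule linearI)
    (simp_all add: frame_N_def vec_eq_iff complex_eq_iff)

lemma bounded_linear_vcnj: "bounded_linear vcnj"
  by (rule linear_conv_bounded_linear[THEN iffD1], rule linearI)
    (simp_all add: vcnj_def vec_eq_iff complex_eq_iff)

lemma linear_tau_c:
  assumes "X q \<in> Sp4" "linear (\<lambda>v. differential f q (c, v))"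
  shows "linear (\<lambda>v. tau_c f X q (c, v))"
proof -
  have "linear (\<lambda>w. Oc (complexify w) (vcnj (frame_N (X q))))"
    by (intro bounded_linear.linear bounded_linear_compose[OF bounded_bilinear.bounded_linear_left[OF bounded_bilinear_Oc]]
        bounded_linear_complexify)
  from linear_compose[OF assms(2) this] show ?thesis
    by (simp add: form_pairings(1)[where X = X and q = q, OF assms(1)] comp_def)
qed

locale lagrangian_chart = surface_chart A c for A :: "'a::{t2_space, second_countable_topology} chart set" and c +
  fixes f :: "'a \<Rightarrow> real^4"
  assumes lagrangian: "lagrangian_immersion A f"
begin

abbreviation "fh \<equiv> in_chart c f"
abbreviation "Dom \<equiv> snd c ` fst c"

lemma smooth_f: "smooth_map A (carrier_of A) f"
  using lagrangian by (simp add: lagrangian_immersion_def)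

lemma smooth_fh: "smooth_on Dom fh"
  using smooth_hat[OF smooth_f open_carrier] chart_carrier by (simp add: Int_absorb2)

lemma open_Dom: "open Dom"
  using chart by (simp add: is_chart_def)

lemma linear_df:
  assumes "q \<in> fst c" shows "linear (\<lambda>v. differential f q (c, v))"
  unfolding differential_pd using smooth_on_differentiable[OF smooth_fh] assms by (intro linear_pd) blast

lemma frame_smooth_map:
  assumes "first_order_frame A f U X"
  shows "smooth_map A U X" "open U" "q \<in> U \<Longrightarrow> X q \<in> Sp4"
  using assms by (auto simp: first_order_frame_def symplectic_frame_def)

lemma df_from:
  assumes "q \<in> fst c" "c' \<in> A" "q \<in> fst c'"
  shows "differential f q (c, v) = differential f q (c', differential (snd c') q (c, v))"
  using differential_from[OF smooth_f open_carrier _ assms] assms(1) chart_carrier by blast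

text \<open>Two orientation reversals cancel, namely the basis \<i>, 1 in the Gauss map and the
  minus sign in \<open>tau_c\<close>. So \<open>tau_c\<close> preserves the orientation of the
  chart.\<close>

lemma first_order_tangent_atlas:
  assumes X: "first_order_frame A f U X" "q \<in> U" and q: "q \<in> fst c" and c: "c \<in> A"
  shows "Oc (frame_E (X q)) (complexify (differential f q (c, v))) = 0"
    and "Im (cnj (tau_c f X q (c, 1)) * tau_c f X q (c, \<i>)) > 0"
proof -
  note Sp = frame_smooth_map(3)[OF X]
  note r = frame_relations[OF Sp] frame_relations'[OF Sp]
  have g: "gauss_map f c q = oriented_plane (column 1 (X q)) (column 2 (X q))"
    using X q c by (simp add: first_order_frame_def)
  have "(differential f q (c, \<i>), differential f q (c, 1)) \<in> gauss_map f c q"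
    unfolding gauss_map_def oriented_plane_def by (rule CollectI, rule exI[of _ 1], rule exI[of _ 0],
        rule exI[of _ 0], rule exI[of _ 1]) simp
  then obtain a b c' d where abcd: "a * d - b * c' > 0"
    "differential f q (c, \<i>) = a *\<^sub>R column 1 (X q) + b *\<^sub>R column 2 (X q)"
    "differential f q (c, 1) = c' *\<^sub>R column 1 (X q) + d *\<^sub>R column 2 (X q)"
    unfolding g oriented_plane_def mem_Collect_eq prod.inject by blast
  have "tau_c f X q (c, \<i>) = Complex a (- b)" "tau_c f X q (c, 1) = Complex c' (- d)"
    unfolding form_pairings(1)[where X = X and q = q, OF Sp] abcd(2,3) complexify_plane by (simp_all add: Oc_simps r)
  then show "Im (cnj (tau_c f X q (c, 1)) * tau_c f X q (c, \<i>)) > 0"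
    using abcd(1) by (simp add: algebra_simps)
  have "differential f q (c, v) = Re v *\<^sub>R differential f q (c, 1) + Im v *\<^sub>R differential f q (c, \<i>)"
    unfolding differential_pd using smooth_on_differentiable[OF smooth_fh] q by (intro pd_complex_dir) blast
  also have "\<dots> = (Re v * c' + Im v * a) *\<^sub>R column 1 (X q) + (Re v * d + Im v * b) *\<^sub>R column 2 (X q)"
    unfolding abcd by (simp add: algebra_simps)
  finally show "Oc (frame_E (X q)) (complexify (differential f q (c, v))) = 0"
    by (simp add: complexify_plane Oc_simps r)
qed

lemma first_order_tangent:
  assumes X: "first_order_frame A f U X" "q \<in> U" and q: "q \<in> fst c"
  shows "Oc (frame_E (X q)) (complexify (differential f q (c, v))) = 0"
    and "Im (cnj (tau_c f X q (c, 1)) * tau_c f X q (c, \<i>)) > 0"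
proof -
  obtain c' where c': "c' \<in> A" "q \<in> fst c'" using atlas_chart[OF q] .
  interpret c': lagrangian_chart A c' f
    using chart_in_atlas[OF c'(1)] lagrangian by (simp add: lagrangian_chart_def lagrangian_chart_axioms_def)
  note Sp = frame_smooth_map(3)[OF X]
  note t = c'.first_order_tangent_atlas[OF X c'(2,1)]
  let ?S = "\<lambda>v. differential (snd c') q (c, v)"
  show "Oc (frame_E (X q)) (complexify (differential f q (c, v))) = 0"
    unfolding df_from[OF q c'] by (rule t(1))
  have T: "tau_c f X q (c, v) = tau_c f X q (c', ?S v)" for v
    by (simp add: tau_c_def tau_form_def df_from[OF q c'])
  have S: "Im (cnj (?S 1) * ?S \<i>) > 0"
    using transitions[OF c'(1)] q c'(2) unfolding oriented_transition_def differential_pd by simp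
  have "Im (cnj (tau_c f X q (c, 1)) * tau_c f X q (c, \<i>))
      = Im (cnj (tau_c f X q (c', 1)) * tau_c f X q (c', \<i>)) * Im (cnj (?S 1) * ?S \<i>)"
    unfolding T by (rule linear_det[OF linear_tau_c[where X = X and q = q, OF Sp c'.linear_df[OF c'(2)]]])
  then show "Im (cnj (tau_c f X q (c, 1)) * tau_c f X q (c, \<i>)) > 0"
    using mult_pos_pos[OF t(2) S] by (simp only:)
qed

lemma df_frame:
  assumes X: "first_order_frame A f U X" "q \<in> U" and q: "q \<in> fst c"
  shows "complexify (differential f q (c, v)) = (tau_c f X q (c, v) / 2) *s frame_E (X q)
    + (cnj (tau_c f X q (c, v)) / 2) *s vcnj (frame_E (X q))"
proof -
  note Sp = frame_smooth_map(3)[OF X]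
  let ?v = "complexify (differential f q (c, v))" and ?T = "tau_c f X q (c, v)"
  have T: "?T = Oc ?v (vcnj (frame_N (X q)))" by (rule form_pairings(1)[where X = X and q = q, OF Sp])
  have 1: "Oc ?v (frame_N (X q)) = cnj ?T"
    unfolding T using Oc_vcnj[of ?v "vcnj (frame_N (X q))"] by simp
  have 2: "Oc ?v (frame_E (X q)) = 0" using first_order_tangent(1)[OF X q] Oc_swap by (metis minus_zero)
  then have 3: "Oc ?v (vcnj (frame_E (X q))) = 0" using Oc_vcnj[of ?v "frame_E (X q)"] by simp
  have "2 *s ?v = ?T *s frame_E (X q) + cnj ?T *s vcnj (frame_E (X q))"
    using symplectic_expand[OF frame_relations[OF Sp], of ?v] 1 2 3 T by simp
  then show ?thesis by (simp add: vec_eq_iff) (metis add_divide_distrib nonzero_mult_div_cancel_left times_divide_eq_left zero_neq_numeral)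
qed

text \<open>Differentiating the Lagrangian relation between E and its conjugate shows that \<gamma>
  is symmetric, and the second order condition makes it trace-free. Trace and skew part are exactly
  the pairing with \<open>vcnj E\<close>.\<close>

lemma dE_pairings:
  assumes X: "second_order_frame A f U X" "q \<in> U" and q: "q \<in> fst c"
  shows "Oc (vcnj (frame_E (X q))) (frame_E (differential X q (c, u))) = 0"
    and "Oc (frame_E (X q)) (frame_E (differential X q (c, u))) = 2 * omega_c X q (c, u)"
proof -
  have X1: "first_order_frame A f U X" using X(1) by (simp add: second_order_frame_def)
  note Sp = frame_smooth_map(3)[OF X1 X(2)]
  let ?V = "snd c ` (fst c \<inter> U)" and ?p = "snd c q"
  have V: "open ?V" "?p \<in> ?V" using open_chart_image[OF chart frame_smooth_map(2)[OF X1]] q X(2) by auto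
  let ?Xh = "in_chart c X"
  note s = smooth_hat[OF frame_smooth_map(1,2)[OF X1]]
  let ?E = "\<lambda>z. frame_E (?Xh z)"
  have dX: "?Xh differentiable at ?p" using smooth_on_differentiable[OF s V(2)] .
  have sE: "smooth_on ?V ?E" by (rule smooth_on_linear[OF V(1) bounded_linear_frame_E s])
  note dE = smooth_on_differentiable[OF sE V(2)]
    and dcE = smooth_on_differentiable[OF smooth_on_linear[OF V(1) bounded_linear_vcnj sE] V(2)]
  have pE: "pd u ?E ?p = frame_E (differential X q (c, u))"
    unfolding differential_pd by (rule pd_linear[OF bounded_linear_frame_E dX])
  have pcE: "pd u (\<lambda>z. vcnj (?E z)) ?p = vcnj (frame_E (differential X q (c, u)))"
    using pd_linear[OF bounded_linear_vcnj dE, of u] pE by simp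
  have Eq: "?E ?p = frame_E (X q)" by (simp add: in_chart_apply[OF chart q])
  have "pd u (\<lambda>z. Oc (?E z) (vcnj (?E z))) ?p = pd u (\<lambda>z. 0) ?p"
  proof (rule pd_cong_open(1)[OF V])
    show "(\<lambda>z. Oc (?E z) (vcnj (?E z))) differentiable at ?p"
      by (intro smooth_on_differentiable[OF _ V(2)] smooth_on_bilinear[OF V(1) bounded_bilinear_Oc sE]
          smooth_on_linear[OF V(1) bounded_linear_vcnj sE])
    fix y assume "y \<in> ?V"
    then show "Oc (?E y) (vcnj (?E y)) = 0"
      using frame_smooth_map(3)[OF X1] by (auto simp: in_chart_apply[OF chart] frame_relations)
  qed
  then have "Oc (frame_E (X q)) (vcnj (frame_E (differential X q (c, u))))
      + Oc (frame_E (differential X q (c, u))) (vcnj (frame_E (X q))) = 0"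
    unfolding pd_bilinear[OF bounded_bilinear_Oc dE dcE] pE pcE Eq by simp
  then have "cnj (Oc (vcnj (frame_E (X q))) (frame_E (differential X q (c, u))))
      = Oc (vcnj (frame_E (X q))) (frame_E (differential X q (c, u)))"
    using Oc_vcnj[of "vcnj (frame_E (X q))" "frame_E (differential X q (c, u))"]
      Oc_swap[of "frame_E (differential X q (c, u))" "vcnj (frame_E (X q))"] by simp
  then have g12: "gamma_form X 1 2 q (c, u) = gamma_form X 2 1 q (c, u)"
    unfolding form_pairings(4)[where X = X and q = q, OF Sp] by (simp add: complex_eq_iff)
  have g11: "gamma_form X 1 1 q (c, u) + gamma_form X 2 2 q (c, u) = 0"
  proof -
    obtain c' where c': "c' \<in> A" "q \<in> fst c'" using atlas_chart[OF q] .
    let ?u = "(c', differential (snd c') q (c, u))"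
    have "?u \<in> tangents A q" using c' by (simp add: tangents_def)
    then have "gamma_form X 1 1 q ?u + gamma_form X 2 2 q ?u = 0"
      using X unfolding second_order_frame_def by blast
    then show ?thesis
      unfolding gamma_form_def theta_form_def
      by (simp add: differential_from[OF frame_smooth_map(1,2)[OF X1] X(2) q c'])
  qed
  show "Oc (vcnj (frame_E (X q))) (frame_E (differential X q (c, u))) = 0"
    unfolding form_pairings(4)[where X = X and q = q, OF Sp] using g11 g12 by (simp add: complex_eq_iff)
  show "Oc (frame_E (X q)) (frame_E (differential X q (c, u))) = 2 * omega_c X q (c, u)"
    unfolding form_pairings(3)[where X = X and q = q, OF Sp] using g11 g12
    by (simp add: omega_c_def complex_eq_iff)
qed

text \<open>Differentiating \<open>Oc E df = 0\<close> moves the derivative from f to E, and the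
  pairing of dE with df is known from \<open>dE_pairings\<close>. The left side involves no frame,
  which is what allows frames, and later two immersions, to be compared.\<close>

lemma cubic_form_frame:
  assumes X: "second_order_frame A f U X" "q \<in> U" and q: "q \<in> fst c"
  shows "Omega (pd w fh (snd c q)) (pd u (pd v fh) (snd c q))
    = Re (tau_c f X q (c, w) * tau_c f X q (c, v) * omega_c X q (c, u))"
proof -
  have X1: "first_order_frame A f U X" using X(1) by (simp add: second_order_frame_def)
  let ?V = "snd c ` (fst c \<inter> U)" and ?p = "snd c q"
  have V: "open ?V" "?p \<in> ?V" using open_chart_image[OF chart frame_smooth_map(2)[OF X1]] q X(2) by auto
  let ?Xh = "in_chart c X" and ?T = "\<lambda>v. tau_c f X q (c, v)" and ?W = "omega_c X q (c, u)"
  let ?EE = "frame_E (X q)" and ?dE = "frame_E (differential X q (c, u))"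
  note s = smooth_hat[OF frame_smooth_map(1,2)[OF X1]]
  have sf: "smooth_on ?V fh" by (rule smooth_on_subset[OF smooth_fh]) blast
  let ?E = "\<lambda>z. frame_E (?Xh z)" and ?F = "\<lambda>z. complexify (pd v fh z)"
  have sE: "smooth_on ?V ?E" by (rule smooth_on_linear[OF V(1) bounded_linear_frame_E s])
  have sF: "smooth_on ?V ?F" by (rule smooth_on_linear[OF V(1) bounded_linear_complexify smooth_on_pd[OF sf]])
  note dE = smooth_on_differentiable[OF sE V(2)] and dF = smooth_on_differentiable[OF sF V(2)]
  have pE: "pd u ?E ?p = ?dE"
    unfolding differential_pd by (rule pd_linear[OF bounded_linear_frame_E smooth_on_differentiable[OF s V(2)]])
  have pF: "pd u ?F ?p = complexify (pd u (pd v fh) ?p)"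
    by (rule pd_linear[OF bounded_linear_complexify smooth_on_differentiable[OF smooth_on_pd[OF sf] V(2)]])
  have "pd u (\<lambda>z. Oc (?E z) (?F z)) ?p = pd u (\<lambda>z. 0) ?p"
  proof (rule pd_cong_open(1)[OF V])
    show "(\<lambda>z. Oc (?E z) (?F z)) differentiable at ?p"
      by (intro smooth_on_differentiable[OF _ V(2)] smooth_on_bilinear[OF V(1) bounded_bilinear_Oc sE sF])
    fix y assume "y \<in> ?V"
    then show "Oc (?E y) (?F y) = 0"
      using first_order_tangent(1)[OF X1] by (auto simp: in_chart_apply[OF chart] differential_pd)
  qed
  then have "Oc ?EE (complexify (pd u (pd v fh) ?p)) = - Oc ?dE (complexify (differential f q (c, v)))"
    unfolding pd_bilinear[OF bounded_bilinear_Oc dE dF] pE pF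
    by (simp add: in_chart_apply[OF chart q] differential_pd eq_neg_iff_add_eq_0)
  also have "\<dots> = ?T v * ?W"
  proof -
    have "Oc ?dE ?EE = - 2 * ?W" "Oc ?dE (vcnj ?EE) = 0"
      using dE_pairings[OF X q, of u] Oc_swap[of ?dE ?EE] Oc_swap[of ?dE "vcnj ?EE"] by simp_all
    then show ?thesis unfolding df_frame[OF X1 X(2) q] by (simp add: Oc_simps)
  qed
  finally have 1: "Oc ?EE (complexify (pd u (pd v fh) ?p)) = ?T v * ?W" .
  then have 2: "Oc (vcnj ?EE) (complexify (pd u (pd v fh) ?p)) = cnj (?T v * ?W)"
    using Oc_vcnj[of ?EE "complexify (pd u (pd v fh) ?p)"] by simp
  have 3: "Oc (complexify (pd w fh ?p)) (complexify (pd u (pd v fh) ?p)) = (?T w * (?T v * ?W) + cnj (?T w * (?T v * ?W))) / 2"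
    using df_frame[OF X1 X(2) q, of w] unfolding differential_pd
    by (simp add: Oc_simps 1 2[simplified] add_divide_distrib)
  have "Re ((a + cnj a) / 2) = Re a" for a by simp
  then show ?thesis unfolding Re_Oc 3 by (simp only: mult.assoc)
qed

lemma pd_fh_commute:
  assumes "q \<in> fst c" shows "pd u (pd v fh) (snd c q) = pd v (pd u fh) (snd c q)"
  using assms by (intro pd_pd_commute[OF open_Dom _ smooth_fh]) blast

lemma linear_tau: "first_order_frame A f U X \<Longrightarrow> q \<in> U \<Longrightarrow> q \<in> fst c \<Longrightarrow> linear (\<lambda>v. tau_c f X q (c, v))"
  by (rule linear_tau_c[where X = X and q = q and c = c and f = f], erule (1) frame_smooth_map(3), erule linear_df)

text \<open>Second derivatives commute, so the expression in \<open>cubic_form_frame\<close> is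
  symmetric in u and v.\<close>

lemma omega_proportional:
  assumes X: "second_order_frame A f U X" "q \<in> U" and q: "q \<in> fst c"
  shows "\<exists>s. \<forall>u. omega_c X q (c, u) = s * tau_c f X q (c, u)"
proof -
  have X1: "first_order_frame A f U X" using X(1) by (simp add: second_order_frame_def)
  show ?thesis
  proof (rule symmetric_proportional[OF linear_tau[OF X1 X(2) q] first_order_tangent(2)[OF X1 X(2) q]])
    fix u v w
    show "Re (tau_c f X q (c, w) * tau_c f X q (c, v) * omega_c X q (c, u)) =
      Re (tau_c f X q (c, w) * tau_c f X q (c, u) * omega_c X q (c, v))"
      unfolding cubic_form_frame[OF X q, symmetric] pd_fh_commute[OF q, of u v] by (rule refl)
  qed
qed

text \<open>With \<omega> a multiple of \<tau>, both frames write the same real cubic form as the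
  real part of a multiple of the cube of \<tau>, so \<open>cubic_unique\<close> applies.\<close>

lemma second_order_compare:
  assumes X: "second_order_frame A f U X" "q \<in> U" and Y: "second_order_frame A f V Y" "q \<in> V"
    and q: "q \<in> fst c"
  shows "(tau_c f X q (c, u))\<^sup>2 * omega_c X q (c, u) = (tau_c f Y q (c, u))\<^sup>2 * omega_c Y q (c, u)"
    and "omega_c Y q (c, 1) \<noteq> 0 \<Longrightarrow> \<exists>p. p \<noteq> 0 \<and> (\<forall>u. tau_c f Y q (c, u) = p * tau_c f X q (c, u))"
proof -
  have X1: "first_order_frame A f U X" using X(1) by (simp add: second_order_frame_def)
  have Y1: "first_order_frame A f V Y" using Y(1) by (simp add: second_order_frame_def)
  obtain s where s: "\<And>u. omega_c X q (c, u) = s * tau_c f X q (c, u)"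
    using omega_proportional[OF X q] by blast
  obtain r where r: "\<And>u. omega_c Y q (c, u) = r * tau_c f Y q (c, u)"
    using omega_proportional[OF Y q] by blast
  have eq: "Re (s * (tau_c f X q (c, u))^3) = Re (r * (tau_c f Y q (c, u))^3)" for u
    using cubic_form_frame[OF X q, of u u u] cubic_form_frame[OF Y q, of u u u] unfolding s r
    by (simp only: power3_eq_cube mult.assoc mult.commute mult.left_commute)
  note cu = cubic_unique[OF linear_tau[OF X1 X(2) q] first_order_tangent(2)[OF X1 X(2) q]
    linear_tau[OF Y1 Y(2) q] first_order_tangent(2)[OF Y1 Y(2) q] eq]
  show "(tau_c f X q (c, u))\<^sup>2 * omega_c X q (c, u) = (tau_c f Y q (c, u))\<^sup>2 * omega_c Y q (c, u)"
    using cu(1)[of u] unfolding s r by (simp add: power3_eq_cube power2_eq_square mult.left_commute mult.commute)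
  show "\<exists>p. p \<noteq> 0 \<and> (\<forall>u. tau_c f Y q (c, u) = p * tau_c f X q (c, u))" if "omega_c Y q (c, 1) \<noteq> 0"
  proof (rule cu(2))
    show "r \<noteq> 0" using that r[of 1] by auto
  qed
qed

end

locale lagrangian_surface = surface A for A :: "'a::{t2_space, second_countable_topology} chart set" +
  fixes f :: "'a \<Rightarrow> real^4"
  assumes lagrangian: "lagrangian_immersion A f"
begin

lemma lagrangian_chart: "c \<in> A \<Longrightarrow> lagrangian_chart A c f"
  using chart_in_atlas lagrangian by (simp add: lagrangian_chart_def lagrangian_chart_axioms_def)

lemma fubini_form_eq:
  assumes X: "second_order_frame A f U X" "q \<in> U" and u: "u \<in> tangents A q"
  shows "fubini_form A f q u = (tau_c f X q u)\<^sup>2 * omega_c X q u"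
proof -
  obtain c v where cv: "u = (c, v)" "c \<in> A" "q \<in> fst c" using u by (cases u) (auto simp: tangents_def)
  interpret c: lagrangian_chart A c f by (rule lagrangian_chart[OF cv(2)])
  show ?thesis
    unfolding fubini_form_def
  proof (rule the_equality)
    show "\<exists>U' X'. second_order_frame A f U' X' \<and> q \<in> U' \<and>
        (tau_c f X q u)\<^sup>2 * omega_c X q u = (tau_c f X' q u)\<^sup>2 * omega_c X' q u" using X by blast
    show "w = (tau_c f X q u)\<^sup>2 * omega_c X q u" if "\<exists>U' X'. second_order_frame A f U' X' \<and> q \<in> U' \<and>
        w = (tau_c f X' q u)\<^sup>2 * omega_c X' q u" for w
      using that c.second_order_compare(1)[OF _ _ X cv(3)] unfolding cv(1) by blast
  qed
qed

end

lemma bounded_bilinear_vscale: "bounded_bilinear (\<lambda>(c::complex) (v::complex^4). c *s v)"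
  unfolding bilinear_conv_bounded_bilinear[symmetric] bilinear_def
  by (auto intro!: linearI simp: vec_eq_iff algebra_simps)

context lagrangian_chart
begin

text \<open>For trace-free \<gamma> the form g is the square of the modulus of \<omega>.\<close>

lemma omega_nonzero:
  assumes el: "elliptic_immersion A f" and X: "second_order_frame A f U X" "q \<in> U" and q: "q \<in> fst c"
    and v: "v \<noteq> 0"
  shows "omega_c X q (c, v) \<noteq> 0"
proof -
  have X1: "first_order_frame A f U X" using X(1) by (simp add: second_order_frame_def)
  obtain c' where c': "c' \<in> A" "q \<in> fst c'" using atlas_chart[OF q] .
  let ?w = "differential (snd c') q (c, v)"
  have u: "(c', ?w) \<in> tangents A q" using c' by (simp add: tangents_def)
  have e: "gamma_form X i j q (c, v) = gamma_form X i j q (c', ?w)" for i j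
    unfolding gamma_form_def theta_form_def
    by (simp add: differential_from[OF frame_smooth_map(1,2)[OF X1] X(2) q c'])
  have "?w \<noteq> 0"
  proof
    assume "?w = 0"
    then have "v = differential (snd c) q (c', 0)" using coordinate_from[OF q c', of v] by simp
    also have "\<dots> = 0"
    proof -
      have "in_chart c' (snd c) differentiable at (snd c' q)"
        using transitions[OF c'(1)] q c'(2) unfolding oriented_transition_def
        by (auto elim!: smooth_on_differentiable)
      from linear_0[OF linear_pd[OF this]] show ?thesis by (simp add: differential_pd)
    qed
    finally show False using v by simp
  qed
  then have g: "g_form X q (c', ?w) > 0" using el X1 X(2) u unfolding elliptic_immersion_def by fastforce
  have "gamma_form X 1 1 q (c', ?w) + gamma_form X 2 2 q (c', ?w) = 0"
    using X u unfolding second_order_frame_def by blast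
  then have "gamma_form X 2 2 q (c', ?w) = - gamma_form X 1 1 q (c', ?w)" by simp
  then have "gamma_form X 1 1 q (c', ?w) \<noteq> 0 \<or> gamma_form X 2 1 q (c', ?w) \<noteq> 0"
    "omega_c X q (c, v) = Complex (gamma_form X 1 1 q (c', ?w)) (gamma_form X 2 1 q (c', ?w))"
    using g by (auto simp: g_form_def omega_c_def e)
  then show ?thesis by (auto simp: complex_eq_iff)
qed

text \<open>The real part of \<open>tau_c\<close> times E is df for either frame; as \<tau> takes
  all complex values, a factor p in \<tau> must be compensated in E.\<close>

lemma frame_E_proportional:
  assumes el: "elliptic_immersion A f" and X: "second_order_frame A f U X" "q \<in> U"
    and Y: "second_order_frame A f V Y" "q \<in> V" and q: "q \<in> fst c"
  shows "\<exists>p. p \<noteq> 0 \<and> (\<forall>u. tau_c f Y q (c, u) = p * tau_c f X q (c, u)) \<and> frame_E (X q) = p *s frame_E (Y q)"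
proof -
  have X1: "first_order_frame A f U X" using X(1) by (simp add: second_order_frame_def)
  have Y1: "first_order_frame A f V Y" using Y(1) by (simp add: second_order_frame_def)
  obtain p where p: "p \<noteq> 0" "\<And>u. tau_c f Y q (c, u) = p * tau_c f X q (c, u)"
    using second_order_compare(2)[OF X Y q] omega_nonzero[OF el Y q] by fastforce
  obtain S where S: "\<And>x. tau_c f X q (c, S x) = x"
    by (rule linear_det_inverse[OF linear_tau[OF X1 X(2) q] first_order_tangent(2)[OF X1 X(2) q]], rule that, assumption)
  have "(x / 2) *s frame_E (X q) + (cnj x / 2) *s vcnj (frame_E (X q))
      = (p * x / 2) *s frame_E (Y q) + (cnj (p * x) / 2) *s vcnj (frame_E (Y q))" for x
    using df_frame[OF X1 X(2) q, of "S x"] df_frame[OF Y1 Y(2) q, of "S x"] unfolding p(2) S by metis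
  from this[of 1] this[of \<i>] have "frame_E (X q) $ a = p * frame_E (Y q) $ a" for a
    by (auto simp: vec_eq_iff vcnj_def complex_eq_iff dest!: spec[of _ a]) argo+
  then have "frame_E (X q) = p *s frame_E (Y q)" by (simp add: vec_eq_iff)
  with p show ?thesis by blast
qed

text \<open>For two second order frames \<open>E\<close> changes by a factor, and modulo \<open>E\<close> the form \<open>dE\<close> is
  \<open>cnj \<eta> cnj E + \<omega> cnj N\<close>. If \<open>\<eta>\<close> vanishes for one of the frames, then for the other one it is
  complex antilinear; being complex linear for a third order frame, it vanishes.\<close>

lemma third_order_eta_zero:
  assumes el: "elliptic_immersion A f" and X: "third_order_frame A f U X" "q \<in> U"
    and Y: "third_order_frame A f V Y" "q \<in> V" and q: "q \<in> fst c"
    and eta: "\<And>u. eta_c X q (c, u) = 0"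
  shows "eta_c Y q (c, u) = 0"
proof -
  have X2: "second_order_frame A f U X" and Y2: "second_order_frame A f V Y"
    using X(1) Y(1) by (simp_all add: third_order_frame_def)
  then have X1: "first_order_frame A f U X" and Y1: "first_order_frame A f V Y"
    by (simp_all add: second_order_frame_def)
  note SpX = frame_smooth_map(3)[OF X1 X(2)] and SpY = frame_smooth_map(3)[OF Y1 Y(2)]
  obtain p where p: "p \<noteq> 0" "\<And>u. tau_c f Y q (c, u) = p * tau_c f X q (c, u)"
    "frame_E (X q) = p *s frame_E (Y q)"
    using frame_E_proportional[OF el X2 X(2) Y2 Y(2) q] by blast
  let ?W = "snd c ` (fst c \<inter> (U \<inter> V))" and ?p = "snd c q"
  have W: "open ?W" "?p \<in> ?W"
    using open_chart_image[OF chart open_Int[OF frame_smooth_map(2)[OF X1] frame_smooth_map(2)[OF Y1]]]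
      q X(2) Y(2) by auto
  let ?EX = "\<lambda>z. frame_E (in_chart c X z)" and ?EY = "\<lambda>z. frame_E (in_chart c Y z)"
  let ?NX = "\<lambda>z. vcnj (frame_N (in_chart c X z))"
  have sX: "smooth_on ?W (in_chart c X)" and sY: "smooth_on ?W (in_chart c Y)"
    using smooth_hat[OF frame_smooth_map(1,2)[OF X1]] smooth_hat[OF frame_smooth_map(1,2)[OF Y1]]
    by (auto elim!: smooth_on_subset)
  note sE = smooth_on_linear[OF W(1) bounded_linear_frame_E sX] smooth_on_linear[OF W(1) bounded_linear_frame_E sY]
    smooth_on_linear[OF W(1) bounded_linear_vcnj smooth_on_linear[OF W(1) bounded_linear_frame_N sX]]
  \<comment> \<open>The factor with E of Y equal to \<open>?mu\<close> times E of X. The pointwise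
    factor from \<open>frame_E_proportional\<close> comes without regularity; written as a pairing,
    its inverse is visibly smooth and can be differentiated.\<close>
  let ?mu = "\<lambda>z. Oc (?EY z) (?NX z) * (1 / 2)"
  have smu: "smooth_on ?W ?mu"
    by (intro smooth_on_mult W(1) smooth_on_const smooth_on_bilinear[OF W(1) bounded_bilinear_Oc] sE)
  have pr: "?mu z *s ?EX z = ?EY z" if "z \<in> ?W" for z
  proof -
    obtain y where y: "z = snd c y" "y \<in> fst c" "y \<in> U" "y \<in> V" using \<open>z \<in> ?W\<close> by blast
    obtain r where r: "r \<noteq> 0" "frame_E (X y) = r *s frame_E (Y y)"
      using frame_E_proportional[OF el X2 y(3) Y2 y(4,2)] by blast
    have "2 = r * Oc (frame_E (Y y)) (vcnj (frame_N (X y)))"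
      using frame_relations(3)[OF frame_smooth_map(3)[OF X1 y(3)]] unfolding r(2) by (simp add: Oc_simps)
    then have k: "Oc (frame_E (Y y)) (vcnj (frame_N (X y))) * (1 / 2) * r = 1" by (simp add: mult.commute)
    show ?thesis unfolding y(1) in_chart_apply[OF chart y(2)] r(2) vector_smult_assoc k by simp
  qed
  have dEX: "pd u ?EX ?p = frame_E (differential X q (c, u))" and dEY: "pd u ?EY ?p = frame_E (differential Y q (c, u))" for u
    unfolding differential_pd
    by (rule pd_linear[OF bounded_linear_frame_E smooth_on_differentiable[OF sX W(2)]],
        rule pd_linear[OF bounded_linear_frame_E smooth_on_differentiable[OF sY W(2)]])
  have Xq: "in_chart c X ?p = X q" "in_chart c Y ?p = Y q" by (simp_all add: in_chart_apply[OF chart q])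
  have dE: "frame_E (differential Y q (c, u)) = ?mu ?p *s frame_E (differential X q (c, u)) + pd u ?mu ?p *s frame_E (X q)" for u
  proof -
    have "pd u (\<lambda>z. ?mu z *s ?EX z) ?p = pd u ?EY ?p"
      by (rule pd_cong_open(1)[OF W smooth_on_differentiable[OF smooth_on_bilinear[OF W(1) bounded_bilinear_vscale smu sE(1)] W(2)] pr])
    then show ?thesis
      unfolding pd_bilinear[OF bounded_bilinear_vscale smooth_on_differentiable[OF smu W(2)] smooth_on_differentiable[OF sE(1) W(2)]]
        dEX dEY Xq by simp
  qed
  obtain s where s: "\<And>u. omega_c X q (c, u) = s * tau_c f X q (c, u)"
    using omega_proportional[OF X2 X(2) q] by blast
  obtain r where r: "\<And>u. omega_c Y q (c, u) = r * tau_c f Y q (c, u)"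
    using omega_proportional[OF Y2 Y(2) q] by blast
  define m where "m = ?mu ?p * s * Oc (vcnj (frame_N (X q))) (frame_N (Y q))"
  have 1: "2 * cnj (eta_c Y q (c, u)) = m * tau_c f X q (c, u)" for u
  proof -
    let ?dE = "frame_E (differential X q (c, u))"
    have EN: "Oc (frame_E (X q)) (frame_N (Y q)) = 0"
      unfolding p(3) by (simp add: Oc_simps frame_relations(2)[OF SpY])
    have d: "Oc ?dE (frame_N (X q)) = 0" "Oc ?dE (vcnj (frame_E (X q))) = 0"
        "Oc ?dE (frame_E (X q)) = - 2 * omega_c X q (c, u)"
      using dE_pairings[OF X2 X(2) q, of u] eta[of u] form_pairings(5)[where X = X and q = q, OF SpX, of "(c, u)"]
        Oc_swap[of ?dE "vcnj (frame_E (X q))"] Oc_swap[of ?dE "frame_E (X q)"] by simp_all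
    have "2 *s ?dE = Oc ?dE (vcnj (frame_N (X q))) *s frame_E (X q) + (2 * omega_c X q (c, u)) *s vcnj (frame_N (X q))"
      using symplectic_expand[OF frame_relations[OF SpX], of ?dE] unfolding d by (simp add: vec_eq_iff)
    then have "Oc (2 *s ?dE) (frame_N (Y q)) = 2 * omega_c X q (c, u) * Oc (vcnj (frame_N (X q))) (frame_N (Y q))"
      by (simp add: Oc_simps EN)
    then have "Oc ?dE (frame_N (Y q)) = omega_c X q (c, u) * Oc (vcnj (frame_N (X q))) (frame_N (Y q))"
      by (simp add: Oc_simps)
    then show ?thesis
      unfolding form_pairings(5)[where X = Y and q = q, OF SpY, symmetric] dE m_def
      by (simp only: Oc_simps EN s) simp
  qed
  obtain h where h: "\<And>u. u \<in> tangents A q \<Longrightarrow> eta_c Y q u = h * omega_c Y q u"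
    using Y unfolding third_order_frame_def eta_coeffs_def by fastforce
  have 2: "eta_c Y q (c, u) = h * r * p * tau_c f X q (c, u)" for u
  proof -
    obtain c' where c': "c' \<in> A" "q \<in> fst c'" using atlas_chart[OF q] .
    let ?u = "(c', differential (snd c') q (c, u))"
    note df = differential_from[OF frame_smooth_map(1,2)[OF Y1] Y(2) q c']
    have "eta_c Y q (c, u) = eta_c Y q ?u" "omega_c Y q (c, u) = omega_c Y q ?u"
      unfolding eta_c_def omega_c_def alpha_form_def gamma_form_def theta_form_def by (simp_all add: df)
    moreover have "?u \<in> tangents A q" using c' by (simp add: tangents_def)
    ultimately show ?thesis using h r p(2) by (simp add: mult.assoc)
  qed
  obtain S where S: "\<And>x. tau_c f X q (c, S x) = x"
    by (rule linear_det_inverse[OF linear_tau[OF X1 X(2) q] first_order_tangent(2)[OF X1 X(2) q]], rule that, assumption)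
  \<comment> \<open>An antilinear function of x equals a linear one, so both vanish.\<close>
  have "2 * cnj (h * r * p * x) = m * x" for x using 1[of "S x"] unfolding 2 S .
  from this[of 1] this[of \<i>] have "h * r * p = 0" by (simp add: complex_eq_iff) argo
  then show ?thesis using 2 by simp
qed

end

text \<open>If \<eta> vanishes at q for one third order frame, it does so for all, and the definite
  description then denotes 0. Genericity thereby reaches the given frame without a transformation
  law for the Hopf differential.\<close>

lemma (in lagrangian_surface) hopf_nonzero_imp_eta_nonzero:
  assumes el: "elliptic_immersion A f" and X: "third_order_frame A f U X" "q \<in> U"
    and nz: "hopf_differential A f q u \<noteq> 0" and u: "u \<in> tangents A q"
  shows "\<exists>v. eta_c X q (fst u, v) \<noteq> 0"
proof (rule ccontr)
  assume z: "\<nexists>v. eta_c X q (fst u, v) \<noteq> 0"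
  obtain c v where cv: "u = (c, v)" "c \<in> A" "q \<in> fst c" using u by (cases u) (auto simp: tangents_def)
  interpret c: lagrangian_chart A c f by (rule lagrangian_chart[OF cv(2)])
  have 0: "eta_c Y q u = 0" if "third_order_frame A f V Y" "q \<in> V" for V Y
    unfolding cv(1) using z cv(1) by (intro c.third_order_eta_zero[OF el X that cv(3)]) auto
  have "hopf_differential A f q u = 0"
    unfolding hopf_differential_def
  proof (rule the_equality)
    show "\<exists>U X. third_order_frame A f U X \<and> q \<in> U \<and>
        0 = of_real (cmod (t_coeff A f X q) powr (2/3)) * eta_c X q u * omega_c X q u"
      using X 0[OF X] by (intro exI[of _ U] exI[of _ X]) simp
    show "w = 0" if "\<exists>U X. third_order_frame A f U X \<and> q \<in> U \<and>
        w = of_real (cmod (t_coeff A f X q) powr (2/3)) * eta_c X q u * omega_c X q u" for w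
      using that 0 by auto
  qed
  with nz show False by simp
qed

section \<open>Existence of second order frames\<close>

lemma Omega_expand: "Omega v w = v$1 * w$3 + v$2 * w$4 - v$3 * w$1 - v$4 * w$2"
  by (simp add: Omega_def inner_vec_def matrix_vector_mult_def sum_4 J4_def)

lemma Omega_simps:
  "Omega (u + v) w = Omega u w + Omega v w" "Omega w (u + v) = Omega w u + Omega w v"
  "Omega (r *\<^sub>R v) w = r * Omega v w" "Omega w (r *\<^sub>R v) = r * Omega w v" "Omega v v = 0"
  by (simp_all add: Omega_expand algebra_simps)

lemma Omega_swap: "Omega w v = - Omega v w"
  by (simp add: Omega_expand)

lemma bounded_bilinear_Omega: "bounded_bilinear Omega"
  unfolding bilinear_conv_bounded_bilinear[symmetric] bilinear_def
  by (auto intro!: linearI simp: Omega_simps)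

text \<open>This is \<open>- J4 *v v\<close>; the sign makes \<open>Omega v (Jmul w)\<close> the
  inner product.\<close>

definition Jmul :: "real^4 \<Rightarrow> real^4" where
  "Jmul v = (\<chi> i. if i = 1 then - v$3 else if i = 2 then - v$4 else if i = 3 then v$1 else v$2)"

lemma Omega_Jmul: "Omega v (Jmul w) = v \<bullet> w" "Omega (Jmul v) w = - (v \<bullet> w)" "Omega (Jmul v) (Jmul w) = Omega v w"
  by (simp_all add: Omega_expand Jmul_def inner_vec_def sum_4)

text \<open>The last two columns are \<open>J\<close> applied to the dual basis of \<open>v, w\<close> in their plane.\<close>

definition lagrangian_frame :: "real^4 \<Rightarrow> real^4 \<Rightarrow> real^4^4" where
  "lagrangian_frame v w = (let d = (v \<bullet> v) * (w \<bullet> w) - (v \<bullet> w) * (v \<bullet> w) in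
    (\<chi> i j. if j = 1 then v$i else if j = 2 then w$i
      else if j = 3 then Jmul (((w \<bullet> w) / d) *\<^sub>R v + (- (v \<bullet> w) / d) *\<^sub>R w) $ i
      else Jmul (((v \<bullet> v) / d) *\<^sub>R w + (- (v \<bullet> w) / d) *\<^sub>R v) $ i))"

lemma Sp4_columns: "X \<in> Sp4 \<longleftrightarrow> (\<forall>i j. Omega (column i X) (column j X) = J4$i$j)"
proof -
  have "(transpose X ** J4 ** X)$i$j = Omega (column i X) (column j X)" for i j
    by (simp add: matrix_matrix_mult_def sum_4 J4_def transpose_def Omega_expand column_def)
  then show ?thesis by (simp add: Sp4_iff vec_eq_iff)
qed

lemma lagrangian_frame_columns:
  "column 1 (lagrangian_frame v w) = v" "column 2 (lagrangian_frame v w) = w"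
  by (simp_all add: lagrangian_frame_def column_def Let_def vec_eq_iff)

lemma lagrangian_frame_Sp4:
  assumes vw: "Omega v w = 0" and d: "(v \<bullet> v) * (w \<bullet> w) - (v \<bullet> w) * (v \<bullet> w) \<noteq> 0"
  shows "lagrangian_frame v w \<in> Sp4"
proof -
  define d where "d = (v \<bullet> v) * (w \<bullet> w) - (v \<bullet> w) * (v \<bullet> w)"
  define y1 where "y1 = ((w \<bullet> w) / d) *\<^sub>R v + (- (v \<bullet> w) / d) *\<^sub>R w"
  define y2 where "y2 = ((v \<bullet> v) / d) *\<^sub>R w + (- (v \<bullet> w) / d) *\<^sub>R v"
  have c: "column 3 (lagrangian_frame v w) = Jmul y1" "column 4 (lagrangian_frame v w) = Jmul y2"
    by (simp_all add: lagrangian_frame_def column_def Let_def vec_eq_iff y1_def y2_def d_def)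
  have d0: "d \<noteq> 0" using d by (simp add: d_def)
  have i: "v \<bullet> y1 = 1" "w \<bullet> y1 = 0" "v \<bullet> y2 = 0" "w \<bullet> y2 = 1"
  proof -
    have "d * (v \<bullet> y1) = d" "d * (w \<bullet> y1) = 0" "d * (v \<bullet> y2) = 0" "d * (w \<bullet> y2) = d"
      using d0 by (simp_all add: y1_def y2_def inner_simps inner_commute[of w v] field_simps)
        (simp_all add: d_def algebra_simps inner_commute[of w v])
    then show "v \<bullet> y1 = 1" "w \<bullet> y1 = 0" "v \<bullet> y2 = 0" "w \<bullet> y2 = 1" using d0 by simp_all
  qed
  have wv: "Omega w v = 0" using vw Omega_swap by (metis minus_zero)
  have o: "Omega y1 y2 = 0" "Omega y2 y1 = 0"
    unfolding y1_def y2_def Omega_simps vw wv by simp_all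
  have Jo: "Jmul y1 \<bullet> y2 = 0" "Jmul y2 \<bullet> y1 = 0"
    using o Omega_Jmul(1)[of "Jmul y1" y2] Omega_Jmul(1)[of "Jmul y2" y1] Omega_Jmul(3)[of y1 y2] Omega_Jmul(3)[of y2 y1]
    by simp_all
  show ?thesis
    unfolding Sp4_columns forall_4 lagrangian_frame_columns c
    by (simp add: Omega_Jmul Omega_simps vw wv i Jo J4_def inner_commute[of y1] inner_commute[of y2])
qed

lemma smooth_lagrangian_frame:
  assumes S: "open S" and v: "smooth_on S v" and w: "smooth_on S w"
    and d: "\<And>z. z \<in> S \<Longrightarrow> (v z \<bullet> v z) * (w z \<bullet> w z) - (v z \<bullet> w z) * (v z \<bullet> w z) \<noteq> 0"
  shows "smooth_on S (\<lambda>z. lagrangian_frame (v z) (w z))"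
proof -
  note i = smooth_on_bilinear[OF S bounded_bilinear_inner]
  have Jm: "bounded_linear Jmul"
    by (rule linear_conv_bounded_linear[THEN iffD1], rule linearI)
      (simp_all add: Jmul_def vec_eq_iff)
  note s = smooth_on_vec_nth[OF S smooth_on_linear[OF S Jm]] smooth_on_add[OF S] smooth_on_scaleR[OF S]
    smooth_on_divide[OF S] smooth_on_minus[OF S] smooth_on_diff[OF S] smooth_on_mult[OF S] i v w
  have "smooth_on S (\<lambda>z. v z $ a)" "smooth_on S (\<lambda>z. w z $ a)" for a
    by (intro smooth_on_vec_nth S v w)+
  moreover have "smooth_on S (\<lambda>z. Jmul (((w z \<bullet> w z) / ((v z \<bullet> v z) * (w z \<bullet> w z) - (v z \<bullet> w z) * (v z \<bullet> w z))) *\<^sub>R v z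
      + (- (v z \<bullet> w z) / ((v z \<bullet> v z) * (w z \<bullet> w z) - (v z \<bullet> w z) * (v z \<bullet> w z))) *\<^sub>R w z) $ a)" for a
    by (intro s d)
  moreover have "smooth_on S (\<lambda>z. Jmul (((v z \<bullet> v z) / ((v z \<bullet> v z) * (w z \<bullet> w z) - (v z \<bullet> w z) * (v z \<bullet> w z))) *\<^sub>R w z
      + (- (v z \<bullet> w z) / ((v z \<bullet> v z) * (w z \<bullet> w z) - (v z \<bullet> w z) * (v z \<bullet> w z))) *\<^sub>R v z) $ a)" for a
    by (intro s d)
  ultimately have "smooth_on S (\<lambda>z. lagrangian_frame (v z) (w z) $ a $ b)" for a b
    using exhaust_4[of b] by (auto simp: lagrangian_frame_def Let_def)
  then have "smooth_on S (\<lambda>z. \<chi> a. \<chi> b. lagrangian_frame (v z) (w z) $ a $ b)"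
    by (intro smooth_on_vec S)
  then show ?thesis by simp
qed

lemma oriented_plane_subset:
  assumes "a * d - b * c > 0"
  shows "oriented_plane (a *\<^sub>R v + b *\<^sub>R w) (c *\<^sub>R v + d *\<^sub>R w) \<subseteq> oriented_plane v w"
proof
  fix x assume "x \<in> oriented_plane (a *\<^sub>R v + b *\<^sub>R w) (c *\<^sub>R v + d *\<^sub>R w)"
  then obtain p q r s where x: "x = (p *\<^sub>R (a *\<^sub>R v + b *\<^sub>R w) + q *\<^sub>R (c *\<^sub>R v + d *\<^sub>R w),
      r *\<^sub>R (a *\<^sub>R v + b *\<^sub>R w) + s *\<^sub>R (c *\<^sub>R v + d *\<^sub>R w))" and det: "p * s - q * r > 0"
    unfolding oriented_plane_def mem_Collect_eq by blast
  have "x = ((p * a + q * c) *\<^sub>R v + (p * b + q * d) *\<^sub>R w, (r * a + s * c) *\<^sub>R v + (r * b + s * d) *\<^sub>R w)"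
    unfolding x by (simp add: algebra_simps)
  moreover have "(p * a + q * c) * (r * b + s * d) - (p * b + q * d) * (r * a + s * c) > 0"
    using mult_pos_pos[OF assms det] by (simp add: algebra_simps)
  ultimately show "x \<in> oriented_plane v w" unfolding oriented_plane_def mem_Collect_eq by blast
qed

lemma oriented_plane_eq:
  assumes "a * d - b * c > 0"
  shows "oriented_plane (a *\<^sub>R v + b *\<^sub>R w) (c *\<^sub>R v + d *\<^sub>R w) = oriented_plane v w"
proof
  let ?D = "a * d - b * c" and ?v = "a *\<^sub>R v + b *\<^sub>R w" and ?w = "c *\<^sub>R v + d *\<^sub>R w"
  define k where "k = inverse ?D"
  have k: "k > 0" "k * ?D = 1" using assms by (simp_all add: k_def)
  have "(k * d) *\<^sub>R ?v + (- (k * b)) *\<^sub>R ?w = (k * ?D) *\<^sub>R v"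
    "(- (k * c)) *\<^sub>R ?v + (k * a) *\<^sub>R ?w = (k * ?D) *\<^sub>R w"
    by (simp_all add: algebra_simps)
  then have e: "(k * d) *\<^sub>R ?v + (- (k * b)) *\<^sub>R ?w = v" "(- (k * c)) *\<^sub>R ?v + (k * a) *\<^sub>R ?w = w"
    unfolding k(2) by simp_all
  have "(k * d) * (k * a) - (- (k * b)) * (- (k * c)) = k * (k * ?D)" by (simp add: algebra_simps)
  then have "(k * d) * (k * a) - (- (k * b)) * (- (k * c)) > 0" using k by simp
  from oriented_plane_subset[OF this, of ?v ?w] show "oriented_plane v w \<subseteq> oriented_plane ?v ?w"
    unfolding e .
qed (rule oriented_plane_subset[OF assms])

lemma gram_nonzero:
  fixes v w :: "'b::real_inner"
  assumes "\<And>a b. a *\<^sub>R v + b *\<^sub>R w = 0 \<Longrightarrow> a = 0 \<and> b = 0"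
  shows "(v \<bullet> v) * (w \<bullet> w) - (v \<bullet> w) * (v \<bullet> w) \<noteq> 0"
proof
  assume 0: "(v \<bullet> v) * (w \<bullet> w) - (v \<bullet> w) * (v \<bullet> w) = 0"
  \<comment> \<open>The equality case of the Cauchy-Schwarz inequality: the squared norm of this
    combination is \<open>v \<bullet> v\<close> times the Gram determinant.\<close>
  let ?u = "(v \<bullet> w) *\<^sub>R v + (- (v \<bullet> v)) *\<^sub>R w"
  have "?u \<bullet> ?u = (v \<bullet> v) * ((v \<bullet> v) * (w \<bullet> w) - (v \<bullet> w) * (v \<bullet> w))"
    by (simp add: inner_simps inner_commute[of w v] algebra_simps)
  then have "?u = 0" using 0 by simp
  then have "v \<bullet> v = 0" using assms by fastforce
  then have "v = 0" by simp
  then show False using assms[of 1 0] by simp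
qed

context lagrangian_chart
begin

lemma Omega_df:
  assumes q: "q \<in> fst c" shows "Omega (differential f q (c, v)) (differential f q (c, w)) = 0"
proof -
  obtain c' where c': "c' \<in> A" "q \<in> fst c'" using atlas_chart[OF q] .
  then have "q \<in> carrier_of A" "(c', x) \<in> tangents A q" for x by (auto simp: carrier_of_def tangents_def)
  then show ?thesis using lagrangian unfolding df_from[OF q c'] lagrangian_immersion_def by blast
qed

lemma df_independent:
  assumes q: "q \<in> fst c" and c: "c \<in> A" and 0: "a *\<^sub>R differential f q (c, \<i>) + b *\<^sub>R differential f q (c, 1) = 0"
  shows "a = 0 \<and> b = 0"
proof -
  have "q \<in> carrier_of A" "(c, Complex b a) \<in> tangents A q" using q c by (auto simp: carrier_of_def tangents_def)
  moreover have "differential f q (c, Complex b a) = b *\<^sub>R differential f q (c, 1) + a *\<^sub>R differential f q (c, \<i>)"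
    using pd_complex_dir[of fh "snd c q" "Complex b a"] smooth_on_differentiable[OF smooth_fh] q
    by (simp add: differential_pd)
  ultimately have "Complex b a = 0"
    using lagrangian 0 unfolding lagrangian_immersion_def by (metis add.commute snd_conv)
  then show ?thesis by (simp add: complex_eq_iff)
qed

lemma Omega_pd:
  assumes "z \<in> Dom" shows "Omega (pd v fh z) (pd w fh z) = 0"
  using assms Omega_df by (auto simp: differential_pd)

text \<open>The derivative of the Lagrangian condition. Together with commuting second derivatives
  it makes the cubic form totally symmetric, so that it has only four coefficients.\<close>

lemma Omega_pd_pd:
  assumes z: "z \<in> Dom" shows "Omega (pd v fh z) (pd u (pd w fh) z) = Omega (pd w fh z) (pd u (pd v fh) z)"
proof -
  note d = smooth_on_differentiable[OF smooth_on_pd[OF smooth_fh] z]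
  have "pd u (\<lambda>z. Omega (pd v fh z) (pd w fh z)) z = pd u (\<lambda>z. 0) z"
    by (rule pd_cong_open(1)[OF open_Dom z])
      (use Omega_pd in \<open>auto intro!: smooth_on_differentiable[OF _ z] smooth_on_bilinear[OF open_Dom bounded_bilinear_Omega]
        smooth_on_pd smooth_fh\<close>)
  then have "Omega (pd v fh z) (pd u (pd w fh) z) + Omega (pd u (pd v fh) z) (pd w fh z) = 0"
    unfolding pd_bilinear[OF bounded_bilinear_Omega d d] by simp
  then show ?thesis using Omega_swap[of "pd u (pd v fh) z" "pd w fh z"] by simp
qed

lemma gamma_form_columns:
  assumes "X q \<in> Sp4"
  shows "gamma_form X 1 j q u = Omega (column 1 (X q)) (column j (differential X q u))"
    "gamma_form X 2 j q u = Omega (column 2 (X q)) (column j (differential X q u))"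
  unfolding gamma_form_def theta_form_def Sp4_matrix_inv[OF assms]
  by (simp_all add: symplectic_inverse_entries Omega_expand column_def)

text \<open>In the chart \<open>c\<close> the tangent plane carries the basis \<open>f\<^sub>y, f\<^sub>x\<close>, in this order because of the
  orientation convention for the Gauss map.\<close>

lemma first_order_frame_from_basis:
  assumes c: "c \<in> A" and B: "open B" "connected B" "B \<subseteq> Dom"
    and smooth: "smooth_on B a1" "smooth_on B b1" "smooth_on B a2" "smooth_on B b2"
    and det: "\<And>z. z \<in> B \<Longrightarrow> a1 z * b2 z - b1 z * a2 z > 0"
  defines "V1 \<equiv> \<lambda>z. a1 z *\<^sub>R pd \<i> fh z + b1 z *\<^sub>R pd 1 fh z"
    and "V2 \<equiv> \<lambda>z. a2 z *\<^sub>R pd \<i> fh z + b2 z *\<^sub>R pd 1 fh z"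
  defines "X \<equiv> \<lambda>q. lagrangian_frame (V1 (snd c q)) (V2 (snd c q))"
  shows "first_order_frame A f (fst c \<inter> snd c -` B) X"
    and "q \<in> fst c \<Longrightarrow> snd c q \<in> B \<Longrightarrow> gamma_form X 1 1 q (c, u) = Omega (V1 (snd c q)) (pd u V1 (snd c q))"
    and "q \<in> fst c \<Longrightarrow> snd c q \<in> B \<Longrightarrow> gamma_form X 2 2 q (c, u) = Omega (V2 (snd c q)) (pd u V2 (snd c q))"
    and "q \<in> fst c \<Longrightarrow> snd c q \<in> B \<Longrightarrow> gamma_form X 2 1 q (c, u) = Omega (V2 (snd c q)) (pd u V1 (snd c q))"
proof -
  let ?U = "fst c \<inter> snd c -` B"
  have sf: "smooth_on B fh" by (rule smooth_on_subset[OF smooth_fh B(3)])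
  have sV: "smooth_on B V1" "smooth_on B V2"
    unfolding V1_def V2_def by (intro smooth_on_add smooth_on_scaleR B smooth smooth_on_pd sf)+
  have img: "\<exists>q. q \<in> fst c \<and> snd c q = z" if "z \<in> B" for z using that B(3) by blast
  have indep: "x = 0 \<and> y = 0" if z: "z \<in> B" and 0: "x *\<^sub>R V1 z + y *\<^sub>R V2 z = 0" for x y z
  proof -
    obtain q where q: "q \<in> fst c" "snd c q = z" using img[OF z] by blast
    have "(x * a1 z + y * a2 z) *\<^sub>R differential f q (c, \<i>) + (x * b1 z + y * b2 z) *\<^sub>R differential f q (c, 1) = 0"
      using 0 by (simp add: V1_def V2_def differential_pd q(2) algebra_simps)
    from df_independent[OF q(1) c this] have e: "x * a1 z + y * a2 z = 0" "x * b1 z + y * b2 z = 0" by auto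
    have "x * (a1 z * b2 z - b1 z * a2 z) = (x * a1 z + y * a2 z) * b2 z - (x * b1 z + y * b2 z) * a2 z"
      "y * (a1 z * b2 z - b1 z * a2 z) = (x * b1 z + y * b2 z) * a1 z - (x * a1 z + y * a2 z) * b1 z"
      by (simp_all add: algebra_simps)
    then show ?thesis using det[OF z] unfolding e by simp
  qed
  have gram: "(V1 z \<bullet> V1 z) * (V2 z \<bullet> V2 z) - (V1 z \<bullet> V2 z) * (V1 z \<bullet> V2 z) \<noteq> 0" if "z \<in> B" for z
    by (rule gram_nonzero[OF indep[OF that]])
  have OV: "Omega (V1 z) (V2 z) = 0" if "z \<in> B" for z
    using Omega_pd that B(3) by (simp add: V1_def V2_def Omega_simps subset_eq)
  let ?X = "\<lambda>z. lagrangian_frame (V1 z) (V2 z)"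
  have sX: "smooth_on B ?X" by (rule smooth_lagrangian_frame[OF B(1) sV gram])
  have hom: "continuous_on Dom (inv_into (fst c) (snd c))" "continuous_on (fst c) (snd c)"
    "\<And>q. q \<in> fst c \<Longrightarrow> inv_into (fst c) (snd c) (snd c q) = q"
    using chart unfolding is_chart_def homeomorphism_def by auto
  have U: "?U = inv_into (fst c) (snd c) ` B"
  proof (rule set_eqI, rule iffI)
    fix q assume "q \<in> ?U"
    then show "q \<in> inv_into (fst c) (snd c) ` B" using hom(3)[of q] by (intro image_eqI[of _ _ "snd c q"]) simp_all
  next
    fix q assume "q \<in> inv_into (fst c) (snd c) ` B"
    then obtain z where z: "z \<in> B" "q = inv_into (fst c) (snd c) z" by blast
    obtain p where "p \<in> fst c" "snd c p = z" using img[OF z(1)] by blast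
    then show "q \<in> ?U" using z hom(3)[of p] by simp
  qed
  have oU: "open ?U" "connected ?U"
    using continuous_open_preimage[OF hom(2) open_dom B(1)]
      connected_continuous_image[OF continuous_on_subset[OF hom(1) B(3)] B(2)] unfolding U by simp_all
  have Sp: "X q \<in> Sp4" if "q \<in> ?U" for q
    unfolding X_def using that by (intro lagrangian_frame_Sp4 OV gram) auto
  have sm: "smooth_map A ?U X"
    unfolding smooth_map_def
  proof
    fix c' assume c': "c' \<in> A"
    have o': "open (snd c' ` (fst c' \<inter> ?U))" by (rule open_chart_image[OF is_chart[OF c'] oU(1)])
    have "smooth_on (snd c' ` (fst c' \<inter> ?U)) (\<lambda>z. ?X (in_chart c' (snd c) z))"
    proof (rule smooth_on_compose[OF o' B(1) _ sX])
      show "smooth_on (snd c' ` (fst c' \<inter> ?U)) (in_chart c' (snd c))"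
        using transitions[OF c'] unfolding oriented_transition_def by (auto elim!: smooth_on_subset)
      show "in_chart c' (snd c) ` snd c' ` (fst c' \<inter> ?U) \<subseteq> B"
        using is_chart[OF c'] by (auto simp: in_chart_apply)
    qed
    then show "smooth_on (snd c' ` (fst c' \<inter> ?U)) (in_chart c' X)"
      by (simp add: X_def in_chart_def comp_def)
  qed
  have gauss: "gauss_map f c' q = oriented_plane (column 1 (X q)) (column 2 (X q))"
    if q: "q \<in> ?U" and c': "c' \<in> A" "q \<in> fst c'" for q c'
  proof -
    interpret c': lagrangian_chart A c' f
      using chart_in_atlas[OF c'(1)] lagrangian by (simp add: lagrangian_chart_def lagrangian_chart_axioms_def)
    have qc: "q \<in> fst c" using q by simp
    let ?S = "\<lambda>v. differential (snd c) q (c', v)"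
    have S: "Im (cnj (?S 1) * ?S \<i>) > 0"
      using c'.transitions[OF c] qc c'(2) unfolding oriented_transition_def differential_pd by simp
    have d: "differential f q (c', v) = Im (?S v) *\<^sub>R differential f q (c, \<i>) + Re (?S v) *\<^sub>R differential f q (c, 1)" for v
    proof -
      have "differential f q (c', v) = differential f q (c, ?S v)" by (rule c'.df_from[OF c'(2) c qc])
      also have "\<dots> = Re (?S v) *\<^sub>R differential f q (c, 1) + Im (?S v) *\<^sub>R differential f q (c, \<i>)"
        unfolding differential_pd[of f q c] using smooth_on_differentiable[OF smooth_fh] qc by (intro pd_complex_dir) blast
      finally show ?thesis by simp
    qed
    have "gauss_map f c' q = oriented_plane (differential f q (c, \<i>)) (differential f q (c, 1))"
      unfolding gauss_map_def d by (rule oriented_plane_eq) (use S in \<open>simp add: algebra_simps\<close>)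
    also have "\<dots> = oriented_plane (V1 (snd c q)) (V2 (snd c q))"
      unfolding V1_def V2_def differential_pd
      by (rule oriented_plane_eq[symmetric]) (use det q in auto)
    finally show ?thesis by (simp add: X_def lagrangian_frame_columns)
  qed
  show X1: "first_order_frame A f ?U X"
    unfolding first_order_frame_def symplectic_frame_def
    using oU sm Sp gauss chart_carrier by blast
  have dX: "column 1 (differential X q (c, u)) = pd u V1 (snd c q)" "column 2 (differential X q (c, u)) = pd u V2 (snd c q)"
    if q: "q \<in> fst c" "snd c q \<in> B" for q u
  proof -
    have "differential X q (c, u) = pd u ?X (snd c q)"
      unfolding differential_pd
      by (rule pd_cong_open(1)[OF B(1) q(2) smooth_on_differentiable[OF sX q(2)], symmetric])
        (use B(3) in \<open>auto simp: X_def in_chart_apply[OF chart]\<close>)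
    moreover have "column j (pd u ?X (snd c q)) = pd u (\<lambda>z. column j (?X z)) (snd c q)" for j
    proof (rule pd_linear[symmetric, OF _ smooth_on_differentiable[OF sX q(2)]])
      show "bounded_linear (column j :: real^4^4 \<Rightarrow> _)"
        by (rule linear_conv_bounded_linear[THEN iffD1], rule linearI) (simp_all add: column_def vec_eq_iff)
    qed
    ultimately show "column 1 (differential X q (c, u)) = pd u V1 (snd c q)" "column 2 (differential X q (c, u)) = pd u V2 (snd c q)"
      by (simp_all add: lagrangian_frame_columns)
  qed
  show "gamma_form X 1 1 q (c, u) = Omega (V1 (snd c q)) (pd u V1 (snd c q))"
    "gamma_form X 2 2 q (c, u) = Omega (V2 (snd c q)) (pd u V2 (snd c q))"
    "gamma_form X 2 1 q (c, u) = Omega (V2 (snd c q)) (pd u V1 (snd c q))"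
    if q: "q \<in> fst c" "snd c q \<in> B"
  proof -
    have "X q \<in> Sp4" using Sp q by simp
    note g = gamma_form_columns[where X = X and q = q, OF this]
    have col: "column 1 (X q) = V1 (snd c q)" "column 2 (X q) = V2 (snd c q)"
      by (simp_all add: X_def lagrangian_frame_columns)
    show "gamma_form X 1 1 q (c, u) = Omega (V1 (snd c q)) (pd u V1 (snd c q))"
      "gamma_form X 2 2 q (c, u) = Omega (V2 (snd c q)) (pd u V2 (snd c q))"
      "gamma_form X 2 1 q (c, u) = Omega (V2 (snd c q)) (pd u V1 (snd c q))"
      unfolding g dX[OF q] col by (rule refl)+
  qed
qed

abbreviation "fx \<equiv> pd 1 fh"
abbreviation "fy \<equiv> pd \<i> fh"

lemma cubic_coefficients:
  assumes z: "z \<in> Dom"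
  shows "Omega (fx z) (pd u fx z) = Re u * Omega (fx z) (pd 1 fx z) + Im u * Omega (fx z) (pd \<i> fx z)"
    and "Omega (fx z) (pd u fy z) = Re u * Omega (fx z) (pd \<i> fx z) + Im u * Omega (fx z) (pd \<i> fy z)"
    and "Omega (fy z) (pd u fy z) = Re u * Omega (fx z) (pd \<i> fy z) + Im u * Omega (fy z) (pd \<i> fy z)"
    and "Omega (fy z) (pd u fx z) = Re u * Omega (fx z) (pd \<i> fx z) + Im u * Omega (fx z) (pd \<i> fy z)"
proof -
  have c: "pd 1 fy z = pd \<i> fx z" by (rule pd_pd_commute[OF open_Dom z smooth_fh])
  have d: "pd u (pd v fh) z = Re u *\<^sub>R pd 1 (pd v fh) z + Im u *\<^sub>R pd \<i> (pd v fh) z" for v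
    by (rule pd_complex_dir[OF smooth_on_differentiable[OF smooth_on_pd[OF smooth_fh] z]])
  have s: "Omega (fy z) (pd w fx z) = Omega (fx z) (pd w fy z)" for w by (rule Omega_pd_pd[OF z])
  have xx: "Omega (fx z) (pd u fx z) = Re u * Omega (fx z) (pd 1 fx z) + Im u * Omega (fx z) (pd \<i> fx z)"
    unfolding d Omega_simps by (rule refl)
  have xy: "Omega (fx z) (pd u fy z) = Re u * Omega (fx z) (pd \<i> fx z) + Im u * Omega (fx z) (pd \<i> fy z)"
    unfolding d[of \<i>] Omega_simps c by (rule refl)
  have yy: "Omega (fy z) (pd u fy z) = Re u * Omega (fx z) (pd \<i> fy z) + Im u * Omega (fy z) (pd \<i> fy z)"
    unfolding d[of \<i>] Omega_simps c s by (rule refl)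
  show "Omega (fx z) (pd u fx z) = Re u * Omega (fx z) (pd 1 fx z) + Im u * Omega (fx z) (pd \<i> fx z)"
    "Omega (fx z) (pd u fy z) = Re u * Omega (fx z) (pd \<i> fx z) + Im u * Omega (fx z) (pd \<i> fy z)"
    "Omega (fy z) (pd u fy z) = Re u * Omega (fx z) (pd \<i> fy z) + Im u * Omega (fy z) (pd \<i> fy z)"
    "Omega (fy z) (pd u fx z) = Re u * Omega (fx z) (pd \<i> fx z) + Im u * Omega (fx z) (pd \<i> fy z)"
    using xx xy yy s[of u] by simp_all
qed

text \<open>With the coefficients \<open>C0, \<dots>, C3\<close> of the cubic form \<open>\<Omega>(df, d\<^sup>2f)\<close>, the quadratic form \<open>g\<close> is its
  Hessian covariant. A first order frame is of second order if the cubic form is apolar to the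
  inverse metric of the frame; the adjugate of the Hessian has this property.\<close>

lemma second_order_frame_exists:
  assumes el: "elliptic_immersion A f" and c: "c \<in> A" and q0: "q0 \<in> fst c"
  shows "\<exists>U X. second_order_frame A f U X \<and> q0 \<in> U"
proof -
  obtain r where r: "r > 0" "ball (snd c q0) r \<subseteq> Dom"
    using open_Dom q0 unfolding open_contains_ball by blast
  define B where "B = ball (snd c q0) r"
  have B: "open B" "connected B" "B \<subseteq> Dom" "snd c q0 \<in> B" using r by (simp_all add: B_def)
  define C0 where "C0 z = Omega (fx z) (pd 1 fx z)" for z
  define C1 where "C1 z = Omega (fx z) (pd \<i> fx z)" for z
  define C2 where "C2 z = Omega (fx z) (pd \<i> fy z)" for z
  define C3 where "C3 z = Omega (fy z) (pd \<i> fy z)" for z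
  have cc: "Omega (fx z) (pd u fx z) = Re u * C0 z + Im u * C1 z"
      "Omega (fx z) (pd u fy z) = Re u * C1 z + Im u * C2 z"
      "Omega (fy z) (pd u fy z) = Re u * C2 z + Im u * C3 z"
      "Omega (fy z) (pd u fx z) = Re u * C1 z + Im u * C2 z" if "z \<in> B" for z u
    using cubic_coefficients[of z u] that B(3) unfolding C0_def C1_def C2_def C3_def by auto
  have sf: "smooth_on B fx" "smooth_on B fy" "smooth_on B (pd v fx)" "smooth_on B (pd v fy)" for v
    using smooth_on_subset[OF smooth_fh B(3)] by (simp_all add: smooth_on_pd)
  note sO = smooth_on_bilinear[OF B(1) bounded_bilinear_Omega]
  have sC: "smooth_on B C0" "smooth_on B C1" "smooth_on B C2" "smooth_on B C3"
    unfolding C0_def [abs_def] C1_def [abs_def] C2_def [abs_def] C3_def [abs_def] by (intro sO sf)+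
  have posC: "(x * C1 z + y * C2 z)\<^sup>2 - (x * C2 z + y * C3 z) * (x * C0 z + y * C1 z) > 0"
    if z: "z \<in> B" and xy: "x \<noteq> 0 \<or> y \<noteq> 0" for z x y
  proof -
    obtain q where q: "q \<in> fst c" "snd c q = z" using z B(3) by blast
    \<comment> \<open>The coordinate basis itself spans a first order frame; ellipticity applied to
      it says that the Hessian of the cubic form is positive definite.\<close>
    note F = first_order_frame_from_basis[OF c B(1-3), of "\<lambda>z. 1" "\<lambda>z. 0" "\<lambda>z. 0" "\<lambda>z. 1",
        OF smooth_on_const smooth_on_const smooth_on_const smooth_on_const]
    let ?X = "\<lambda>q. lagrangian_frame (fy (snd c q)) (fx (snd c q))"
    have X: "first_order_frame A f (fst c \<inter> snd c -` B) ?X" using F(1) by simp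
    have "(c, Complex x y) \<in> tangents A q" "snd (c, Complex x y) \<noteq> 0"
      using q c xy by (auto simp: tangents_def complex_eq_iff)
    then have g: "g_form ?X q (c, Complex x y) > 0"
      using el X q z unfolding elliptic_immersion_def by blast
    have gg: "gamma_form ?X 1 1 q (c, Complex x y) = x * C2 z + y * C3 z"
      "gamma_form ?X 2 2 q (c, Complex x y) = x * C0 z + y * C1 z"
      "gamma_form ?X 2 1 q (c, Complex x y) = x * C1 z + y * C2 z"
      using F(2-4)[of q "Complex x y"] q z cc[OF z, of "Complex x y"] by simp_all
    show ?thesis using g unfolding g_form_def gg mult_minus_left by linarith
  qed
  \<comment> \<open>The coefficients of g in the coordinate frame: g = P x^2 + 2 Q x y + R
    y^2.\<close>
  define P where "P z = (C1 z)\<^sup>2 - C0 z * C2 z" for z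
  define R where "R z = (C2 z)\<^sup>2 - C1 z * C3 z" for z
  define Q where "Q z = (C1 z * C2 z - C0 z * C3 z) * (1 / 2)" for z
  have pos: "P z > 0" "R z > 0" "P z * R z - Q z * Q z > 0" if z: "z \<in> B" for z
  proof -
    have form: "P z * x\<^sup>2 + 2 * Q z * x * y + R z * y\<^sup>2 > 0" if "x \<noteq> 0 \<or> y \<noteq> 0" for x y
      using posC[OF z that] by (simp add: P_def Q_def R_def power2_eq_square algebra_simps)
    from form[of 1 0] form[of 0 1] show p: "P z > 0" and "R z > 0" by simp_all
    \<comment> \<open>The value of the form at (-Q, P).\<close>
    have "P z * (P z * R z - Q z * Q z) > 0"
      using form[of "- Q z" "P z"] p by (simp add: power2_eq_square algebra_simps)
    then show "P z * R z - Q z * Q z > 0" using p zero_less_mult_pos by blast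
  qed
  define a where "a z = sqrt (P z * R z - Q z * Q z)" for z
  have sPQR: "smooth_on B P" "smooth_on B Q" "smooth_on B R"
    unfolding P_def [abs_def] Q_def [abs_def] R_def [abs_def] power2_eq_square
    by (intro smooth_on_diff smooth_on_mult smooth_on_const sC B(1))+
  have sa: "smooth_on B a"
    unfolding a_def [abs_def]
    by (intro smooth_on_sqrt smooth_on_diff smooth_on_mult sPQR B(1)) (use pos(3) in simp)
  have a2: "a z * a z = P z * R z - Q z * Q z" if "z \<in> B" for z
    using pos(3)[OF that] by (simp add: a_def)
  have det: "a z * R z - 0 * (- Q z) > 0" if "z \<in> B" for z
    using pos[OF that] by (simp add: a_def)
  \<comment> \<open>A completed square: since a^2 + Q^2 = P R, the sum of the symmetric squares of
    V1 and V2 is R (P fy^2 - 2 Q fx fy + R fx^2). This is R times the adjugate of the Hessian, and R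
    is positive.\<close>
  let ?V1 = "\<lambda>z. a z *\<^sub>R fy z + 0 *\<^sub>R fx z" and ?V2 = "\<lambda>z. (- Q z) *\<^sub>R fy z + R z *\<^sub>R fx z"
  define X where "X q = lagrangian_frame (?V1 (snd c q)) (?V2 (snd c q))" for q
  let ?U = "fst c \<inter> snd c -` B"
  note F = first_order_frame_from_basis[OF c B(1-3) sa smooth_on_const smooth_on_minus[OF B(1) sPQR(2)] sPQR(3) det,
      folded X_def [abs_def]]
  have X1: "first_order_frame A f ?U X" by (rule F(1))
  have F11: "gamma_form X 1 1 q (c, u) = Omega (?V1 (snd c q)) (pd u ?V1 (snd c q))"
    if "q \<in> fst c" "snd c q \<in> B" for q u
    by (rule F(2)[OF _ that])
  have F22: "gamma_form X 2 2 q (c, u) = Omega (?V2 (snd c q)) (pd u ?V2 (snd c q))"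
    if "q \<in> fst c" "snd c q \<in> B" for q u
    by (rule F(3)[OF _ that])
  have tr: "gamma_form X 1 1 q (c, u) + gamma_form X 2 2 q (c, u) = 0" if q: "q \<in> fst c" "snd c q \<in> B" for q u
  proof -
    let ?z = "snd c q"
    have z: "?z \<in> Dom" using q by blast
    have d1: "pd u ?V1 ?z = a ?z *\<^sub>R pd u fy ?z + pd u a ?z *\<^sub>R fy ?z"
      using pd_bilinear[OF bounded_bilinear_scaleR smooth_on_differentiable[OF sa q(2)] smooth_on_differentiable[OF sf(2) q(2)]]
      by simp
    have s: "smooth_on B (\<lambda>z. (- Q z) *\<^sub>R fy z)" "smooth_on B (\<lambda>z. R z *\<^sub>R fx z)"
      by (intro smooth_on_scaleR B(1) sPQR sf smooth_on_minus)+
    have d2: "pd u ?V2 ?z = (- Q ?z) *\<^sub>R pd u fy ?z + pd u (\<lambda>z. - Q z) ?z *\<^sub>R fy ?z + (R ?z *\<^sub>R pd u fx ?z + pd u R ?z *\<^sub>R fx ?z)"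
      unfolding pd_bilinear[OF bounded_bilinear_scaleR smooth_on_differentiable[OF sPQR(3) q(2)] smooth_on_differentiable[OF sf(1) q(2)], symmetric]
        pd_bilinear[OF bounded_bilinear_scaleR smooth_on_differentiable[OF smooth_on_minus[OF B(1) sPQR(2)] q(2)] smooth_on_differentiable[OF sf(2) q(2)], symmetric]
      by (rule pd_add[OF smooth_on_differentiable[OF s(1) q(2)] smooth_on_differentiable[OF s(2) q(2)]])
    have Oxy: "Omega (fx ?z) (fy ?z) = 0" "Omega (fy ?z) (fx ?z) = 0" by (rule Omega_pd[OF z])+
    have 1: "gamma_form X 1 1 q (c, u) = a ?z * a ?z * (Re u * C2 ?z + Im u * C3 ?z)"
      unfolding F11[OF q] d1 by (simp add: Omega_simps cc[OF q(2)])
    have 2: "gamma_form X 2 2 q (c, u) = Q ?z * Q ?z * (Re u * C2 ?z + Im u * C3 ?z)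
        - 2 * (Q ?z * R ?z) * (Re u * C1 ?z + Im u * C2 ?z) + R ?z * R ?z * (Re u * C0 ?z + Im u * C1 ?z)"
      unfolding F22[OF q] d2 Omega_simps cc[OF q(2)] Oxy by (simp add: algebra_simps)
    let ?x = "Re u" and ?y = "Im u"
    have Q2: "2 * Q ?z = C1 ?z * C2 ?z - C0 ?z * C3 ?z" by (simp add: Q_def)
    \<comment> \<open>A binary cubic is apolar to its own Hessian; this is a polynomial identity in
      the coefficients.\<close>
    have "P ?z * (?x * C2 ?z + ?y * C3 ?z) - 2 * Q ?z * (?x * C1 ?z + ?y * C2 ?z) + R ?z * (?x * C0 ?z + ?y * C1 ?z) = 0"
      unfolding Q2 P_def R_def by (simp add: power2_eq_square algebra_simps)
    moreover have "gamma_form X 1 1 q (c, u) + gamma_form X 2 2 q (c, u) = R ?z * (P ?z * (?x * C2 ?z + ?y * C3 ?z)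
        - 2 * Q ?z * (?x * C1 ?z + ?y * C2 ?z) + R ?z * (?x * C0 ?z + ?y * C1 ?z))"
      unfolding 1 2 a2[OF q(2)] by (simp add: algebra_simps)
    ultimately show ?thesis by simp
  qed
  have "gamma_form X 1 1 q (c', w) + gamma_form X 2 2 q (c', w) = 0"
    if q: "q \<in> ?U" and c': "c' \<in> A" "q \<in> fst c'" for q c' w
  proof -
    have "differential X q (c', w) = differential X q (c, differential (snd c) q (c', w))"
      using q by (intro differential_into[OF frame_smooth_map(1,2)[OF X1] q _ c']) simp
    then have "gamma_form X i j q (c', w) = gamma_form X i j q (c, differential (snd c) q (c', w))" for i j
      by (simp add: gamma_form_def theta_form_def)
    then show ?thesis using tr q by simp
  qed
  then have "second_order_frame A f ?U X"
    using X1 by (auto simp: second_order_frame_def tangents_def)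
  then show ?thesis using q0 B(4) by blast
qed

end

section \<open>Local rigidity\<close>

context lagrangian_chart
begin

text \<open>The Fubini form is evaluated over an atlas chart c', while the computation takes place
  in c. The real part no longer mentions a frame.\<close>

lemma Re_fubini_form:
  assumes X: "second_order_frame A f U X" "q \<in> U" and q: "q \<in> fst c" and c': "c' \<in> A" "q \<in> fst c'"
  shows "fubini_form A f q (c', differential (snd c') q (c, v)) = (tau_c f X q (c, v))\<^sup>2 * omega_c X q (c, v)"
    and "Re (fubini_form A f q (c', differential (snd c') q (c, v)))
      = Omega (pd v fh (snd c q)) (pd v (pd v fh) (snd c q))"
proof -
  interpret L: lagrangian_surface A f by unfold_locales (rule lagrangian)
  have X1: "first_order_frame A f U X" using X(1) by (simp add: second_order_frame_def)
  let ?u = "(c', differential (snd c') q (c, v))"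
  have u: "?u \<in> tangents A q" using c' by (simp add: tangents_def)
  have "tau_c f X q ?u = tau_c f X q (c, v)"
    by (simp add: tau_c_def tau_form_def df_from[OF q c', of v])
  moreover have "omega_c X q ?u = omega_c X q (c, v)"
    by (simp add: omega_c_def gamma_form_def theta_form_def
        differential_from[OF frame_smooth_map(1,2)[OF X1] X(2) q c', of v])
  ultimately show 1: "fubini_form A f q ?u = (tau_c f X q (c, v))\<^sup>2 * omega_c X q (c, v)"
    using L.fubini_form_eq[OF X u] by simp
  show "Re (fubini_form A f q ?u) = Omega (pd v fh (snd c q)) (pd v (pd v fh) (snd c q))"
    unfolding 1 cubic_form_frame[OF X q] power2_eq_square by (rule refl)
qed

lemma pd_pd_expand:
  assumes z: "z \<in> Dom"
  shows "pd v (pd v fh) z = (Re v * Re v) *\<^sub>R pd 1 fx z + (2 * (Re v * Im v)) *\<^sub>R pd \<i> fx z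
    + (Im v * Im v) *\<^sub>R pd \<i> fy z"
proof -
  have d: "pd u (pd w fh) z = Re u *\<^sub>R pd 1 (pd w fh) z + Im u *\<^sub>R pd \<i> (pd w fh) z" for u w
    by (rule pd_complex_dir[OF smooth_on_differentiable[OF smooth_on_pd[OF smooth_fh] z]])
  have c: "pd u (pd w fh) z = pd w (pd u fh) z" for u w
    by (rule pd_pd_commute[OF open_Dom z smooth_fh])
  have "pd v (pd v fh) z = Re v *\<^sub>R pd v fx z + Im v *\<^sub>R pd v fy z"
    unfolding d[of v v] c[of 1 v] c[of \<i> v] by (rule refl)
  then show ?thesis unfolding d[of 1 v] d[of \<i> v] c[of \<i> 1] by (simp add: vec_eq_iff algebra_simps)
qed

lemma vdz_complexify:
  assumes z: "z \<in> Dom"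
  shows "vdz (complexify \<circ> fh) z = (1/2) *s (complexify (fx z) - \<i> *s complexify (fy z))"
    and "vdz (vdz (complexify \<circ> fh)) z
      = (1/4) *s (complexify (pd 1 fx z) - (2 * \<i>) *s complexify (pd \<i> fx z) - complexify (pd \<i> fy z))"
    and "vdzb (vdz (complexify \<circ> fh)) z = (1/4) *s (complexify (pd 1 fx z) + complexify (pd \<i> fy z))"
proof -
  interpret P: plane_domain Dom by unfold_locales (rule open_Dom)
  have 0: "pd v (\<lambda>z. complexify (G z) $ a) z = complexify (pd v G z) $ a"
    if "smooth_on Dom G" "z \<in> Dom" for v a z and G :: "complex \<Rightarrow> real^4"
    by (rule pd_linear[OF bounded_linear_compose[OF bounded_linear_vec_nth bounded_linear_complexify]
        smooth_on_differentiable[OF that]])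
  have s: "smooth_on Dom fx" "smooth_on Dom fy" by (intro smooth_on_pd smooth_fh)+
  have d1: "vdz (\<lambda>z. complexify (G z)) z = (1/2) *s (complexify (pd 1 G z) - \<i> *s complexify (pd \<i> G z))"
    "vdzb (\<lambda>z. complexify (G z)) z = (1/2) *s (complexify (pd 1 G z) + \<i> *s complexify (pd \<i> G z))"
    if "smooth_on Dom G" "z \<in> Dom" for z and G :: "complex \<Rightarrow> real^4"
    by (simp_all add: vdz_def vdzb_def vec_eq_iff dz_def dzb_def 0[OF that])
  show "vdz (complexify \<circ> fh) z = (1/2) *s (complexify (fx z) - \<i> *s complexify (fy z))"
    unfolding comp_def by (rule d1(1)[OF smooth_fh z])
  let ?\<phi> = "\<lambda>z. (1/2) *s (complexify (fx z) - \<i> *s complexify (fy z))"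
  have e: "vdz (complexify \<circ> fh) y = ?\<phi> y" if "y \<in> Dom" for y
    unfolding comp_def by (rule d1(1)[OF smooth_fh that])
  have sc: "smooth_on Dom (\<lambda>z. complexify (fx z))" "smooth_on Dom (\<lambda>z. complexify (fy z))"
    by (intro smooth_on_linear[OF open_Dom bounded_linear_complexify] s)+
  have sy: "smooth_on Dom (\<lambda>z. \<i> *s complexify (fy z))" by (intro P.smooth_vscale smooth_on_const sc)
  have sd: "smooth_on Dom (\<lambda>z. complexify (fx z) - \<i> *s complexify (fy z))"
    by (intro smooth_on_diff open_Dom sc sy)
  have s\<phi>: "smooth_on Dom ?\<phi>" by (intro P.smooth_vscale smooth_on_const sd)
  have c: "pd 1 fy z = pd \<i> fx z" by (rule pd_pd_commute[OF open_Dom z smooth_fh])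
  have "vdz ?\<phi> z = (1/2) *s (vdz (\<lambda>z. complexify (fx z)) z - \<i> *s vdz (\<lambda>z. complexify (fy z)) z)"
    "vdzb ?\<phi> z = (1/2) *s (vdzb (\<lambda>z. complexify (fx z)) z - \<i> *s vdzb (\<lambda>z. complexify (fy z)) z)"
    using P.vdz_rules(2,4)[OF sd sd smooth_on_const z, of "1/2"] P.vdz_rules(5,6)[OF sc(1) sy smooth_on_const z]
      P.vdz_rules(2,4)[OF sc(2,2) smooth_on_const z, of \<i>] by simp_all
  then have "vdz (vdz (complexify \<circ> fh)) z = (1/2) *s (vdz (\<lambda>z. complexify (fx z)) z - \<i> *s vdz (\<lambda>z. complexify (fy z)) z)"
    "vdzb (vdz (complexify \<circ> fh)) z = (1/2) *s (vdzb (\<lambda>z. complexify (fx z)) z - \<i> *s vdzb (\<lambda>z. complexify (fy z)) z)"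
    using P.vdz_cong[OF s\<phi> z, of "vdz (complexify \<circ> fh)"] e by simp_all
  then show "vdz (vdz (complexify \<circ> fh)) z
      = (1/4) *s (complexify (pd 1 fx z) - (2 * \<i>) *s complexify (pd \<i> fx z) - complexify (pd \<i> fy z))"
    "vdzb (vdz (complexify \<circ> fh)) z = (1/4) *s (complexify (pd 1 fx z) + complexify (pd \<i> fy z))"
    unfolding d1[OF s(1) z] d1[OF s(2) z] c
    by (simp_all add: vec_eq_iff algebra_simps)
qed

text \<open>With T = t^2, comparing coefficients in Re (T v^3) gives Re T, -Im T, -Re T, Im T for
  the four coefficients. The first and third cancel, as do the second and fourth; this is the
  vanishing of the mixed pairings.\<close>

lemma cubic_immersion_chart:
  assumes S: "open S" "S \<subseteq> Dom" and t: "smooth_on S t" "\<And>z. z \<in> S \<Longrightarrow> t z \<noteq> 0"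
    and cub: "\<And>z v. z \<in> S \<Longrightarrow> Omega (pd v fh z) (pd v (pd v fh) z) = Re ((t z)\<^sup>2 * v^3)"
  shows "cubic_immersion S fh t"
proof
  show "open S" "smooth_on S t" "smooth_on S fh" "\<And>z. z \<in> S \<Longrightarrow> t z \<noteq> 0"
    using S t smooth_on_subset[OF smooth_fh] by auto
next
  fix z assume zS: "z \<in> S"
  then have z: "z \<in> Dom" using S by blast
  define T where "T = (t z)\<^sup>2"
  let ?C0 = "Omega (fx z) (pd 1 fx z)" and ?C1 = "Omega (fx z) (pd \<i> fx z)"
  let ?C2 = "Omega (fx z) (pd \<i> fy z)" and ?C3 = "Omega (fy z) (pd \<i> fy z)"
  note cc = cubic_coefficients[OF z, of 1, simplified] cubic_coefficients[OF z, of \<i>, simplified]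
  have C: "Omega (pd v fh z) (pd v (pd v fh) z) = Re v^3 * ?C0 + 3 * ((Re v)\<^sup>2 * Im v) * ?C1
      + 3 * (Re v * (Im v)\<^sup>2) * ?C2 + Im v^3 * ?C3" for v
    unfolding pd_pd_expand[OF z, of v] pd_complex_dir[OF smooth_on_differentiable[OF smooth_fh z], of v] Omega_simps
    using cc by (simp add: algebra_simps power2_eq_square power3_eq_cube)
  have p: "(1 + \<i>)^3 = Complex (-2) 2" "(1 - \<i>)^3 = Complex (-2) (-2)" "\<i>^3 = Complex 0 (-1)"
    by (simp_all add: power3_eq_cube complex_eq_iff)
  have "?C0 = Re T" using cub[OF zS, of 1] C[of 1] by (simp add: T_def)
  moreover have "?C3 = Im T" using cub[OF zS, of \<i>] C[of \<i>] by (simp add: p T_def)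
  moreover have "?C0 + 3 * ?C1 + 3 * ?C2 + ?C3 = - 2 * Re T - 2 * Im T"
    using cub[OF zS, of "1 + \<i>"] C[of "1 + \<i>"] by (simp add: p T_def)
  moreover have "?C0 - 3 * ?C1 + 3 * ?C2 - ?C3 = - 2 * Re T + 2 * Im T"
    using cub[OF zS, of "1 - \<i>"] C[of "1 - \<i>"] by (simp add: p T_def)
  ultimately have CC: "?C0 = Re T" "?C1 = - Im T" "?C2 = - Re T" "?C3 = Im T" by argo+
  have yx: "Omega (fy z) (pd 1 fx z) = - Im T" "Omega (fy z) (pd \<i> fx z) = - Re T"
    using cc CC by simp_all
  note O = Omega_pd[OF z, of 1 \<i>] Omega_pd[OF z, of \<i> 1] CC yx
  note OC = O[THEN arg_cong[where f = complex_of_real], unfolded Omega_Oc]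
  show "Oc (vdz (complexify \<circ> fh) z) (vcnj (vdz (complexify \<circ> fh) z)) = 0"
    "Oc (vdz (complexify \<circ> fh) z) (vdz (vdz (complexify \<circ> fh)) z) = (t z)\<^sup>2 / 2"
    "Oc (vdz (complexify \<circ> fh) z) (vdzb (vdz (complexify \<circ> fh)) z) = 0"
    "Oc (vdz (complexify \<circ> fh) z) (vcnj (vdz (vdz (complexify \<circ> fh)) z)) = 0"
    unfolding vdz_complexify[OF z] T_def[symmetric]
    by (simp_all add: Oc_simps OC) (simp_all add: complex_eq_iff)
qed

end

lemma d_z_eq: "d_z c F q = dz (in_chart c F) (snd c q)" "d_zbar c F q = dzb (in_chart c F) (snd c q)"
  by (simp_all add: d_z_def d_zbar_def dz_def dzb_def differential_pd)

lemma in_chart_d_z: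
  assumes c: "is_chart c" and z: "z \<in> snd c ` fst c"
  shows "in_chart c (d_z c F) z = dz (in_chart c F) z" "in_chart c (d_zbar c F) z = dzb (in_chart c F) z"
proof -
  obtain q where q: "q \<in> fst c" "z = snd c q" using z by blast
  show "in_chart c (d_z c F) z = dz (in_chart c F) z" "in_chart c (d_zbar c F) z = dzb (in_chart c F) z"
    unfolding q(2) in_chart_apply[OF c q(1)] d_z_eq by (rule refl)+
qed

context lagrangian_chart
begin

lemma tangent_transfer:
  assumes X: "first_order_frame A f U X" "q \<in> U" and q: "q \<in> fst c" "c' \<in> A" "q \<in> fst c'"
  shows "omega_c X q (c, v) = omega_c X q (c', differential (snd c') q (c, v))"
    and "eta_c X q (c, v) = eta_c X q (c', differential (snd c') q (c, v))"
  by (simp_all add: omega_c_def eta_c_def alpha_form_def gamma_form_def theta_form_def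
      differential_from[OF frame_smooth_map(1,2)[OF X(1)] X(2) q, of v])

lemma adapted_forms:
  assumes X: "adapted_frame A f c X" and q: "q \<in> fst c"
  shows "omega_c X q (c, v) = v"
    and "tau_c f X q (c, v) = tau_c f X q (c, 1) * v" and "tau_c f X q (c, 1) \<noteq> 0"
    and "eta_c X q (c, v) = h_coeff A X q * v"
    and "u \<in> tangents A q \<Longrightarrow> eta_c X q u = h_coeff A X q * omega_c X q u"
proof -
  have X3: "third_order_frame A f (fst c) X" using X by (simp add: adapted_frame_def)
  then have X2: "second_order_frame A f (fst c) X" by (simp add: third_order_frame_def)
  then have X1: "first_order_frame A f (fst c) X" by (simp add: second_order_frame_def)
  obtain c' where c': "c' \<in> A" "q \<in> fst c'" using atlas_chart[OF q] .
  let ?S = "\<lambda>v. differential (snd c') q (c, v)"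
  have u: "(c', w) \<in> tangents A q" for w using c' by (simp add: tangents_def)
  note tr = tangent_transfer[OF X1 q q c']
  have om: "omega_c X q u = differential (snd c) q u" if "u \<in> tangents A q" for u
    using X q that unfolding adapted_frame_def by blast
  have W: "omega_c X q (c, v) = v" for v
    unfolding tr(1)[of v] om[OF u] by (rule coordinate_from[OF q c'])
  show "omega_c X q (c, v) = v" by (rule W)
  obtain s where s: "\<And>v. omega_c X q (c, v) = s * tau_c f X q (c, v)"
    using omega_proportional[OF X2 q q] by blast
  have sT: "s * tau_c f X q (c, v) = v" for v using s[of v] unfolding W[of v] by (rule sym)
  note s1 = sT[of 1]
  then have nz: "s \<noteq> 0" "tau_c f X q (c, 1) \<noteq> 0" by auto
  show "tau_c f X q (c, 1) \<noteq> 0" by (rule nz)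
  have "s * (tau_c f X q (c, 1) * v) = s * tau_c f X q (c, v)"
    unfolding mult.assoc[symmetric] s1 sT by simp
  then show "tau_c f X q (c, v) = tau_c f X q (c, 1) * v" using nz by simp
  obtain h where h: "eta_coeffs A X q h 0" using X3 q unfolding third_order_frame_def by blast
  have hu: "h_coeff A X q = h"
    unfolding h_coeff_def
  proof (rule the_equality)
    show "\<exists>l. eta_coeffs A X q h l" using h by blast
    fix h' assume "\<exists>l. eta_coeffs A X q h' l"
    then obtain l where l: "eta_coeffs A X q h' l" by blast
    \<comment> \<open>The values v = 1 and v = \<i> separate the linear from the antilinear part, so
      h is unique although l is left open.\<close>
    have "h * v = h' * v + of_real l * cnj v" for v
    proof -
      have "omega_c X q (c', ?S v) = v" using tr(1)[of v] unfolding W[of v] by (rule sym)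
      moreover have "eta_c X q (c', ?S v) = h * omega_c X q (c', ?S v) + of_real 0 * cnj (omega_c X q (c', ?S v))"
        "eta_c X q (c', ?S v) = h' * omega_c X q (c', ?S v) + of_real l * cnj (omega_c X q (c', ?S v))"
        using h l u unfolding eta_coeffs_def by blast+
      ultimately show ?thesis by simp
    qed
    from this[of 1] this[of \<i>] show "h' = h" by (simp add: complex_eq_iff)
  qed
  show e: "eta_c X q u = h_coeff A X q * omega_c X q u" if "u \<in> tangents A q" for u
    using h that unfolding hu eta_coeffs_def by simp
  show "eta_c X q (c, v) = h_coeff A X q * v"
    unfolding tr(2)[of v] e[OF u] tr(1)[of v, symmetric] W by (rule refl)
qed

text \<open>The coefficient t of \<tau> = t dz as the value of \<tau> on the first coordinate
  vector. Written as a pairing it is visibly smooth, unlike the pointwise description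
  \<open>t_coeff\<close>.\<close>

definition "t_hat X z = Oc (complexify (fx z)) (vcnj (frame_N (in_chart c X z)))"

lemma t_hat:
  assumes X: "adapted_frame A f c X"
  shows "smooth_on Dom (t_hat X)"
    and "q \<in> fst c \<Longrightarrow> t_hat X (snd c q) = tau_c f X q (c, 1)"
    and "z \<in> Dom \<Longrightarrow> t_hat X z \<noteq> 0"
proof -
  have X1: "first_order_frame A f (fst c) X"
    using X by (simp add: adapted_frame_def third_order_frame_def second_order_frame_def)
  have sX: "smooth_on Dom (in_chart c X)" using smooth_hat[OF frame_smooth_map(1,2)[OF X1]] by simp
  show "smooth_on Dom (t_hat X)"
    unfolding t_hat_def [abs_def]
    by (intro smooth_on_bilinear[OF open_Dom bounded_bilinear_Oc] smooth_on_linear[OF open_Dom bounded_linear_complexify]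
        smooth_on_linear[OF open_Dom bounded_linear_vcnj] smooth_on_linear[OF open_Dom bounded_linear_frame_N]
        smooth_on_pd smooth_fh sX)
  have e: "t_hat X (snd c q) = tau_c f X q (c, 1)" if "q \<in> fst c" for q
    using form_pairings(1)[where X = X and q = q and f = f and u = "(c, 1)", OF frame_smooth_map(3)[OF X1 that]]
    by (simp add: t_hat_def differential_pd in_chart_apply[OF chart that])
  then show "q \<in> fst c \<Longrightarrow> t_hat X (snd c q) = tau_c f X q (c, 1)" .
  show "t_hat X z \<noteq> 0" if "z \<in> Dom" using that e adapted_forms(3)[OF X] by auto
qed

lemma adapted_cubic:
  assumes X: "adapted_frame A f c X" and z: "z \<in> Dom"
  shows "Omega (pd v fh z) (pd v (pd v fh) z) = Re ((t_hat X z)\<^sup>2 * v^3)"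
proof -
  obtain q where q: "q \<in> fst c" "z = snd c q" using z by blast
  have X2: "second_order_frame A f (fst c) X"
    using X by (simp add: adapted_frame_def third_order_frame_def)
  show ?thesis
    unfolding q(2) cubic_form_frame[OF X2 q(1) q(1)] adapted_forms(1)[OF X q(1)] adapted_forms(2)[OF X q(1), of v]
      t_hat(2)[OF X q(1)]
    by (simp only: power2_eq_square power3_eq_cube mult.assoc mult.commute mult.left_commute)
qed

text \<open>Genericity is stated for \<eta> of the adapted frame, rigidity for h built from t. The
  two meet in the zbar derivative of E = X_1 + \<i> X_2: pairing it with X_3 + \<i> X_4 gives 2 cnj
  h by the definition of \<eta> and by \<open>E_zb\<close> alike.\<close>

lemma adapted_h:
  assumes X: "adapted_frame A f c X" and z: "z \<in> Dom"
  shows "in_chart c (h_coeff A X) z = dzb (t_hat X) z / cnj (t_hat X z)"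
proof -
  obtain q where q: "q \<in> fst c" "z = snd c q" using z by blast
  have X1: "first_order_frame A f (fst c) X"
    using X by (simp add: adapted_frame_def third_order_frame_def second_order_frame_def)
  note Sp = frame_smooth_map(3)[OF X1 q(1)]
  interpret G: cubic_immersion Dom fh "t_hat X"
    by (rule cubic_immersion_chart[OF open_Dom order_refl t_hat(1)[OF X] t_hat(3)[OF X] adapted_cubic[OF X]])
  let ?Xh = "in_chart c X"
  have sX: "smooth_on Dom ?Xh" using smooth_hat[OF frame_smooth_map(1,2)[OF X1]] by simp
  have GE: "G.E y = frame_E (?Xh y)" if "y \<in> Dom" for y
  proof -
    obtain p where p: "p \<in> fst c" "y = snd c p" using \<open>y \<in> Dom\<close> by blast
    let ?t = "t_hat X y" and ?E = "frame_E (X p)"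
    have d: "complexify (pd v fh y) = (?t * v / 2) *s ?E + (cnj (?t * v) / 2) *s vcnj ?E" for v
      using df_frame[OF X1 p(1) p(1), of v] adapted_forms(2)[OF X p(1), of v] t_hat(2)[OF X p(1)]
      by (simp add: differential_pd p(2))
    have "vdz (complexify \<circ> fh) y = (?t / 2) *s ?E"
      unfolding vdz_complexify(1)[OF that] d[of 1] d[of \<i>] by (simp add: vec_eq_iff algebra_simps)
    then show ?thesis using t_hat(3)[OF X that] by (simp add: G.E_def p(2) in_chart_apply[OF chart p(1)])
  qed
  have pE: "pd v G.E z = frame_E (differential X q (c, v))" for v
  proof -
    have "pd v G.E z = pd v (\<lambda>z. frame_E (?Xh z)) z"
      by (rule pd_cong_open(1)[OF open_Dom z smooth_on_differentiable[OF G.smooth_E z] GE])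
    also have "\<dots> = frame_E (pd v ?Xh z)"
      by (rule pd_linear[OF bounded_linear_frame_E smooth_on_differentiable[OF sX z]])
    finally show ?thesis by (simp add: differential_pd q(2))
  qed
  let ?h = "h_coeff A X q" and ?N = "frame_N (X q)"
  have "vdzb G.E z = (1/2) *s (pd 1 G.E z + \<i> *s pd \<i> G.E z)"
    using smooth_on_differentiable[OF G.smooth_E z]
    by (simp add: vdzb_def dzb_def vec_eq_iff pd_vec_nth)
  then have "2 * Oc (vdzb G.E z) ?N = Oc (pd 1 G.E z) ?N + \<i> * Oc (pd \<i> G.E z) ?N"
    by (simp add: Oc_simps)
  also have "\<dots> = 4 * cnj ?h"
    unfolding pE form_pairings(5)[where X = X and q = q, OF Sp] adapted_forms(4)[OF X q(1), of 1]
      adapted_forms(4)[OF X q(1), of \<i>] by (simp add: algebra_simps)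
  finally have 1: "2 * Oc (vdzb G.E z) ?N = 4 * cnj ?h" .
  have "Oc (vdzb G.E z) ?N = cnj (G.h z) * 2"
    unfolding G.E_zb[OF z] GE[OF z]
    by (simp add: Oc_simps q(2) in_chart_apply[OF chart q(1)] frame_relations'[OF Sp])
  then have "cnj ?h = cnj (G.h z)" using 1 by simp
  then have "?h = G.h z" by simp
  then show ?thesis by (simp add: G.h_def q(2) in_chart_apply[OF chart q(1)])
qed

text \<open>Equality of the Fubini forms is equality of the real cubic forms \<open>\<Omega>(df, d\<^sup>2f)\<close>.\<close>

lemma fubini_cubic:
  assumes X: "adapted_frame A f c X" and f': "elliptic_immersion A f'"
    and eq: "\<forall>q\<in>carrier_of A. \<forall>u\<in>tangents A q. fubini_form A f' q u = fubini_form A f q u" and z: "z \<in> Dom"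
  shows "Omega (pd v (in_chart c f') z) (pd v (pd v (in_chart c f')) z) = Re ((t_hat X z)\<^sup>2 * v^3)"
proof -
  obtain q where q: "q \<in> fst c" "z = snd c q" using z by blast
  obtain c' where c': "c' \<in> A" "q \<in> fst c'" using atlas_chart[OF q(1)] .
  have lag': "lagrangian_immersion A f'" using f' by (simp add: elliptic_immersion_def)
  interpret F: lagrangian_chart A c f' by unfold_locales (rule lag')
  interpret F': lagrangian_chart A c' f'
    using chart_in_atlas[OF c'(1)] lag' by (simp add: lagrangian_chart_def lagrangian_chart_axioms_def)
  obtain U Y where Y: "second_order_frame A f' U Y" "q \<in> U"
    using F'.second_order_frame_exists[OF f' c'] by blast
  have X2: "second_order_frame A f (fst c) X"
    using X by (simp add: adapted_frame_def third_order_frame_def)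
  have "q \<in> carrier_of A" "(c', differential (snd c') q (c, v)) \<in> tangents A q"
    using c' by (auto simp: carrier_of_def tangents_def)
  then have "Re (fubini_form A f' q (c', differential (snd c') q (c, v))) = Re (fubini_form A f q (c', differential (snd c') q (c, v)))"
    using eq by simp
  then show ?thesis
    unfolding F.Re_fubini_form(2)[OF Y q(1) c'] Re_fubini_form(2)[OF X2 q(1) q(1) c'] q(2)[symmetric] adapted_cubic[OF X z] .
qed

end

text \<open>P is given as nonzero at q only, in a chart and frame chosen for q; continuity extends
  this to a convex ball. Uniqueness is stated for all nonempty open subsets because gluing compares
  affine maps on overlaps.\<close>

lemma local_rigidity:
  fixes A :: "'a::{t2_space, second_countable_topology} chart set"
  assumes atlas: "oriented_surface_atlas A" and f: "generic_immersion A f" and f': "elliptic_immersion A f'"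
    and eq: "\<forall>q\<in>carrier_of A. \<forall>u\<in>tangents A q. fubini_form A f' q u = fubini_form A f q u"
    and q: "q \<in> carrier_of A"
  obtains V D where "open V" "q \<in> V" "D \<in> affine_Sp4" "\<And>p. p \<in> V \<Longrightarrow> f' p = affine_act D (f p)"
    "\<forall>W D1 D2. open W \<and> W \<subseteq> V \<and> W \<noteq> {} \<and>
      (\<forall>p\<in>W. affine_act D1 (f p) = affine_act D2 (f p)) \<longrightarrow> D1 = D2"
proof -
  have el: "elliptic_immersion A f" using f by (simp add: generic_immersion_def)
  then have lag: "lagrangian_immersion A f" by (simp add: elliptic_immersion_def)
  have lag': "lagrangian_immersion A f'" using f' by (simp add: elliptic_immersion_def)
  obtain c X where c: "complex_parameter A f c" and X: "adapted_frame A f c X" and qc: "q \<in> fst c"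
    and P: "P_coeff A c X q \<noteq> 0"
    using f q unfolding generic_immersion_def by blast
  interpret lagrangian_surface A f by unfold_locales (rule atlas, rule lag)
  interpret F: lagrangian_chart A c f
    by unfold_locales (use c lag in \<open>auto simp: complex_parameter_def holomorphic_chart_def\<close>)
  interpret F': lagrangian_chart A c f' by unfold_locales (rule lag')
  let ?t = "F.t_hat X"
  interpret G: cubic_immersion F.Dom F.fh ?t
    by (rule F.cubic_immersion_chart[OF F.open_Dom order_refl F.t_hat(1)[OF X] F.t_hat(3)[OF X] F.adapted_cubic[OF X]])
  have h: "in_chart c (h_coeff A X) z = G.h z" if "z \<in> F.Dom" for z
    using F.adapted_h[OF X that] by (simp add: G.h_def)
  have z0: "snd c q \<in> F.Dom" using qc by blast
  have hq: "G.h (snd c q) \<noteq> 0"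
  proof -
    obtain u where u: "u \<in> tangents A q" "hopf_differential A f q u \<noteq> 0"
      using f q unfolding generic_immersion_def by blast
    have X3: "third_order_frame A f (fst c) X" using X by (simp add: adapted_frame_def)
    obtain v where v: "eta_c X q (fst u, v) \<noteq> 0"
      using hopf_nonzero_imp_eta_nonzero[OF el X3 qc u(2,1)] by blast
    have "(fst u, v) \<in> tangents A q" using u by (simp add: tangents_def)
    then have "h_coeff A X q \<noteq> 0" using v F.adapted_forms(5)[OF X qc] by auto
    then show ?thesis using h[OF z0] in_chart_apply[OF F.chart qc] by metis
  qed
  \<comment> \<open>The quotients in P are known to be smooth only where h has no zero, so this set
    is fixed before continuity of P is used.\<close>
  define S1 where "S1 = F.Dom \<inter> G.h -` (- {0})"
  have S1: "open S1" "S1 \<subseteq> F.Dom" "snd c q \<in> S1" "\<And>z. z \<in> S1 \<Longrightarrow> G.h z \<noteq> 0"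
    using continuous_open_preimage[OF smooth_on_continuous[OF G.smooth_h] F.open_Dom open_Compl[OF closed_singleton, of 0]] z0 hq
    unfolding S1_def by simp_all
  interpret S1: plane_domain S1 by unfold_locales (rule S1(1))
  have sh: "smooth_on S1 G.h" by (rule smooth_on_subset[OF G.smooth_h S1(2)])
  define Q1 where "Q1 p = dz (\<lambda>p. cnj (G.h p)) p * inverse (cnj (G.h p))" for p
  define Q2 where "Q2 p = dzb G.h p * inverse (G.h p)" for p
  define Pf where "Pf z = dzb Q1 z - dz Q2 z" for z
  have sQ1: "smooth_on S1 Q1"
    unfolding Q1_def [abs_def] using S1(4)
    by (intro smooth_on_mult S1.smooth_dz S1.smooth_cnj smooth_on_inverse S1(1) sh) auto
  have sQ2: "smooth_on S1 Q2"
    unfolding Q2_def [abs_def] using S1(4)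
    by (intro smooth_on_mult S1.smooth_dzb smooth_on_inverse S1(1) sh) auto
  have Pq: "Pf (snd c q) \<noteq> 0"
  proof -
    let ?h = "h_coeff A X" let ?hb = "\<lambda>p. cnj (?h p)"
    have hb: "in_chart c ?hb z = cnj (G.h z)" if "z \<in> F.Dom" for z
      using h[OF that] by (simp add: in_chart_def)
    have "in_chart c (\<lambda>p. d_z c ?hb p * inverse (?hb p)) z = Q1 z" if z: "z \<in> F.Dom" for z
    proof -
      have "in_chart c (\<lambda>p. d_z c ?hb p * inverse (?hb p)) z = in_chart c (d_z c ?hb) z * inverse (in_chart c ?hb z)"
        by (simp add: in_chart_def)
      also have "in_chart c (d_z c ?hb) z = dz (in_chart c ?hb) z" by (rule in_chart_d_z(1)[OF F.chart z])
      also have "\<dots> = dz (\<lambda>p. cnj (G.h p)) z"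
        by (rule G.dz_cong(1)[OF G.smooth_cnj[OF G.smooth_h] z, symmetric]) (simp add: hb)
      finally show ?thesis by (simp add: Q1_def hb[OF z])
    qed
    then have 1: "dzb (in_chart c (\<lambda>p. d_z c ?hb p * inverse (?hb p))) (snd c q) = dzb Q1 (snd c q)"
      using S1(2) by (intro S1.dz_cong(2)[OF sQ1 S1(3), symmetric]) auto
    have "in_chart c (\<lambda>p. d_zbar c ?h p * inverse (?h p)) z = Q2 z" if z: "z \<in> F.Dom" for z
    proof -
      have "in_chart c (\<lambda>p. d_zbar c ?h p * inverse (?h p)) z = in_chart c (d_zbar c ?h) z * inverse (in_chart c ?h z)"
        by (simp add: in_chart_def)
      also have "in_chart c (d_zbar c ?h) z = dzb (in_chart c ?h) z" by (rule in_chart_d_z(2)[OF F.chart z])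
      also have "\<dots> = dzb G.h z"
        by (rule G.dz_cong(2)[OF G.smooth_h z, symmetric]) (simp add: h)
      finally show ?thesis by (simp add: Q2_def h[OF z])
    qed
    then have 2: "dz (in_chart c (\<lambda>p. d_zbar c ?h p * inverse (?h p))) (snd c q) = dz Q2 (snd c q)"
      using S1(2) by (intro S1.dz_cong(1)[OF sQ2 S1(3), symmetric]) auto
    have "P_coeff A c X q = Pf (snd c q)"
      unfolding P_coeff_def Let_def Pf_def 1[symmetric] 2[symmetric] by (simp only: d_z_eq)
    then show ?thesis using P by simp
  qed
  have "continuous_on S1 Pf"
    unfolding Pf_def [abs_def]
    by (intro smooth_on_continuous smooth_on_diff S1(1) S1.smooth_dz S1.smooth_dzb sQ1 sQ2)
  then have "open (S1 \<inter> Pf -` (- {0}))" using S1(1) by (intro continuous_open_preimage) auto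
  then obtain r where r: "r > 0" "ball (snd c q) r \<subseteq> S1 \<inter> Pf -` (- {0})"
    using S1(3) Pq unfolding open_contains_ball by blast
  define S where "S = ball (snd c q) r"
  have S: "open S" "S \<subseteq> F.Dom" "convex S" "snd c q \<in> S" using r S1(2) by (auto simp: S_def)
  have imm: "cubic_immersion T F.fh ?t" "cubic_immersion T F'.fh ?t" if "open T" "T \<subseteq> S" for T
  proof -
    have TD: "T \<subseteq> F.Dom" using that(2) S(2) by blast
    note t = smooth_on_subset[OF F.t_hat(1)[OF X] TD] F.t_hat(3)[OF X subsetD[OF TD]]
    show "cubic_immersion T F.fh ?t"
      by (rule F.cubic_immersion_chart[OF that(1) TD t F.adapted_cubic[OF X subsetD[OF TD]]])
    show "cubic_immersion T F'.fh ?t"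
      by (rule F'.cubic_immersion_chart[OF that(1) TD t F.fubini_cubic[OF X f' eq subsetD[OF TD]]])
  qed
  interpret pair: cubic_pair S F.fh F'.fh ?t
  proof (intro cubic_pair.intro cubic_pair_axioms.intro)
    show "cubic_immersion S F.fh ?t" "cubic_immersion S F'.fh ?t" by (rule imm[OF S(1) order_refl])+
    show "convex S" by (rule S(3))
    fix z assume "z \<in> S"
    then have z: "z \<in> S1" "Pf z \<noteq> 0" using r(2) unfolding S_def by auto
    show "G.h z \<noteq> 0" by (rule S1(4)[OF z(1)])
    show "dzb (\<lambda>p. dz (\<lambda>p. cnj (G.h p)) p * inverse (cnj (G.h p))) z - dz (\<lambda>p. dzb G.h p * inverse (G.h p)) z \<noteq> 0"
      using z(2) unfolding Pf_def Q1_def [abs_def] Q2_def [abs_def] .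
  qed
  obtain D where D: "D \<in> affine_Sp4" "\<And>z. z \<in> S \<Longrightarrow> F'.fh z = affine_act D (F.fh z)"
    using pair.affine_rigidity S(4) by blast
  define V where "V = fst c \<inter> snd c -` S"
  have oV: "open V"
  proof -
    have "continuous_on (fst c) (snd c)" using F.chart unfolding is_chart_def homeomorphism_def by blast
    then show ?thesis unfolding V_def by (rule continuous_open_preimage[OF _ F.open_dom S(1)])
  qed
  have qV: "q \<in> V" using qc S(4) by (simp add: V_def)
  have act: "f' p = affine_act D (f p)" if "p \<in> V" for p
    using D(2)[of "snd c p"] that by (simp add: V_def in_chart_apply[OF F.chart])
  have unique: "\<forall>W D1 D2. open W \<and> W \<subseteq> V \<and> W \<noteq> {} \<and>
      (\<forall>p\<in>W. affine_act D1 (f p) = affine_act D2 (f p)) \<longrightarrow> D1 = D2"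
  proof (intro allI impI, elim conjE)
    fix W D1 D2
    assume W: "open W" "W \<subseteq> V" "W \<noteq> {}" "\<forall>p\<in>W. affine_act D1 (f p) = affine_act D2 (f p)"
    let ?T = "snd c ` (fst c \<inter> W)"
    interpret T: cubic_immersion ?T F.fh ?t
      by (rule imm(1)[OF open_chart_image[OF F.chart W(1)]]) (use W(2) in \<open>auto simp: V_def\<close>)
    show "D1 = D2"
    proof (rule T.affine_eq)
      show "?T \<noteq> {}" using W(2,3) by (auto simp: V_def)
      show "affine_act D1 (F.fh z) = affine_act D2 (F.fh z)" if "z \<in> ?T" for z
        using that W(4) by (auto simp: in_chart_apply[OF F.chart])
    qed
  qed
  show thesis by (rule that[OF oV qV D(1) act unique])
qed

section \<open>From local to global rigidity\<close>

theorem proposition2: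
  fixes A :: "'a::{t2_space, second_countable_topology} chart set"
    and f f' :: "'a \<Rightarrow> real^4"
  assumes "oriented_surface_atlas A"
    and "connected (carrier_of A)"
    and "simply_connected (carrier_of A)"
    and "generic_immersion A f"
    and "elliptic_immersion A f'"
    and "\<forall>q\<in>carrier_of A. \<forall>u\<in>tangents A q. fubini_form A f' q u = fubini_form A f q u"
  shows "\<exists>D\<in>affine_Sp4. \<forall>q\<in>carrier_of A. f' q = affine_act D (f q)"
proof (cases "carrier_of A = {}")
  case True
  have "mat 1 \<in> Sp4" by (simp add: Sp4_iff transpose_mat)
  then have "(0, mat 1) \<in> affine_Sp4" by (simp add: affine_Sp4_def)
  then show ?thesis using True by blast
next
  case False
  note loc = local_rigidity[OF assms(1,4-6)]
  obtain q0 where q0: "q0 \<in> carrier_of A" using False by blast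
  obtain V0 D where D: "open V0" "q0 \<in> V0" "D \<in> affine_Sp4" "\<And>p. p \<in> V0 \<Longrightarrow> f' p = affine_act D (f p)"
    by (rule loc[OF q0], rule that, assumption+)
  \<comment> \<open>\<open>G\<close> is the open set near whose points the fixed D works,
    \<open>H\<close> its exterior. Connectedness applies once no point of the surface lies on the
    boundary of \<open>G\<close>.\<close>
  define G where "G = {q. \<exists>W. open W \<and> q \<in> W \<and> (\<forall>p\<in>W. f' p = affine_act D (f p))}"
  define H where "H = {q. \<exists>W. open W \<and> q \<in> W \<and> W \<inter> G = {}}"
  have oG: "open G" unfolding G_def by (subst open_subopen) blast
  have oH: "open H" unfolding H_def by (subst open_subopen) blast
  have cover: "carrier_of A \<subseteq> G \<union> H"
  proof
    fix q assume q: "q \<in> carrier_of A"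
    obtain V E where V: "open V" "q \<in> V" "E \<in> affine_Sp4" "\<And>p. p \<in> V \<Longrightarrow> f' p = affine_act E (f p)"
      and u: "\<forall>W D1 D2. open W \<and> W \<subseteq> V \<and> W \<noteq> {} \<and>
        (\<forall>p\<in>W. affine_act D1 (f p) = affine_act D2 (f p)) \<longrightarrow> D1 = D2"
      by (rule loc[OF q], rule that, assumption+)
    show "q \<in> G \<union> H"
    proof (cases "V \<inter> G = {}")
      case True
      then show ?thesis using V(1,2) unfolding H_def by blast
    next
      case False
      then obtain p W where p: "p \<in> V" "open W" "p \<in> W" "\<And>x. x \<in> W \<Longrightarrow> f' x = affine_act D (f x)"
        unfolding G_def by blast
      \<comment> \<open>On the overlap both maps carry f to f'; agreement on one nonempty open set
        identifies them, so D works on all of V.\<close>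
      have "D = E"
      proof (rule u[rule_format], intro conjI ballI)
        show "open (V \<inter> W)" "V \<inter> W \<subseteq> V" "V \<inter> W \<noteq> {}" using p V(1) by auto
        show "affine_act D (f x) = affine_act E (f x)" if "x \<in> V \<inter> W" for x
          using that p(4)[of x] V(4)[of x] by simp
      qed
      then have "open V \<and> q \<in> V \<and> (\<forall>p\<in>V. f' p = affine_act D (f p))" using V(1,2,4) by simp
      then show ?thesis unfolding G_def by blast
    qed
  qed
  have "G \<inter> H \<inter> carrier_of A = {}" unfolding H_def by blast
  from connectedD[OF assms(2) oG oH this cover]
  have "H \<inter> carrier_of A = {}"
  proof
    assume "G \<inter> carrier_of A = {}"
    moreover have "q0 \<in> G" using D(1,2,4) unfolding G_def by blast
    ultimately show ?thesis using q0 by blast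
  qed
  then have "carrier_of A \<subseteq> G" using cover by blast
  then have "\<forall>q\<in>carrier_of A. f' q = affine_act D (f q)" unfolding G_def by blast
  then show ?thesis using D(3) by blast
qed

end
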